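(* Let $(G,g)$ be a Lie group equipped with a left-invariant Riemannian metric $g$, and let $K$ be a semisimple normal subgroup of $G$ generating a left-invariant conformal foliation $\mathcal{F}$ on $G$. If the restriction of the metric $g$ to $K$ is biinvariant (i.e. invariant under both left and right translations by elements of $K$), then the foliation $\mathcal{F}$ has totally geodesic leaves.
   Context: A Riemannian Lie group $(G,g)$ is a Lie group $G$ with a left-invariant Riemannian metric $g$. A subgroup $K$ of $G$ means a Lie subgroup, with Lie algebra $\mathfrak{k}\subset\mathfrak{g}$; $K$ is semisimple if $\mathfrak{k}$ is semisimple. The left-invariant foliation $\mathcal{F}$ generated by $K$ is the foliation tangent to the left-invariant (integrable) distribution $\mathcal{V}$ on $G$ whose value at the identity is $\mathfrak{k}$. Let $\mathcal{H}$ be the orthogonal complement of $\mathcal{V}$ in $TG$ with respect to $g$; $\mathcal{V}$ and $\mathcal{H}$ also denote the orthogonal projections onto these subbundles. With $\nabla$ the Levi-Civita connection of $g$, the second fundamental forms are $$B^{\mathcal{V}}(V,W)=\tfrac12\,\mathcal{H}(\nabla_V W+\nabla_W V)\ \ (V,W\in\mathcal{V}),\qquad B^{\mathcal{H}}(X,Y)=\tfrac12\,\mathcal{V}(\nabla_X Y+\nabla_Y X)\ \ (X,Y\in\mathcal{H}).$$ The foliation $\mathcal{F}$ is conformal if there is a vertical vector field $V\in\mathcal{V}$ with $B^{\mathcal{H}}=g\otimes V$, i.e. $B^{\mathcal H}(X,Y)=g(X,Y)\,V$ for all $X,Y\in\mathcal H$. It has totally geodesic leaves (is totally geodesic) if $B^{\mathcal{V}}=0$.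 *)

theory Defs
  imports "HOL-Analysis.Analysis" "HOL-Algebra.Coset"
begin

section \<open>Smooth manifolds\<close>

text \<open>\<open>C\<^sup>n\<close>- and \<open>C\<^sup>\<infinity>\<close>-maps between normed spaces, used for open \<open>S\<close> only.\<close>

primrec C_on :: "nat \<Rightarrow> 'a::real_normed_vector set \<Rightarrow> ('a \<Rightarrow> 'b::real_normed_vector) \<Rightarrow> bool" where
  "C_on 0 S f \<longleftrightarrow> continuous_on S f"
| "C_on (Suc n) S f \<longleftrightarrow> (\<forall>x\<in>S. f differentiable (at x)) \<and>
     (\<forall>v. C_on n S (\<lambda>x. frechet_derivative f (at x) v))"

definition smooth_on :: "'a::real_normed_vector set \<Rightarrow> ('a \<Rightarrow> 'b::real_normed_vector) \<Rightarrow> bool" where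
  "smooth_on S f \<longleftrightarrow> (\<forall>n. C_on n S f)"

text \<open>A chart is a pair of a domain and a coordinate map; the values of the coordinate map outside
  the domain are irrelevant.\<close>

type_synonym ('a, 'e) chart = "'a set \<times> ('a \<Rightarrow> 'e)"

definition chart_inv :: "('a, 'e) chart \<Rightarrow> 'e \<Rightarrow> 'a" where
  "chart_inv c = inv_into (fst c) (snd c)"

record ('a, 'e) manifold =
  mtop :: "'a topology"
  atlas :: "('a, 'e) chart set"

definition smooth_manifold :: "('a, 'e::euclidean_space) manifold \<Rightarrow> bool" where
  "smooth_manifold M \<longleftrightarrow>
     Hausdorff_space (mtop M) \<and> second_countable (mtop M) \<and>
     (\<Union>c\<in>atlas M. fst c) = topspace (mtop M) \<and>
     (\<forall>c\<in>atlas M. openin (mtop M) (fst c) \<and> open (snd c ` fst c) \<and>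
        homeomorphic_map (subtopology (mtop M) (fst c)) (top_of_set (snd c ` fst c)) (snd c)) \<and>
     (\<forall>c\<in>atlas M. \<forall>d\<in>atlas M. smooth_on (snd c ` (fst c \<inter> fst d)) (snd d \<circ> chart_inv c))"

definition prod_manifold :: "('a, 'e) manifold \<Rightarrow> ('b, 'f) manifold \<Rightarrow> ('a \<times> 'b, 'e \<times> 'f) manifold" where
  "prod_manifold M N =
     \<lparr>mtop = prod_topology (mtop M) (mtop N),
      atlas = {(fst c \<times> fst d, map_prod (snd c) (snd d)) | c d. c \<in> atlas M \<and> d \<in> atlas N}\<rparr>"

definition smooth_map ::
    "('a, 'e::euclidean_space) manifold \<Rightarrow> ('b, 'f::euclidean_space) manifold \<Rightarrow> ('a \<Rightarrow> 'b) \<Rightarrow> bool" where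
  "smooth_map M N f \<longleftrightarrow> continuous_map (mtop M) (mtop N) f \<and>
     (\<forall>c\<in>atlas M. \<forall>d\<in>atlas N. smooth_on (snd c ` (fst c \<inter> f -` fst d)) (snd d \<circ> f \<circ> chart_inv c))"

definition smooth_fun :: "('a, 'e::euclidean_space) manifold \<Rightarrow> ('a \<Rightarrow> real) \<Rightarrow> bool" where
  "smooth_fun M f \<longleftrightarrow> (\<forall>c\<in>atlas M. smooth_on (snd c ` fst c) (f \<circ> chart_inv c))"

section \<open>Tangent vectors and vector fields\<close>

text \<open>For every point \<open>p\<close> a chart \<open>chart_at M p\<close> around \<open>p\<close> is selected once and for all.  The tangent
  space at \<open>p\<close> is the model space \<^typ>\<open>'e\<close>, a vector being given by its components in
  \<open>chart_at M p\<close>.  The selected chart may jump from point to point, so a vector field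
  \<open>X :: 'a \<Rightarrow> 'e\<close> must not be differentiated directly but only after passing to the components
  \<open>coord M c X\<close> in one fixed chart \<open>c\<close>.  Values outside \<open>topspace (mtop M)\<close> are irrelevant.\<close>

definition chart_at :: "('a, 'e) manifold \<Rightarrow> 'a \<Rightarrow> ('a, 'e) chart" where
  "chart_at M p = (SOME c. c \<in> atlas M \<and> p \<in> fst c)"

definition coord_at :: "('a, 'e) manifold \<Rightarrow> 'a \<Rightarrow> 'e" where
  "coord_at M p = snd (chart_at M p) p"

definition tangent_map ::
    "('a, 'e::euclidean_space) manifold \<Rightarrow> ('b, 'f::euclidean_space) manifold \<Rightarrow> ('a \<Rightarrow> 'b) \<Rightarrow> 'a \<Rightarrow> 'e \<Rightarrow> 'f" where
  "tangent_map M N f p =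
     frechet_derivative (snd (chart_at N (f p)) \<circ> f \<circ> chart_inv (chart_at M p)) (at (coord_at M p))"

definition coord :: "('a, 'e::euclidean_space) manifold \<Rightarrow> ('a, 'e) chart \<Rightarrow> ('a \<Rightarrow> 'e) \<Rightarrow> 'e \<Rightarrow> 'e" where
  "coord M c X y = (let q = chart_inv c y in
     frechet_derivative (snd c \<circ> chart_inv (chart_at M q)) (at (coord_at M q)) (X q))"

definition smooth_vf :: "('a, 'e::euclidean_space) manifold \<Rightarrow> ('a \<Rightarrow> 'e) \<Rightarrow> bool" where
  "smooth_vf M X \<longleftrightarrow> (\<forall>c\<in>atlas M. smooth_on (snd c ` fst c) (coord M c X))"

definition vf_deriv :: "('a, 'e::euclidean_space) manifold \<Rightarrow> ('a \<Rightarrow> 'e) \<Rightarrow> ('a \<Rightarrow> real) \<Rightarrow> 'a \<Rightarrow> real" where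
  "vf_deriv M X f p = frechet_derivative (f \<circ> chart_inv (chart_at M p)) (at (coord_at M p)) (X p)"

definition vf_bracket :: "('a, 'e::euclidean_space) manifold \<Rightarrow> ('a \<Rightarrow> 'e) \<Rightarrow> ('a \<Rightarrow> 'e) \<Rightarrow> 'a \<Rightarrow> 'e" where
  "vf_bracket M X Y p =
     frechet_derivative (coord M (chart_at M p) Y) (at (coord_at M p)) (X p) -
     frechet_derivative (coord M (chart_at M p) X) (at (coord_at M p)) (Y p)"

section \<open>Riemannian metrics and the Levi-Civita connection\<close>

type_synonym ('a, 'e) metric = "'a \<Rightarrow> 'e \<Rightarrow> 'e \<Rightarrow> real"
type_synonym ('a, 'e) connection = "('a \<Rightarrow> 'e) \<Rightarrow> ('a \<Rightarrow> 'e) \<Rightarrow> 'a \<Rightarrow> 'e"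

definition riemannian_metric :: "('a, 'e::euclidean_space) manifold \<Rightarrow> ('a, 'e) metric \<Rightarrow> bool" where
  "riemannian_metric M g \<longleftrightarrow>
     (\<forall>p\<in>topspace (mtop M). bilinear (g p) \<and> (\<forall>u v. g p u v = g p v u) \<and> (\<forall>v. v \<noteq> 0 \<longrightarrow> 0 < g p v v)) \<and>
     (\<forall>X Y. smooth_vf M X \<longrightarrow> smooth_vf M Y \<longrightarrow> smooth_fun M (\<lambda>p. g p (X p) (Y p)))"

definition affine_connection :: "('a, 'e::euclidean_space) manifold \<Rightarrow> ('a, 'e) connection \<Rightarrow> bool" where
  "affine_connection M nab \<longleftrightarrow>
     (\<forall>X Y. smooth_vf M X \<longrightarrow> smooth_vf M Y \<longrightarrow> smooth_vf M (nab X Y)) \<and>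
     (\<forall>X Y Z. smooth_vf M X \<longrightarrow> smooth_vf M Y \<longrightarrow> smooth_vf M Z \<longrightarrow>
        (\<forall>p\<in>topspace (mtop M).
           nab (\<lambda>q. X q + Y q) Z p = nab X Z p + nab Y Z p \<and>
           nab X (\<lambda>q. Y q + Z q) p = nab X Y p + nab X Z p)) \<and>
     (\<forall>f X Y. smooth_fun M f \<longrightarrow> smooth_vf M X \<longrightarrow> smooth_vf M Y \<longrightarrow>
        (\<forall>p\<in>topspace (mtop M).
           nab (\<lambda>q. f q *\<^sub>R X q) Y p = f p *\<^sub>R nab X Y p \<and>
           nab X (\<lambda>q. f q *\<^sub>R Y q) p = vf_deriv M X f p *\<^sub>R Y p + f p *\<^sub>R nab X Y p))"

definition levi_civita_connection ::
    "('a, 'e::euclidean_space) manifold \<Rightarrow> ('a, 'e) metric \<Rightarrow> ('a, 'e) connection \<Rightarrow> bool" where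
  "levi_civita_connection M g nab \<longleftrightarrow> affine_connection M nab \<and>
     (\<forall>X Y. smooth_vf M X \<longrightarrow> smooth_vf M Y \<longrightarrow>
        (\<forall>p\<in>topspace (mtop M). nab X Y p - nab Y X p = vf_bracket M X Y p)) \<and>
     (\<forall>X Y Z. smooth_vf M X \<longrightarrow> smooth_vf M Y \<longrightarrow> smooth_vf M Z \<longrightarrow>
        (\<forall>p\<in>topspace (mtop M).
           vf_deriv M X (\<lambda>q. g q (Y q) (Z q)) p = g p (nab X Y p) (Z p) + g p (Y p) (nab X Z p)))"

section \<open>Conformal and totally geodesic foliations\<close>

text \<open>A foliation enters through its tangent distribution \<open>D\<close>, which assigns to every point the
  tangent space of the leaf through it.\<close>

type_synonym ('a, 'e) distribution = "'a \<Rightarrow> 'e set"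

definition horizontal :: "('a, 'e) metric \<Rightarrow> ('a, 'e) distribution \<Rightarrow> ('a, 'e) distribution" where
  "horizontal g D p = {w. \<forall>v\<in>D p. g p w v = 0}"

definition section_of :: "('a, 'e::euclidean_space) manifold \<Rightarrow> ('a, 'e) distribution \<Rightarrow> ('a \<Rightarrow> 'e) \<Rightarrow> bool" where
  "section_of M D X \<longleftrightarrow> smooth_vf M X \<and> (\<forall>p\<in>topspace (mtop M). X p \<in> D p)"

definition orth_proj :: "('e \<Rightarrow> 'e \<Rightarrow> real) \<Rightarrow> 'e set \<Rightarrow> 'e::real_vector \<Rightarrow> 'e" where
  "orth_proj b S v = (THE w. w \<in> S \<and> (\<forall>u\<in>S. b (v - w) u = 0))"

text \<open>The form \<open>B\<^sup>\<V>\<close> is obtained with \<open>E = horizontal g D\<close>, and \<open>B\<^sup>\<H>\<close> with \<open>E = D\<close>.\<close>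

definition second_fundamental_form ::
    "('a, 'e) metric \<Rightarrow> ('a, 'e) connection \<Rightarrow> ('a, 'e) distribution
      \<Rightarrow> ('a \<Rightarrow> 'e) \<Rightarrow> ('a \<Rightarrow> 'e) \<Rightarrow> 'a \<Rightarrow> 'e::euclidean_space" where
  "second_fundamental_form g nab E X Y p = (1 / 2) *\<^sub>R orth_proj (g p) (E p) (nab X Y p + nab Y X p)"

definition conformal_foliation ::
    "('a, 'e::euclidean_space) manifold \<Rightarrow> ('a, 'e) metric \<Rightarrow> ('a, 'e) connection \<Rightarrow> ('a, 'e) distribution \<Rightarrow> bool" where
  "conformal_foliation M g nab D \<longleftrightarrow>
     (\<exists>V. section_of M D V \<and>
        (\<forall>X Y. section_of M (horizontal g D) X \<longrightarrow> section_of M (horizontal g D) Y \<longrightarrow>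
           (\<forall>p\<in>topspace (mtop M).
              second_fundamental_form g nab D X Y p = g p (X p) (Y p) *\<^sub>R V p)))"

definition totally_geodesic_foliation ::
    "('a, 'e::euclidean_space) manifold \<Rightarrow> ('a, 'e) metric \<Rightarrow> ('a, 'e) connection \<Rightarrow> ('a, 'e) distribution \<Rightarrow> bool" where
  "totally_geodesic_foliation M g nab D \<longleftrightarrow>
     (\<forall>V W. section_of M D V \<longrightarrow> section_of M D W \<longrightarrow>
        (\<forall>p\<in>topspace (mtop M). second_fundamental_form g nab (horizontal g D) V W p = 0))"

section \<open>Lie groups\<close>

definition lie_group :: "('a, 'm) monoid_scheme \<Rightarrow> ('a, 'e::euclidean_space) manifold \<Rightarrow> bool" where
  "lie_group G M \<longleftrightarrow> group G \<and> smooth_manifold M \<and> topspace (mtop M) = carrier G \<and>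
     smooth_map (prod_manifold M M) M (\<lambda>(x, y). x \<otimes>\<^bsub>G\<^esub> y) \<and>
     smooth_map M M (\<lambda>x. inv\<^bsub>G\<^esub> x)"

text \<open>A Lie subgroup need not be closed: it is a subgroup with a Lie group structure \<open>N\<close> of its own,
  possibly with a finer topology, for which the inclusion is an immersion.\<close>

definition lie_subgroup ::
    "'a set \<Rightarrow> ('a, 'f::euclidean_space) manifold \<Rightarrow> ('a, 'm) monoid_scheme \<Rightarrow> ('a, 'e::euclidean_space) manifold \<Rightarrow> bool" where
  "lie_subgroup K N G M \<longleftrightarrow> subgroup K G \<and> lie_group (G\<lparr>carrier := K\<rparr>) N \<and>
     smooth_map N M (\<lambda>x. x) \<and> (\<forall>p\<in>K. inj (tangent_map N M (\<lambda>x. x) p))"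

definition left_invariant_metric ::
    "('a, 'm) monoid_scheme \<Rightarrow> ('a, 'e::euclidean_space) manifold \<Rightarrow> ('a, 'e) metric \<Rightarrow> bool" where
  "left_invariant_metric G M g \<longleftrightarrow> (\<forall>a\<in>carrier G. \<forall>x\<in>carrier G. \<forall>u v.
     g (a \<otimes>\<^bsub>G\<^esub> x) (tangent_map M M (\<lambda>y. a \<otimes>\<^bsub>G\<^esub> y) x u) (tangent_map M M (\<lambda>y. a \<otimes>\<^bsub>G\<^esub> y) x v) = g x u v)"

definition right_invariant_metric ::
    "('a, 'm) monoid_scheme \<Rightarrow> ('a, 'e::euclidean_space) manifold \<Rightarrow> ('a, 'e) metric \<Rightarrow> bool" where
  "right_invariant_metric G M g \<longleftrightarrow> (\<forall>a\<in>carrier G. \<forall>x\<in>carrier G. \<forall>u v.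
     g (x \<otimes>\<^bsub>G\<^esub> a) (tangent_map M M (\<lambda>y. y \<otimes>\<^bsub>G\<^esub> a) x u) (tangent_map M M (\<lambda>y. y \<otimes>\<^bsub>G\<^esub> a) x v) = g x u v)"

definition biinvariant_metric ::
    "('a, 'm) monoid_scheme \<Rightarrow> ('a, 'e::euclidean_space) manifold \<Rightarrow> ('a, 'e) metric \<Rightarrow> bool" where
  "biinvariant_metric G M g \<longleftrightarrow> left_invariant_metric G M g \<and> right_invariant_metric G M g"

definition restrict_metric ::
    "('a, 'f::euclidean_space) manifold \<Rightarrow> ('a, 'e::euclidean_space) manifold \<Rightarrow> ('a, 'e) metric \<Rightarrow> ('a, 'f) metric" where
  "restrict_metric N M g p u v = g p (tangent_map N M (\<lambda>x. x) p u) (tangent_map N M (\<lambda>x. x) p v)"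

text \<open>The Lie algebra of \<open>G\<close> is the tangent space at \<open>\<one>\<close>, with the bracket of left-invariant fields.\<close>

definition left_invariant_vf ::
    "('a, 'm) monoid_scheme \<Rightarrow> ('a, 'e::euclidean_space) manifold \<Rightarrow> 'e \<Rightarrow> 'a \<Rightarrow> 'e" where
  "left_invariant_vf G M u p = tangent_map M M (\<lambda>y. p \<otimes>\<^bsub>G\<^esub> y) \<one>\<^bsub>G\<^esub> u"

definition lie_bracket ::
    "('a, 'm) monoid_scheme \<Rightarrow> ('a, 'e::euclidean_space) manifold \<Rightarrow> 'e \<Rightarrow> 'e \<Rightarrow> 'e" where
  "lie_bracket G M u v = vf_bracket M (left_invariant_vf G M u) (left_invariant_vf G M v) \<one>\<^bsub>G\<^esub>"

definition lie_subalgebra_of ::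
    "('a, 'f::euclidean_space) manifold \<Rightarrow> ('a, 'm) monoid_scheme \<Rightarrow> ('a, 'e::euclidean_space) manifold \<Rightarrow> 'e set" where
  "lie_subalgebra_of N G M = range (tangent_map N M (\<lambda>x. x) \<one>\<^bsub>G\<^esub>)"

definition left_invariant_distribution ::
    "('a, 'm) monoid_scheme \<Rightarrow> ('a, 'e::euclidean_space) manifold \<Rightarrow> 'e set \<Rightarrow> ('a, 'e) distribution" where
  "left_invariant_distribution G M S p = (\<lambda>u. left_invariant_vf G M u p) ` S"

section \<open>Semisimple Lie algebras\<close>

text \<open>A Lie algebra is given by a subspace \<open>L\<close> closed under the bracket \<open>br\<close>.\<close>

definition lie_ideal :: "('e::real_vector \<Rightarrow> 'e \<Rightarrow> 'e) \<Rightarrow> 'e set \<Rightarrow> 'e set \<Rightarrow> bool" where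
  "lie_ideal br L I \<longleftrightarrow> subspace I \<and> I \<subseteq> L \<and> (\<forall>x\<in>L. \<forall>y\<in>I. br x y \<in> I)"

definition lie_derived :: "('e::real_vector \<Rightarrow> 'e \<Rightarrow> 'e) \<Rightarrow> 'e set \<Rightarrow> 'e set" where
  "lie_derived br I = span {br x y | x y. x \<in> I \<and> y \<in> I}"

definition lie_solvable :: "('e::real_vector \<Rightarrow> 'e \<Rightarrow> 'e) \<Rightarrow> 'e set \<Rightarrow> bool" where
  "lie_solvable br I \<longleftrightarrow> (\<exists>n. (lie_derived br ^^ n) I = {0})"

definition lie_semisimple :: "('e::real_vector \<Rightarrow> 'e \<Rightarrow> 'e) \<Rightarrow> 'e set \<Rightarrow> bool" where
  "lie_semisimple br L \<longleftrightarrow> (\<forall>I. lie_ideal br L I \<longrightarrow> lie_solvable br I \<longrightarrow> I = {0})"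

end

theory Submission
  imports Defs
begin

text \<open>Write \<open>\<kk>\<close> for the Lie algebra of \<open>K\<close>.  For left-invariant \<open>V, W\<close> in \<open>\<kk>\<close> and \<open>X\<close> orthogonal to \<open>\<kk>\<close>,
  the Koszul formula gives \<open>g (\<nabla>\<^sub>V W + \<nabla>\<^sub>W V) X = g [X, V] W + g V [X, W]\<close>, because \<open>\<kk>\<close> is an ideal.
  So the leaves are totally geodesic if \<open>ad X\<close> is skew on \<open>\<kk>\<close>.  Biinvariance makes \<open>ad C\<close> skew on \<open>\<kk>\<close>
  for every \<open>C\<close> in \<open>\<kk>\<close>, and \<open>ad X\<close> restricted to \<open>\<kk>\<close> is such an \<open>ad C\<close>: a derivation of a
  centreless Lie algebra with an ad-invariant inner product is inner.

  As \<open>K\<close> need not be closed, that \<open>\<kk>\<close> is an ideal is not immediate.  A right-invariant field with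
  value in \<open>\<kk>\<close> at \<open>\<one>\<close> is tangent to the left-invariant foliation, because otherwise uncountably many
  translates of an open subset of \<open>K\<close> would be disjoint.  It commutes with every left-invariant field,
  and differentiating its coefficients in a vertical left-invariant frame yields the ideal property.\<close>


section \<open>Smooth maps between Euclidean spaces\<close>

text \<open>The connection is given only through its action on globally defined fields, and
  functions that agree on the group may still differ outside it. Arguments by locality are therefore
  replaced by global algebra: vertical fields are expanded in an orthonormal left-invariant frame,
  whose coefficients are inner products and hence smooth. Right-invariant fields also explain the
  skewness of \<open>ad C\<close>. Biinvariance makes the inner product of two such fields with
  values in \<kk> at \<one> constant along \<open>K\<close>, and its derivative at \<one> becomes a
  bracket identity because these fields commute there with left-invariant ones. Neither the
  exponential map nor the adjoint representation of the group appears. Semisimplicity acts through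
  the centre of \<kk>, an abelian ideal and hence zero. This makes the Hilbert-Schmidt product of
  inner derivations definite on \<kk>; the invariant inner product takes the place of the Killing
  form.\<close>

abbreviation deriv_at :: "('a::real_normed_vector \<Rightarrow> 'b::real_normed_vector) \<Rightarrow> 'a \<Rightarrow> 'a \<Rightarrow> 'b"
  where "deriv_at f x \<equiv> frechet_derivative f (at x)"

lemma deriv_at_eqI: "(f has_derivative f') (at x) \<Longrightarrow> deriv_at f x = f'"
  by (metis frechet_derivative_at)

lemma has_derivative_deriv_at: "f differentiable (at x) \<Longrightarrow> (f has_derivative deriv_at f x) (at x)"
  by (simp add: frechet_derivative_works)

lemma linear_deriv_at: "f differentiable (at x) \<Longrightarrow> linear (deriv_at f x)"
  using has_derivative_deriv_at has_derivative_linear by blast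

lemma has_derivative_cong_open:
  assumes "open S" "x \<in> S" "\<And>y. y \<in> S \<Longrightarrow> f y = g y"
  shows "(f has_derivative f') (at x) \<longleftrightarrow> (g has_derivative f') (at x)"
  using assms by (metis has_derivative_transform_within_open)

lemma differentiable_cong_open:
  assumes "open S" "x \<in> S" "\<And>y. y \<in> S \<Longrightarrow> f y = g y"
  shows "f differentiable (at x) \<longleftrightarrow> g differentiable (at x)"
  unfolding differentiable_def using has_derivative_cong_open[OF assms] by simp

lemma deriv_at_cong_open:
  assumes "open S" "x \<in> S" "\<And>y. y \<in> S \<Longrightarrow> f y = g y"
  shows "deriv_at f x = deriv_at g x"
  unfolding frechet_derivative_def using has_derivative_cong_open[OF assms] by simp

section \<open>Regularity under algebraic operations and composition\<close>

lemma C_on_cong: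
  assumes "open S" "\<And>x. x \<in> S \<Longrightarrow> f x = g x"
  shows "C_on n S f \<longleftrightarrow> C_on n S g"
  using assms(2)
proof (induction n arbitrary: f g)
  case 0
  then show ?case by (simp cong: continuous_on_cong)
next
  case (Suc n)
  have "C_on n S (\<lambda>x. deriv_at f x v) \<longleftrightarrow> C_on n S (\<lambda>x. deriv_at g x v)" for v
    by (rule Suc.IH) (simp add: deriv_at_cong_open[OF assms(1) _ Suc.prems])
  then show ?case
    using differentiable_cong_open[OF assms(1) _ Suc.prems] by auto
qed

lemma C_on_subset: "C_on n S f \<Longrightarrow> T \<subseteq> S \<Longrightarrow> C_on n T f"
  by (induction n arbitrary: f) (auto intro: continuous_on_subset)

lemma C_on_Suc_lower: "C_on (Suc n) S f \<Longrightarrow> C_on n S f"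
proof (induction n arbitrary: f)
  case 0
  then show ?case
    by (auto intro!: differentiable_imp_continuous_on differentiable_at_imp_differentiable_on)
next
  case (Suc n)
  then show ?case by (metis C_on.simps(2))
qed

lemma C_on_const: "C_on n S (\<lambda>x. c)"
  by (induction n arbitrary: c) auto

lemma C_on_linear:
  fixes f :: "'a::euclidean_space \<Rightarrow> 'b::real_normed_vector"
  assumes "linear f" shows "C_on n S f"
proof -
  have bl: "bounded_linear f" using assms by (simp add: linear_conv_bounded_linear)
  then have d: "(f has_derivative f) (at x)" for x
    by (rule bounded_linear_imp_has_derivative)
  then have D: "deriv_at f x = f" for x
    by (rule deriv_at_eqI)
  show ?thesis
  proof (cases n)
    case 0
    then show ?thesis using bl by (simp add: linear_continuous_on)
  next
    case (Suc m)
    then show ?thesis using d by (auto simp: D C_on_const differentiable_def)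
  qed
qed

lemma C_on_add:
  assumes "open S" "C_on n S f" "C_on n S g"
  shows "C_on n S (\<lambda>x. f x + g x)"
  using assms(2,3)
proof (induction n arbitrary: f g)
  case 0
  then show ?case by (simp add: continuous_on_add)
next
  case (Suc n)
  have "deriv_at (\<lambda>x. f x + g x) x v = deriv_at f x v + deriv_at g x v" if "x \<in> S" for x v
    using Suc.prems that
    by (subst deriv_at_eqI[OF has_derivative_add[OF has_derivative_deriv_at has_derivative_deriv_at]]) auto
  then have "C_on n S (\<lambda>x. deriv_at (\<lambda>x. f x + g x) x v)" for v
    using Suc by (subst C_on_cong[OF assms(1)]) auto
  then show ?case using Suc.prems by (auto intro: differentiable_add)
qed

lemma C_on_linear_comp:
  fixes L :: "'b::euclidean_space \<Rightarrow> 'c::real_normed_vector"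
  assumes "open S" "C_on n S f" "linear L"
  shows "C_on n S (\<lambda>x. L (f x))"
  using assms(2)
proof (induction n arbitrary: f)
  case 0
  then show ?case
    using continuous_on_compose2[OF linear_continuous_on[of L UNIV]] assms(3)
    by (auto simp: linear_conv_bounded_linear)
next
  case (Suc n)
  have bl: "bounded_linear L" using assms(3) by (simp add: linear_conv_bounded_linear)
  have d: "((\<lambda>x. L (f x)) has_derivative (\<lambda>v. L (deriv_at f x v))) (at x)" if "x \<in> S" for x
    using Suc.prems that by (intro bounded_linear.has_derivative[OF bl] has_derivative_deriv_at) auto
  then have "C_on n S (\<lambda>x. deriv_at (\<lambda>x. L (f x)) x v)" for v
    using Suc by (subst C_on_cong[OF assms(1), where g="\<lambda>x. L (deriv_at f x v)"]) (auto simp: deriv_at_eqI[OF d])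
  then show ?case using d by (auto simp: differentiable_def)
qed

lemma C_on_scaleR:
  fixes f :: "'a::real_normed_vector \<Rightarrow> real"
  assumes "open S" "C_on n S f" "C_on n S g"
  shows "C_on n S (\<lambda>x. f x *\<^sub>R g x)"
  using assms(2,3)
proof (induction n arbitrary: f g)
  case 0
  then show ?case by (simp add: continuous_on_scaleR)
next
  case (Suc n)
  have d: "((\<lambda>x. f x *\<^sub>R g x) has_derivative (\<lambda>v. f x *\<^sub>R deriv_at g x v + deriv_at f x v *\<^sub>R g x)) (at x)"
    if "x \<in> S" for x
    using Suc.prems that by (intro has_derivative_scaleR has_derivative_deriv_at) auto
  \<comment> \<open>The product rule also contains the undifferentiated factors, whose order is
    lowered to that of the induction hypothesis.\<close>
  have "C_on n S f" "C_on n S g"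
    using Suc.prems C_on_Suc_lower by blast+
  then have "C_on n S (\<lambda>x. f x *\<^sub>R deriv_at g x v + deriv_at f x v *\<^sub>R g x)" for v
    using Suc by (intro C_on_add assms(1) Suc.IH) auto
  then have "C_on n S (\<lambda>x. deriv_at (\<lambda>x. f x *\<^sub>R g x) x v)" for v
    by (subst C_on_cong[OF assms(1)]) (auto simp: deriv_at_eqI[OF d])
  then show ?case using d by (auto simp: differentiable_def)
qed

lemma C_on_sum:
  assumes "open S" "finite I" "\<And>i. i \<in> I \<Longrightarrow> C_on n S (f i)"
  shows "C_on n S (\<lambda>x. \<Sum>i\<in>I. f i x)"
  using assms(2,3)
proof (induction I rule: finite_induct)
  case empty
  then show ?case by (simp add: C_on_const)
next
  case (insert i I)
  then show ?case by (auto intro!: C_on_add[OF assms(1)])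
qed

lemma linear_Basis_expand:
  fixes L :: "'a::euclidean_space \<Rightarrow> 'b::real_vector"
  assumes "linear L" shows "L v = (\<Sum>b\<in>Basis. (v \<bullet> b) *\<^sub>R L b)"
proof -
  have "L v = L (\<Sum>b\<in>Basis. (v \<bullet> b) *\<^sub>R b)"
    by (simp add: euclidean_representation)
  then show ?thesis
    by (simp add: linear_sum[OF assms] linear_cmul[OF assms])
qed

text \<open>The chain rule differentiates \<open>g\<close> in the direction
  \<open>deriv_at f x v\<close>, which moves with \<open>x\<close>, while \<open>C_on\<close> only
  controls derivatives in fixed directions. Expanding the direction in \<open>Basis\<close> leaves
  fixed directions with scalar coefficients, to which the product rule and the induction hypothesis
  for the derivatives of \<open>g\<close> apply.\<close>

lemma C_on_compose:
  fixes f :: "'a::real_normed_vector \<Rightarrow> 'b::euclidean_space"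
  assumes "open S" "open T" "f ` S \<subseteq> T" "C_on n S f" "C_on n T g"
  shows "C_on n S (\<lambda>x. g (f x))"
  using assms(4,5)
proof (induction n arbitrary: g)
  case 0
  then show ?case using assms(3) by (auto intro: continuous_on_compose2)
next
  case (Suc n)
  have d: "((\<lambda>x. g (f x)) has_derivative (\<lambda>v. deriv_at g (f x) (deriv_at f x v))) (at x)" if "x \<in> S" for x
    using Suc.prems that assms(3)
    by (intro has_derivative_compose[OF has_derivative_deriv_at has_derivative_deriv_at]) auto
  have f: "C_on n S f"
    using Suc.prems(1) by (rule C_on_Suc_lower)
  have "C_on n S (\<lambda>x. deriv_at f x v \<bullet> b)" for v b
    by (rule C_on_linear_comp[OF assms(1) _ bounded_linear.linear[OF bounded_linear_inner_left]])
      (use Suc.prems in simp)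
  moreover have "C_on n S (\<lambda>x. deriv_at g (f x) b)" for b
    by (rule Suc.IH[OF f]) (use Suc.prems in simp)
  ultimately have "C_on n S (\<lambda>x. \<Sum>b\<in>Basis. (deriv_at f x v \<bullet> b) *\<^sub>R deriv_at g (f x) b)" for v
    by (intro C_on_sum C_on_scaleR assms(1) finite_Basis)
  moreover have "deriv_at (\<lambda>x. g (f x)) x v = (\<Sum>b\<in>Basis. (deriv_at f x v \<bullet> b) *\<^sub>R deriv_at g (f x) b)"
    if "x \<in> S" for x v
  proof -
    have "linear (deriv_at g (f x))"
      using Suc.prems that assms(3) by (intro linear_deriv_at) auto
    then show ?thesis
      unfolding deriv_at_eqI[OF d[OF that]] by (rule linear_Basis_expand)
  qed
  ultimately have "C_on n S (\<lambda>x. deriv_at (\<lambda>x. g (f x)) x v)" for v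
    using C_on_cong[OF assms(1)] by (metis (mono_tags, lifting))
  then show ?case using d by (auto simp: differentiable_def)
qed

lemma C_on_Pair:
  fixes f :: "'a::real_normed_vector \<Rightarrow> 'b::euclidean_space" and g :: "'a \<Rightarrow> 'c::euclidean_space"
  assumes "open S" "C_on n S f" "C_on n S g"
  shows "C_on n S (\<lambda>x. (f x, g x))"
proof -
  have "C_on n S (\<lambda>x. (f x, 0) + (0, g x))"
    using assms
    by (intro C_on_add C_on_linear_comp[where L="\<lambda>x. (x, 0)"] C_on_linear_comp[where L="\<lambda>x. (0, x)"])
      (auto intro!: linearI)
  then show ?thesis by simp
qed

lemma smooth_on_cong:
  "open S \<Longrightarrow> (\<And>x. x \<in> S \<Longrightarrow> f x = g x) \<Longrightarrow> smooth_on S f \<longleftrightarrow> smooth_on S g"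
  unfolding smooth_on_def using C_on_cong by metis

lemma smooth_on_subset: "smooth_on S f \<Longrightarrow> T \<subseteq> S \<Longrightarrow> smooth_on T f"
  unfolding smooth_on_def using C_on_subset by blast

lemma smooth_on_const [simp]: "smooth_on S (\<lambda>x. c)"
  unfolding smooth_on_def by (simp add: C_on_const)

lemma smooth_on_linear:
  fixes f :: "'a::euclidean_space \<Rightarrow> 'b::real_normed_vector"
  shows "linear f \<Longrightarrow> smooth_on S f"
  unfolding smooth_on_def by (simp add: C_on_linear)

lemma smooth_on_ident: "smooth_on S (\<lambda>x::'a::euclidean_space. x)"
  by (intro smooth_on_linear linear_ident)

lemma smooth_on_add: "open S \<Longrightarrow> smooth_on S f \<Longrightarrow> smooth_on S g \<Longrightarrow> smooth_on S (\<lambda>x. f x + g x)"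
  unfolding smooth_on_def using C_on_add by blast

lemma smooth_on_scaleR: "open S \<Longrightarrow> smooth_on S f \<Longrightarrow> smooth_on S g \<Longrightarrow> smooth_on S (\<lambda>x. f x *\<^sub>R g x)"
  unfolding smooth_on_def using C_on_scaleR by blast

lemma smooth_on_compose:
  fixes f :: "'a::real_normed_vector \<Rightarrow> 'b::euclidean_space"
  shows "open S \<Longrightarrow> open T \<Longrightarrow> f ` S \<subseteq> T \<Longrightarrow> smooth_on S f \<Longrightarrow> smooth_on T g \<Longrightarrow> smooth_on S (\<lambda>x. g (f x))"
  unfolding smooth_on_def using C_on_compose by blast

lemma smooth_on_Pair:
  fixes f :: "'a::real_normed_vector \<Rightarrow> 'b::euclidean_space" and g :: "'a \<Rightarrow> 'c::euclidean_space"
  shows "open S \<Longrightarrow> smooth_on S f \<Longrightarrow> smooth_on S g \<Longrightarrow> smooth_on S (\<lambda>x. (f x, g x))"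
  unfolding smooth_on_def using C_on_Pair by blast

lemma smooth_on_differentiable: "smooth_on S f \<Longrightarrow> x \<in> S \<Longrightarrow> f differentiable (at x)"
  unfolding smooth_on_def by (metis C_on.simps(2))

lemma smooth_on_has_derivative: "smooth_on S f \<Longrightarrow> x \<in> S \<Longrightarrow> (f has_derivative deriv_at f x) (at x)"
  by (simp add: smooth_on_differentiable has_derivative_deriv_at)

lemma smooth_on_deriv_at: "smooth_on S f \<Longrightarrow> smooth_on S (\<lambda>x. deriv_at f x v)"
  unfolding smooth_on_def by (metis C_on.simps(2))

lemma smooth_on_continuous_on: "smooth_on S f \<Longrightarrow> continuous_on S f"
  unfolding smooth_on_def by (metis C_on.simps(1))

section \<open>Symmetry of second derivatives\<close>

lemma second_difference_mean_value:
  fixes h :: "'a::real_normed_vector \<Rightarrow> real"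
  assumes h: "C_on 2 S h" and s: "0 < s"
    and S: "\<And>p q. 0 \<le> p \<Longrightarrow> p \<le> s \<Longrightarrow> 0 \<le> q \<Longrightarrow> q \<le> s \<Longrightarrow> x + p *\<^sub>R v + q *\<^sub>R w \<in> S"
  obtains p q where "0 < p" "p < s" "0 < q" "q < s"
    "h (x + s *\<^sub>R v + s *\<^sub>R w) - h (x + s *\<^sub>R v) - h (x + s *\<^sub>R w) + h x
      = s * s * deriv_at (\<lambda>z. deriv_at h z v) (x + p *\<^sub>R v + q *\<^sub>R w) w"
proof -
  have C2: "\<And>y. y \<in> S \<Longrightarrow> h differentiable (at y)" "\<And>y. y \<in> S \<Longrightarrow> (\<lambda>z. deriv_at h z v) differentiable (at y)"
    using h by (auto simp: numeral_2_eq_2)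
  have dline: "((\<lambda>t. k (y + t *\<^sub>R u)) has_real_derivative deriv_at k (y + t *\<^sub>R u) u) (at t)"
    if "k differentiable (at (y + t *\<^sub>R u))" for k :: "'a \<Rightarrow> real" and y u t
  proof -
    have "((\<lambda>t. k (y + t *\<^sub>R u)) has_derivative (\<lambda>r. deriv_at k (y + t *\<^sub>R u) (r *\<^sub>R u))) (at t)"
      by (rule has_derivative_compose[where f="\<lambda>t. y + t *\<^sub>R u" and g=k, OF _ has_derivative_deriv_at[OF that]])
        (auto intro!: derivative_eq_intros)
    then show ?thesis
      unfolding has_field_derivative_def
      by (rule has_derivative_eq_rhs) (auto simp: linear_cmul[OF linear_deriv_at[OF that]])
  qed
  \<comment> \<open>The increment of \<open>\<phi>\<close> over \<open>[0, s]\<close> is the mixed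
    second difference, so the mean value theorem leaves a difference of derivatives in direction
    \<open>v\<close> at two points that are \<open>s *\<^sub>R w\<close> apart.\<close>
  define \<phi> where "\<phi> t = h ((x + s *\<^sub>R w) + t *\<^sub>R v) - h (x + t *\<^sub>R v)" for t
  have "(\<phi> has_real_derivative deriv_at h ((x + s *\<^sub>R w) + t *\<^sub>R v) v - deriv_at h (x + t *\<^sub>R v) v) (at t)"
    if "0 \<le> t" "t \<le> s" for t
    unfolding \<phi>_def using S[OF that, of s] S[OF that, of 0] s
    by (intro DERIV_diff dline C2) (auto simp: algebra_simps)
  from MVT2[OF s this] obtain p where p: "0 < p" "p < s"
    "\<phi> s - \<phi> 0 = (s - 0) * (deriv_at h ((x + s *\<^sub>R w) + p *\<^sub>R v) v - deriv_at h (x + p *\<^sub>R v) v)"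
    by blast
  \<comment> \<open>The remaining difference is the increment of \<open>\<psi>\<close>, and a second
    use of the mean value theorem produces the mixed derivative.\<close>
  define \<psi> where "\<psi> t = deriv_at h ((x + p *\<^sub>R v) + t *\<^sub>R w) v" for t
  have "(\<psi> has_real_derivative deriv_at (\<lambda>z. deriv_at h z v) ((x + p *\<^sub>R v) + t *\<^sub>R w) w) (at t)"
    if "0 \<le> t" "t \<le> s" for t
    unfolding \<psi>_def using S[OF _ _ that] p by (intro dline C2) auto
  from MVT2[OF s this] obtain q where q: "0 < q" "q < s"
    "\<psi> s - \<psi> 0 = (s - 0) * deriv_at (\<lambda>z. deriv_at h z v) ((x + p *\<^sub>R v) + q *\<^sub>R w) w"
    by blast
  show thesis
    using p q by (intro that[of p q]) (auto simp: \<phi>_def \<psi>_def algebra_simps)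
qed

lemma deriv_at_inner_left:
  assumes "f differentiable (at x)"
  shows "deriv_at (\<lambda>x. f x \<bullet> c) x = (\<lambda>v. deriv_at f x v \<bullet> c)"
  by (intro deriv_at_eqI has_derivative_inner_left has_derivative_deriv_at assms)

text \<open>The mixed second difference does not change when \<open>v\<close> and \<open>w\<close>
  are exchanged. It equals \<open>s * s\<close> times either mixed derivative, taken at points that
  tend to \<open>x\<close> as \<open>s\<close> shrinks, so continuity identifies the two values at
  \<open>x\<close>.\<close>

lemma deriv_at_symmetric_real:
  fixes h :: "'a::real_normed_vector \<Rightarrow> real"
  assumes S: "open S" "x \<in> S" and h: "C_on 2 S h"
  shows "deriv_at (\<lambda>z. deriv_at h z v) x w = deriv_at (\<lambda>z. deriv_at h z w) x v"
proof -
  obtain e where e: "e > 0" "ball x e \<subseteq> S"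
    using S open_contains_ball by blast
  define K where "K = norm v + norm w + 1"
  have K: "K > 0" unfolding K_def by (simp add: add_nonneg_pos)
  have near: "dist x (x + p *\<^sub>R v + q *\<^sub>R w) \<le> s * K \<and> dist x (x + p *\<^sub>R w + q *\<^sub>R v) \<le> s * K"
    if "0 \<le> p" "p \<le> s" "0 \<le> q" "q \<le> s" for p q s
  proof -
    have "norm (p *\<^sub>R v + q *\<^sub>R w) \<le> s * norm v + s * norm w" "norm (p *\<^sub>R w + q *\<^sub>R v) \<le> s * norm w + s * norm v"
      using that by (auto intro!: order_trans[OF norm_triangle_ineq] add_mono mult_right_mono)
    moreover have "s * norm v + s * norm w \<le> s * K"
      using that by (simp add: K_def algebra_simps)
    moreover have "dist x (x + a + b) = norm (a + b)" for a b
      by (metis add.assoc add_diff_cancel_left' dist_commute dist_norm)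
    ultimately show ?thesis by simp
  qed
  \<comment> \<open>The summand 1 in \<open>K\<close> keeps it positive when both vectors vanish.
    The shift by 2 gives \<open>s n * K \<le> e / 2\<close>, so already for \<open>n = 0\<close> the
    parallelogram lies inside the ball.\<close>
  define s where "s n = e / (K * real (n + 2))" for n
  have s: "s n > 0" for n using e K by (simp add: s_def)
  have sK: "s n * K < e" for n
  proof -
    have "s n * K = e / real (n + 2)" using K by (simp add: s_def)
    also have "\<dots> < e / 1" using e by (intro divide_strict_left_mono) auto
    finally show ?thesis by simp
  qed
  let ?A = "\<lambda>z. deriv_at (\<lambda>z. deriv_at h z v) z w" and ?B = "\<lambda>z. deriv_at (\<lambda>z. deriv_at h z w) z v"
  have "\<exists>y z. dist x y \<le> s n * K \<and> dist x z \<le> s n * K \<and> ?A y = ?B z" for n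
  proof -
    have "x + p *\<^sub>R v + q *\<^sub>R w \<in> S" "x + p *\<^sub>R w + q *\<^sub>R v \<in> S"
      if "0 \<le> p" "p \<le> s n" "0 \<le> q" "q \<le> s n" for p q
      using near[OF that] sK[of n] e by (auto simp: subset_iff)
    note in_S = this
    obtain p q where pq: "0 < p" "p < s n" "0 < q" "q < s n"
      "h (x + s n *\<^sub>R v + s n *\<^sub>R w) - h (x + s n *\<^sub>R v) - h (x + s n *\<^sub>R w) + h x
      = s n * s n * ?A (x + p *\<^sub>R v + q *\<^sub>R w)"
      using second_difference_mean_value[OF h s[of n], where x=x and v=v and w=w] in_S(1) by blast
    obtain p' q' where pq': "0 < p'" "p' < s n" "0 < q'" "q' < s n"
      "h (x + s n *\<^sub>R w + s n *\<^sub>R v) - h (x + s n *\<^sub>R w) - h (x + s n *\<^sub>R v) + h x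
      = s n * s n * ?B (x + p' *\<^sub>R w + q' *\<^sub>R v)"
      using second_difference_mean_value[OF h s[of n], where x=x and v=w and w=v] in_S(2) by blast
    have "s n * s n * ?A (x + p *\<^sub>R v + q *\<^sub>R w) = s n * s n * ?B (x + p' *\<^sub>R w + q' *\<^sub>R v)"
      using pq(5) pq'(5) by (simp add: algebra_simps)
    then have "?A (x + p *\<^sub>R v + q *\<^sub>R w) = ?B (x + p' *\<^sub>R w + q' *\<^sub>R v)"
      using s[of n] by simp
    then show ?thesis using near pq(1-4) pq'(1-4) by (meson less_imp_le)
  qed
  then obtain y z where yz: "\<And>n. dist x (y n) \<le> s n * K" "\<And>n. dist x (z n) \<le> s n * K" "\<And>n. ?A (y n) = ?B (z n)"
    by metis
  have "(\<lambda>n. e * inverse (real (Suc n))) \<longlonglongrightarrow> 0"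
    using tendsto_mult_right_zero[OF LIMSEQ_inverse_real_of_nat] by blast
  from LIMSEQ_Suc[OF this] have "(\<lambda>n. e * inverse (real (Suc (Suc n)))) \<longlonglongrightarrow> 0" .
  moreover have "s n * K = e * inverse (real (Suc (Suc n)))" for n
  proof -
    have "s n * K = e / real (n + 2)" using K by (simp add: s_def)
    then show ?thesis by (simp add: divide_inverse)
  qed
  ultimately have "(\<lambda>n. s n * K) \<longlonglongrightarrow> 0"
    by simp
  note lim0 = this
  have to_x: "f \<longlonglongrightarrow> x" if "\<And>n. dist x (f n) \<le> s n * K" for f
    by (rule iffD2[OF tendsto_dist_iff], rule Lim_null_comparison[OF _ lim0])
      (use that in \<open>simp add: dist_commute\<close>)
  have lim: "y \<longlonglongrightarrow> x" "z \<longlonglongrightarrow> x"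
    by (intro to_x yz)+
  have "continuous_on S ?A" "continuous_on S ?B"
    using h by (auto simp: numeral_2_eq_2)
  then have "isCont ?A x" "isCont ?B x"
    using S continuous_on_eq_continuous_at by blast+
  then have "(\<lambda>n. ?A (y n)) \<longlonglongrightarrow> ?A x" "(\<lambda>n. ?B (z n)) \<longlonglongrightarrow> ?B x"
    using lim by (auto intro: isCont_tendsto_compose)
  then show ?thesis using yz(3) LIMSEQ_unique by auto
qed

lemma deriv_at_symmetric:
  fixes f :: "'a::real_normed_vector \<Rightarrow> 'b::euclidean_space"
  assumes S: "open S" "x \<in> S" and f: "smooth_on S f"
  shows "deriv_at (\<lambda>z. deriv_at f z v) x w = deriv_at (\<lambda>z. deriv_at f z w) x v"
proof (rule euclidean_eqI)
  fix b :: 'b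
  have inner: "deriv_at (\<lambda>z. deriv_at (\<lambda>y. f y \<bullet> b) z v) x w = deriv_at (\<lambda>z. deriv_at f z v) x w \<bullet> b" for v w
  proof -
    have "deriv_at (\<lambda>z. deriv_at (\<lambda>y. f y \<bullet> b) z v) x = deriv_at (\<lambda>z. deriv_at f z v \<bullet> b) x"
      by (rule deriv_at_cong_open[OF S]) (simp add: deriv_at_inner_left smooth_on_differentiable[OF f])
    then show ?thesis
      using smooth_on_differentiable[OF smooth_on_deriv_at[OF f] S(2)] by (simp add: deriv_at_inner_left)
  qed
  have "C_on 2 S (\<lambda>y. f y \<bullet> b)"
    by (rule C_on_linear_comp[OF S(1) _ bounded_linear.linear[OF bounded_linear_inner_left]])
      (use f in \<open>simp add: smooth_on_def\<close>)
  from deriv_at_symmetric_real[OF S this]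
  show "deriv_at (\<lambda>z. deriv_at f z v) x w \<bullet> b = deriv_at (\<lambda>z. deriv_at f z w) x v \<bullet> b"
    by (simp add: inner)
qed

section \<open>Brackets of fields on open sets\<close>

text \<open>An injective linear map has a linear left inverse, so
  \<open>has_derivative_locally_injective\<close> applies once the derivative is continuous in
  operator norm.\<close>

lemma smooth_on_locally_injective:
  fixes f :: "'a::euclidean_space \<Rightarrow> 'b::euclidean_space"
  assumes S: "open S" "x \<in> S" and f: "smooth_on S f" and inj: "inj (deriv_at f x)"
  obtains r where "0 < r" "ball x r \<subseteq> S" "inj_on f (ball x r)"
proof -
  have der: "(f has_derivative deriv_at f y) (at y)" if "y \<in> S" for y
    by (rule smooth_on_has_derivative[OF f that])
  obtain g' where g': "linear g'" "g' \<circ> deriv_at f x = id"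
    using linear_injective_left_inverse[OF linear_deriv_at[OF smooth_on_differentiable[OF f S(2)]] inj] by blast
  have "\<exists>d>0. \<forall>y. dist x y < d \<longrightarrow> onorm (\<lambda>v. deriv_at f y v - deriv_at f x v) < e" if "e > 0" for e
  proof -
    \<comment> \<open>Smoothness gives continuity of each directional derivative; the finite sum
      over \<open>Basis\<close> dominates the operator norm and so turns this into norm
      continuity.\<close>
    define F where "F y = (\<Sum>b\<in>Basis. norm (deriv_at f y b - deriv_at f x b))" for y
    have "continuous_on S F"
      unfolding F_def by (intro continuous_intros smooth_on_continuous_on[OF smooth_on_deriv_at[OF f]])
    then have "isCont F x"
      using S continuous_on_eq_continuous_at by blast
    moreover have "F x = 0" unfolding F_def by simp
    ultimately have "\<exists>d>0. \<forall>y. dist y x < d \<longrightarrow> dist (F y) 0 < e"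
      using that unfolding continuous_at_eps_delta by metis
    then obtain d where d: "d > 0" "\<And>y. dist y x < d \<Longrightarrow> dist (F y) 0 < e"
      by blast
    obtain d' where d': "d' > 0" "ball x d' \<subseteq> S"
      using S open_contains_ball by blast
    have "onorm (\<lambda>v. deriv_at f y v - deriv_at f x v) < e" if "dist x y < min d d'" for y
    proof -
      have "y \<in> S" using that d' by (auto simp: subset_iff)
      then have "bounded_linear (\<lambda>v. deriv_at f y v - deriv_at f x v)"
        using der S(2) by (intro bounded_linear_sub has_derivative_bounded_linear) auto
      from onorm_componentwise[OF this]
      have "onorm (\<lambda>v. deriv_at f y v - deriv_at f x v) \<le> F y" unfolding F_def .
      also have "\<dots> < e" using d(2)[of y] that by (simp add: dist_commute)
      finally show ?thesis .
    qed
    then show ?thesis using d(1) d'(1) by (intro exI[of _ "min d d'"]) auto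
  qed
  with has_derivative_locally_injective[OF S(2,1) _ g'(2) der]
  show thesis using that g'(1) by (metis linear_conv_bounded_linear)
qed

text \<open>Expanding \<open>y x\<close> in \<open>Basis\<close> moves the dependence of the
  direction on \<open>x\<close> into scalar coefficients, and the product rule separates the second
  derivative of \<open>f\<close> from the derivative of \<open>y\<close>.\<close>

lemma has_derivative_deriv_at_apply:
  fixes f :: "'a::euclidean_space \<Rightarrow> 'b::euclidean_space"
  assumes S: "open S" "z \<in> S" and f: "smooth_on S f" and y: "y differentiable (at z)"
  shows "((\<lambda>x. deriv_at f x (y x)) has_derivative
    (\<lambda>w. deriv_at (\<lambda>x. deriv_at f x (y z)) z w + deriv_at f z (deriv_at y z w))) (at z)"
proof -
  have lin: "linear (deriv_at f x)" if "x \<in> S" for x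
    using f that by (intro linear_deriv_at smooth_on_differentiable)
  have dv: "(\<lambda>x. deriv_at f x v) differentiable (at z)" for v
    using f S(2) smooth_on_deriv_at smooth_on_differentiable by blast
  have dD: "((\<lambda>x. deriv_at f x v) has_derivative deriv_at (\<lambda>x. deriv_at f x v) z) (at z)" for v
    by (rule has_derivative_deriv_at[OF dv])
  have dc: "((\<lambda>x. y x \<bullet> b) has_derivative (\<lambda>w. deriv_at y z w \<bullet> b)) (at z)" for b
    by (intro has_derivative_inner_left has_derivative_deriv_at y)
  have "((\<lambda>x. \<Sum>b\<in>Basis. (y x \<bullet> b) *\<^sub>R deriv_at f x b) has_derivative
      (\<lambda>w. \<Sum>b\<in>Basis. (y z \<bullet> b) *\<^sub>R deriv_at (\<lambda>x. deriv_at f x b) z w + (deriv_at y z w \<bullet> b) *\<^sub>R deriv_at f z b)) (at z)"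
    by (intro has_derivative_sum has_derivative_scaleR dD dc)
  then have 1: "((\<lambda>x. deriv_at f x (y x)) has_derivative
      (\<lambda>w. \<Sum>b\<in>Basis. (y z \<bullet> b) *\<^sub>R deriv_at (\<lambda>x. deriv_at f x b) z w + (deriv_at y z w \<bullet> b) *\<^sub>R deriv_at f z b)) (at z)"
    by (subst has_derivative_cong_open[OF S]) (auto intro: linear_Basis_expand lin)
  have "((\<lambda>x. \<Sum>b\<in>Basis. (y z \<bullet> b) *\<^sub>R deriv_at f x b) has_derivative
      (\<lambda>w. \<Sum>b\<in>Basis. (y z \<bullet> b) *\<^sub>R deriv_at (\<lambda>x. deriv_at f x b) z w)) (at z)"
    by (intro has_derivative_sum has_derivative_scaleR_right dD)
  then have "((\<lambda>x. deriv_at f x (y z)) has_derivative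
      (\<lambda>w. \<Sum>b\<in>Basis. (y z \<bullet> b) *\<^sub>R deriv_at (\<lambda>x. deriv_at f x b) z w)) (at z)"
    by (subst has_derivative_cong_open[OF S]) (auto intro: linear_Basis_expand lin)
  from deriv_at_eqI[OF this]
  have 2: "deriv_at (\<lambda>x. deriv_at f x (y z)) z w = (\<Sum>b\<in>Basis. (y z \<bullet> b) *\<^sub>R deriv_at (\<lambda>x. deriv_at f x b) z w)" for w
    by simp
  show ?thesis
    by (rule has_derivative_eq_rhs[OF 1])
      (simp add: 2 sum.distrib linear_Basis_expand[OF lin[OF S(2)], of "deriv_at y z _"])
qed

lemma deriv_at_deriv_at_apply:
  fixes f :: "'a::euclidean_space \<Rightarrow> 'b::euclidean_space"
  assumes "open S" "z \<in> S" "smooth_on S f" "y differentiable (at z)"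
  shows "deriv_at (\<lambda>x. deriv_at f x (y x)) z w
    = deriv_at (\<lambda>x. deriv_at f x (y z)) z w + deriv_at f z (deriv_at y z w)"
  using deriv_at_eqI[OF has_derivative_deriv_at_apply[OF assms]] by simp

text \<open>The local formula of \<open>vf_bracket\<close> detached from manifolds, so that it can
  be evaluated in any chart.\<close>

definition field_bracket :: "('e::euclidean_space \<Rightarrow> 'e) \<Rightarrow> ('e \<Rightarrow> 'e) \<Rightarrow> 'e \<Rightarrow> 'e" where
  "field_bracket x y z = deriv_at y z (x z) - deriv_at x z (y z)"

text \<open>Differentiating both relations by the chain rule gives the terms of the two brackets
  plus second derivatives of \<open>\<phi>\<close> at the pair \<open>x z\<close>,
  \<open>y z\<close>; the latter cancel by symmetry.\<close>

lemma field_bracket_related: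
  fixes \<phi> :: "'e::euclidean_space \<Rightarrow> 'f::euclidean_space"
  assumes S: "open S" "z \<in> S" and \<phi>: "smooth_on S \<phi>"
    and xy: "x differentiable (at z)" "y differentiable (at z)"
    and xy': "x' differentiable (at (\<phi> z))" "y' differentiable (at (\<phi> z))"
    and rel: "\<And>z. z \<in> S \<Longrightarrow> x' (\<phi> z) = deriv_at \<phi> z (x z)" "\<And>z. z \<in> S \<Longrightarrow> y' (\<phi> z) = deriv_at \<phi> z (y z)"
  shows "deriv_at \<phi> z (field_bracket x y z) = field_bracket x' y' (\<phi> z)"
proof -
  have d\<phi>: "\<phi> differentiable (at z)"
    by (rule smooth_on_differentiable[OF \<phi> S(2)])
  have key: "deriv_at q' (\<phi> z) (deriv_at \<phi> z w) = deriv_at (\<lambda>x. deriv_at \<phi> x (q z)) z w + deriv_at \<phi> z (deriv_at q z w)"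
    if q: "q differentiable (at z)" "q' differentiable (at (\<phi> z))" "\<And>z. z \<in> S \<Longrightarrow> q' (\<phi> z) = deriv_at \<phi> z (q z)" for q q' w
  proof -
    have "((\<lambda>z. q' (\<phi> z)) has_derivative (\<lambda>w. deriv_at q' (\<phi> z) (deriv_at \<phi> z w))) (at z)"
      by (rule has_derivative_compose[OF has_derivative_deriv_at[OF d\<phi>] has_derivative_deriv_at[OF q(2)]])
    then have "deriv_at q' (\<phi> z) (deriv_at \<phi> z w) = deriv_at (\<lambda>z. q' (\<phi> z)) z w"
      using deriv_at_eqI by fastforce
    also have "\<dots> = deriv_at (\<lambda>z. deriv_at \<phi> z (q z)) z w"
      using deriv_at_cong_open[OF S, of "\<lambda>z. q' (\<phi> z)" "\<lambda>z. deriv_at \<phi> z (q z)"] q(3) by simp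
    finally show ?thesis
      by (simp add: deriv_at_deriv_at_apply[OF S \<phi> q(1)])
  qed
  have "deriv_at (\<lambda>u. deriv_at \<phi> u (x z)) z (y z) = deriv_at (\<lambda>u. deriv_at \<phi> u (y z)) z (x z)"
    by (rule deriv_at_symmetric[OF S \<phi>])
  then show ?thesis
    using key[OF xy(1) xy'(1) rel(1), of "y z"] key[OF xy(2) xy'(2) rel(2), of "x z"]
    by (simp add: field_bracket_def rel[OF S(2)] linear_diff[OF linear_deriv_at[OF d\<phi>]])
qed

text \<open>After expansion the products of first derivatives cancel in pairs, and the terms with
  second derivatives cancel by their symmetry.\<close>

lemma field_bracket_Jacobi:
  assumes S: "open S" "p \<in> S" and smooth: "smooth_on S x" "smooth_on S y" "smooth_on S z"
  shows "field_bracket x (field_bracket y z) p + field_bracket y (field_bracket z x) p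
    + field_bracket z (field_bracket x y) p = 0"
proof -
  have d: "q differentiable (at p)" if "smooth_on S q" for q :: "'a \<Rightarrow> 'a"
    using that S(2) smooth_on_differentiable by blast
  have D: "deriv_at (field_bracket q r) p w
     = deriv_at (\<lambda>u. deriv_at r u (q p)) p w + deriv_at r p (deriv_at q p w)
      - (deriv_at (\<lambda>u. deriv_at q u (r p)) p w + deriv_at q p (deriv_at r p w))"
    if qr: "smooth_on S q" "smooth_on S r" for q r :: "'a \<Rightarrow> 'a" and w
    using deriv_at_eqI[OF has_derivative_diff[OF has_derivative_deriv_at_apply[OF S qr(2) d[OF qr(1)]]
        has_derivative_deriv_at_apply[OF S qr(1) d[OF qr(2)]]]]
    by (simp add: field_bracket_def[abs_def])
  have L: "linear (deriv_at q p)" if "smooth_on S q" for q :: "'a \<Rightarrow> 'a"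
    using d[OF that] by (rule linear_deriv_at)
  have sym: "deriv_at (\<lambda>u. deriv_at q u v) p w = deriv_at (\<lambda>u. deriv_at q u w) p v"
    if "smooth_on S q" for q :: "'a \<Rightarrow> 'a" and v w
    by (rule deriv_at_symmetric[OF S that])
  show ?thesis
    unfolding field_bracket_def[of x "field_bracket y z"] field_bracket_def[of y "field_bracket z x"]
      field_bracket_def[of z "field_bracket x y"] D[OF smooth(1,2)] D[OF smooth(2,3)] D[OF smooth(3,1)]
      field_bracket_def[of x y p] field_bracket_def[of y z p] field_bracket_def[of z x p]
      linear_diff[OF L[OF smooth(1)]] linear_diff[OF L[OF smooth(2)]] linear_diff[OF L[OF smooth(3)]]
    using sym[OF smooth(1), of "y p" "z p"] sym[OF smooth(2), of "x p" "z p"] sym[OF smooth(3), of "x p" "y p"]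
    by (simp add: algebra_simps)
qed

section \<open>Derivations of Lie algebras with an invariant inner product\<close>

lemma bilinear_linear_left: "bilinear b \<Longrightarrow> linear (\<lambda>x. b x y)"
  and bilinear_linear_right: "bilinear b \<Longrightarrow> linear (b x)"
  by (simp_all add: bilinear_def)

lemma bilinear_scaled_sum_left:
  "bilinear b \<Longrightarrow> b (\<Sum>i\<in>I. c i *\<^sub>R f i) y = (\<Sum>i\<in>I. c i *\<^sub>R b (f i) y)"
  using linear_sum[OF bilinear_linear_left] linear_cmul[OF bilinear_linear_left]
  by (smt (verit) sum.cong)

lemma bilinear_scaled_sum_right:
  "bilinear b \<Longrightarrow> b x (\<Sum>i\<in>I. c i *\<^sub>R f i) = (\<Sum>i\<in>I. c i *\<^sub>R b x (f i))"
  using linear_sum[OF bilinear_linear_right] linear_cmul[OF bilinear_linear_right]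
  by (smt (verit) sum.cong)

text \<open>An orthonormal set of maximal size spans: the normalised remainder of a vector outside
  its span would enlarge it, and independence bounds the size by the dimension. Positivity is asked
  on \<open>L\<close> only, because the form \<open>q\<close> in \<open>derivation_inner\<close> is
  shown to be definite only there.\<close>

lemma orthonormal_basis_exists:
  fixes b :: "'e::euclidean_space \<Rightarrow> 'e \<Rightarrow> real"
  assumes b: "bilinear b" and L: "subspace L" and sym: "\<And>u v. b u v = b v u"
    and pos: "\<And>v. v \<in> L \<Longrightarrow> v \<noteq> 0 \<Longrightarrow> 0 < b v v"
  obtains B where "finite B" "B \<subseteq> L" "\<And>u. u \<in> L \<Longrightarrow> u = (\<Sum>e\<in>B. b u e *\<^sub>R e)"
proof -
  define ON where "ON B \<longleftrightarrow> finite B \<and> B \<subseteq> L \<and> (\<forall>e\<in>B. \<forall>f\<in>B. b e f = (if e = f then 1 else 0))" for B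
  have coeff: "b (\<Sum>e\<in>B. c e *\<^sub>R e) f = c f" if "ON B" "f \<in> B" for B c f
  proof -
    have "(\<Sum>e\<in>B. c e *\<^sub>R b e f) = (\<Sum>e\<in>B. if e = f then c e else 0)"
      using that by (intro sum.cong) (auto simp: ON_def)
    also have "\<dots> = c f" using that by (simp add: ON_def)
    finally show ?thesis by (simp add: bilinear_scaled_sum_left[OF b])
  qed
  have card: "card B \<le> DIM('e)" if "ON B" for B
  proof (rule independent_card_le)
    show "independent B"
    proof (rule independent_if_scalars_zero)
      show "finite B" using that by (simp add: ON_def)
    next
      fix c f assume "(\<Sum>e\<in>B. c e *\<^sub>R e) = 0" "f \<in> B"
      then show "c f = 0" using coeff[OF that, of f c] bilinear_lzero[OF b] by simp
    qed
  qed
  have "ON {}" by (simp add: ON_def)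
  moreover have "\<forall>B. ON B \<longrightarrow> card B < Suc DIM('e)"
    using card by (simp add: less_Suc_eq_le)
  ultimately have "\<exists>B. ON B \<and> (\<forall>B'. ON B' \<longrightarrow> card B' \<le> card B)"
    by (rule ex_has_greatest_nat)
  then obtain B where B: "ON B" "\<And>B'. ON B' \<Longrightarrow> card B' \<le> card B"
    by auto
  have "u = (\<Sum>e\<in>B. b u e *\<^sub>R e)" if "u \<in> L" for u
  proof (rule ccontr)
    assume "u \<noteq> (\<Sum>e\<in>B. b u e *\<^sub>R e)"
    define w where "w = u - (\<Sum>e\<in>B. b u e *\<^sub>R e)"
    have w: "w \<noteq> 0" "w \<in> L"
      using \<open>u \<noteq> _\<close> B(1) that by (auto simp: w_def ON_def intro!: subspace_diff[OF L] subspace_sum[OF L] subspace_scale[OF L])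
    have wB: "b w f = 0" if "f \<in> B" for f
      using coeff[OF B(1) that] by (simp add: w_def bilinear_lsub[OF b])
    define w' where "w' = (1 / sqrt (b w w)) *\<^sub>R w"
    have "b w' w' = 1"
      using pos[OF w(2,1)] by (simp add: w'_def bilinear_lmul[OF b] bilinear_rmul[OF b] real_sqrt_mult_self)
    moreover have "b w' f = 0" if "f \<in> B" for f
      using wB[OF that] by (simp add: w'_def bilinear_lmul[OF b])
    moreover have "w' \<in> L" by (simp add: w'_def w subspace_scale[OF L])
    ultimately have "ON (insert w' B)" "w' \<notin> B"
      using B(1) sym by (auto simp: ON_def)
    then show False using B(2)[of "insert w' B"] B(1) by (simp add: ON_def)
  qed
  then show thesis using B(1) that[of B] by (auto simp: ON_def)
qed

text \<open>\<open>C\<close> is chosen so that \<open>ad C\<close> is the orthogonal projection of \<open>D\<close> to the space of inner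
  derivations with respect to the Hilbert--Schmidt inner product.  For the difference \<open>E\<close> and \<open>A \<in> L\<close>,
  the derivation \<open>ad (E A) = [E, ad A]\<close> then has norm zero because \<open>ad A\<close> is skew.\<close>

lemma derivation_inner:
  fixes b :: "'e::euclidean_space \<Rightarrow> 'e \<Rightarrow> real" and br :: "'e \<Rightarrow> 'e \<Rightarrow> 'e"
  assumes b: "bilinear b" and L: "subspace L" and sym: "\<And>u v. b u v = b v u"
    and pos: "\<And>v. v \<in> L \<Longrightarrow> v \<noteq> 0 \<Longrightarrow> 0 < b v v"
    and br: "bilinear br" and closed: "\<And>u v. u \<in> L \<Longrightarrow> v \<in> L \<Longrightarrow> br u v \<in> L"
    and jacobi: "\<And>u v w. u \<in> L \<Longrightarrow> v \<in> L \<Longrightarrow> w \<in> L \<Longrightarrow> br u (br v w) = br (br u v) w + br v (br u w)"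
    and inv: "\<And>u v w. u \<in> L \<Longrightarrow> v \<in> L \<Longrightarrow> w \<in> L \<Longrightarrow> b (br u v) w = - b v (br u w)"
    and centre: "\<And>u. u \<in> L \<Longrightarrow> (\<And>v. v \<in> L \<Longrightarrow> br u v = 0) \<Longrightarrow> u = 0"
    and D: "linear D" "\<And>u. u \<in> L \<Longrightarrow> D u \<in> L"
    "\<And>u v. u \<in> L \<Longrightarrow> v \<in> L \<Longrightarrow> D (br u v) = br (D u) v + br u (D v)"
  shows "\<exists>C\<in>L. \<forall>u\<in>L. D u = br C u"
proof -
  obtain B where B: "finite B" "B \<subseteq> L" and exp: "\<And>u. u \<in> L \<Longrightarrow> u = (\<Sum>e\<in>B. b u e *\<^sub>R e)"
    using orthonormal_basis_exists[OF b L sym pos] by metis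
  have BL: "e \<in> L" if "e \<in> B" for e using that B by blast
  \<comment> \<open>The Hilbert-Schmidt product of \<open>br u\<close> and \<open>br v\<close> on
    \<open>L\<close>, computed in the orthonormal basis \<open>B\<close>.\<close>
  define q where "q u v = (\<Sum>e\<in>B. b (br u e) (br v e))" for u v
  have q: "bilinear q"
    unfolding bilinear_def q_def
    by (auto intro!: linear_compose_sum linear_compose[OF bilinear_linear_left[OF br] bilinear_linear_left[OF b], unfolded o_def]
        linear_compose[OF bilinear_linear_left[OF br] bilinear_linear_right[OF b], unfolded o_def])
  have nonneg: "0 \<le> b u u" if "u \<in> L" for u
    using pos[OF that] bilinear_lzero[OF b] by (cases "u = 0") (auto intro: less_imp_le)
  \<comment> \<open>Norm zero forces \<open>br u\<close> to vanish on \<open>B\<close>, hence on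
    \<open>L\<close>, and then the trivial centre gives \<open>u = 0\<close>. The inequality is the
    form in which this is applied to \<open>E u\<close> at the end.\<close>
  have q0: "u = 0" if "u \<in> L" "q u u \<le> 0" for u
  proof (rule centre[OF that(1)])
    fix v assume "v \<in> L"
    have nn: "0 \<le> b (br u e) (br u e)" if "e \<in> B" for e
      using nonneg closed BL \<open>u \<in> L\<close> that by blast
    then have "q u u = 0"
      using that(2) sum_nonneg[of B "\<lambda>e. b (br u e) (br u e)"] by (simp add: q_def)
    then have "\<forall>e\<in>B. b (br u e) (br u e) = 0"
      using sum_nonneg_eq_0_iff[OF B(1) nn] by (simp add: q_def)
    then have "br u e = 0" if "e \<in> B" for e
      using pos[of "br u e"] closed[OF \<open>u \<in> L\<close> BL[OF that]] that by fastforce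
    then have "br u (\<Sum>e\<in>B. b v e *\<^sub>R e) = 0"
      by (simp add: bilinear_scaled_sum_right[OF br])
    then show "br u v = 0" using exp[OF \<open>v \<in> L\<close>] by simp
  qed
  then have qpos: "0 < q u u" if "u \<in> L" "u \<noteq> 0" for u
    using that by (meson not_le)
  have qsym: "q u v = q v u" for u v
    unfolding q_def by (rule sum.cong) (simp_all add: sym)
  obtain B' where B': "finite B'" "B' \<subseteq> L" and exp': "\<And>u. u \<in> L \<Longrightarrow> u = (\<Sum>e\<in>B'. q u e *\<^sub>R e)"
    using orthonormal_basis_exists[OF q L qsym qpos] by metis
  \<comment> \<open>\<open>T u\<close> is the Hilbert-Schmidt product of \<open>D\<close> with
    \<open>br u\<close>; \<open>C\<close> below represents this functional with respect to
    \<open>q\<close>.\<close>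
  define T where "T u = (\<Sum>e\<in>B. b (D e) (br u e))" for u
  have T: "linear T"
    unfolding T_def
    by (auto intro!: linear_compose_sum linear_compose[OF bilinear_linear_left[OF br] bilinear_linear_right[OF b], unfolded o_def])
  define C where "C = (\<Sum>f\<in>B'. T f *\<^sub>R f)"
  have CL: "C \<in> L"
    unfolding C_def using B' by (auto intro!: subspace_sum[OF L] subspace_scale[OF L])
  have qC: "q C u = T u" if "u \<in> L" for u
  proof -
    have "T u = T (\<Sum>f\<in>B'. q u f *\<^sub>R f)" using exp'[OF that] by simp
    also have "\<dots> = (\<Sum>f\<in>B'. T f * q f u)"
      by (simp add: linear_sum[OF T] linear_cmul[OF T]) (simp add: qsym[of u] mult.commute)
    also have "\<dots> = q C u" by (simp add: C_def bilinear_scaled_sum_left[OF q])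
    finally show ?thesis by simp
  qed
  define E where "E u = D u - br C u" for u
  have E: "linear E"
    unfolding E_def by (intro linear_compose_sub D bilinear_linear_right[OF br])
  have EL: "E u \<in> L" if "u \<in> L" for u
    unfolding E_def using that by (intro subspace_diff[OF L] D closed CL)
  have EE: "E (br u v) = br (E u) v + br u (E v)" if "u \<in> L" "v \<in> L" for u v
    using D(3)[OF that] jacobi[OF CL that]
    by (simp add: E_def bilinear_lsub[OF br] bilinear_rsub[OF br])
  have orth: "(\<Sum>e\<in>B. b (E e) (br u e)) = 0" if "u \<in> L" for u
    using qC[OF that] by (simp add: E_def bilinear_lsub[OF b] sum_subtractf T_def q_def)
  \<comment> \<open>Skewness of \<open>br u\<close> moves it from the right of \<open>E\<close> to
    the other factor, as under a trace. Both vectors are expanded in \<open>B\<close>, and the order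
    of summation is exchanged.\<close>
  have cycle: "(\<Sum>e\<in>B. b (E (br u e)) (br v e)) = - (\<Sum>e\<in>B. b (E e) (br v (br u e)))"
    if uv: "u \<in> L" "v \<in> L" for u v
  proof -
    have "(\<Sum>e\<in>B. b (E (br u e)) (br v e)) = (\<Sum>e\<in>B. \<Sum>f\<in>B. b (br u e) f * b (E f) (br v e))"
    proof (rule sum.cong[OF refl])
      fix e assume "e \<in> B"
      then have "E (br u e) = E (\<Sum>f\<in>B. b (br u e) f *\<^sub>R f)"
        using exp[OF closed[OF uv(1) BL]] by simp
      also have "\<dots> = (\<Sum>f\<in>B. b (br u e) f *\<^sub>R E f)"
        by (simp add: linear_sum[OF E] linear_cmul[OF E])
      finally show "b (E (br u e)) (br v e) = (\<Sum>f\<in>B. b (br u e) f * b (E f) (br v e))"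
        by (simp add: bilinear_scaled_sum_left[OF b])
    qed
    also have "\<dots> = (\<Sum>f\<in>B. \<Sum>e\<in>B. b (br u e) f * b (E f) (br v e))"
      by (rule sum.swap)
    also have "\<dots> = (\<Sum>f\<in>B. - b (E f) (br v (br u f)))"
    proof (rule sum.cong[OF refl])
      fix f assume f: "f \<in> B"
      have c: "b (br u e) f = - b (br u f) e" if "e \<in> B" for e
        using inv[OF uv(1) BL[OF that] BL[OF f]] sym by simp
      have "b (E f) (br v (br u f)) = b (E f) (br v (\<Sum>e\<in>B. b (br u f) e *\<^sub>R e))"
        using exp[OF closed[OF uv(1) BL[OF f]]] by simp
      also have "\<dots> = (\<Sum>e\<in>B. b (br u f) e * b (E f) (br v e))"
        by (simp add: bilinear_scaled_sum_right[OF b] bilinear_scaled_sum_right[OF br])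
      also have "\<dots> = - (\<Sum>e\<in>B. b (br u e) f * b (E f) (br v e))"
        by (simp add: c sum_negf)
      finally show "(\<Sum>e\<in>B. b (br u e) f * b (E f) (br v e)) = - b (E f) (br v (br u f))" by simp
    qed
    finally show ?thesis by (simp add: sum_negf)
  qed
  have "E u = 0" if u: "u \<in> L" for u
  proof (rule q0[OF EL[OF u]])
    define v where "v = E u"
    have v: "v \<in> L" unfolding v_def by (rule EL[OF u])
    have ad: "br v e = E (br u e) - br u (E e)" if "e \<in> B" for e
      using EE[OF u BL[OF that]] by (simp add: v_def)
    \<comment> \<open>Since \<open>E\<close> is a derivation, \<open>br v\<close> is the commutator
      of \<open>E\<close> with \<open>br u\<close>. Skewness shifts the commutator to the second
      factor, where the Jacobi identity makes it \<open>br (br u v)\<close>, which is orthogonal to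
      \<open>E\<close>.\<close>
    have "q v v = (\<Sum>e\<in>B. b (E (br u e)) (br v e)) - (\<Sum>e\<in>B. b (br u (E e)) (br v e))"
      by (simp add: q_def ad bilinear_lsub[OF b] flip: sum_subtractf)
    also have "\<dots> = (\<Sum>e\<in>B. b (E e) (br u (br v e)) - b (E e) (br v (br u e)))"
      using inv[OF u EL closed[OF v]] BL by (simp add: cycle[OF u v] sum_subtractf sum_negf)
    also have "\<dots> = (\<Sum>e\<in>B. b (E e) (br (br u v) e))"
      by (rule sum.cong[OF refl]) (simp add: jacobi[OF u v BL] bilinear_radd[OF b])
    also have "\<dots> = 0" by (rule orth[OF closed[OF u v]])
    finally show "q (E u) (E u) \<le> 0" by (simp add: v_def)
  qed
  then show ?thesis using CL by (auto simp: E_def)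
qed

section \<open>Charts and vector fields\<close>

lemma
  assumes "smooth_manifold M" "c \<in> atlas M"
  shows openin_chart: "openin (mtop M) (fst c)"
    and open_chart_image: "open (snd c ` fst c)"
    and homeomorphic_map_chart:
      "homeomorphic_map (subtopology (mtop M) (fst c)) (top_of_set (snd c ` fst c)) (snd c)"
  using assms unfolding smooth_manifold_def by blast+

lemma chart_topspace: "smooth_manifold M \<Longrightarrow> c \<in> atlas M \<Longrightarrow> p \<in> fst c \<Longrightarrow> p \<in> topspace (mtop M)"
  using openin_chart openin_subset by blast

lemma chart_inj_on:
  assumes "smooth_manifold M" "c \<in> atlas M"
  shows "inj_on (snd c) (fst c)"
proof -
  have "fst c \<subseteq> topspace (mtop M)" using openin_chart[OF assms] openin_subset by blast
  then show ?thesis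
    using homeomorphic_imp_injective_map[OF homeomorphic_map_chart[OF assms]]
    by (simp add: Int_absorb1)
qed

lemma chart_inv_chart:
  "smooth_manifold M \<Longrightarrow> c \<in> atlas M \<Longrightarrow> p \<in> fst c \<Longrightarrow> chart_inv c (snd c p) = p"
  unfolding chart_inv_def using chart_inj_on by (metis inv_into_f_f)

lemma chart_inv_in: "y \<in> snd c ` fst c \<Longrightarrow> chart_inv c y \<in> fst c"
  and chart_chart_inv: "y \<in> snd c ` fst c \<Longrightarrow> snd c (chart_inv c y) = y"
  unfolding chart_inv_def by (rule inv_into_into f_inv_into_f, assumption)+

lemma open_chart_image_Int:
  assumes M: "smooth_manifold M" "c \<in> atlas M" and W: "openin (mtop M) W"
  shows "open (snd c ` (fst c \<inter> W))"
proof -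
  have sub: "fst c \<subseteq> topspace (mtop M)" using openin_chart[OF M] openin_subset by blast
  have "openin (subtopology (mtop M) (fst c)) (fst c \<inter> W)"
    using W by (simp add: openin_subtopology_Int2)
  then have "openin (top_of_set (snd c ` fst c)) (snd c ` (fst c \<inter> W))"
    using iffD1[OF homeomorphic_map_openness_eq[OF homeomorphic_map_chart[OF M]]] by simp
  then show ?thesis
    using open_chart_image[OF M] openin_open_eq by blast
qed

lemma continuous_map_chart_inv:
  assumes M: "smooth_manifold M" "c \<in> atlas M"
  shows "continuous_map (top_of_set (snd c ` fst c)) (mtop M) (chart_inv c)"
  unfolding continuous_map_def
proof (intro conjI allI impI)
  show "chart_inv c \<in> topspace (top_of_set (snd c ` fst c)) \<rightarrow> topspace (mtop M)"
    using chart_topspace[OF M chart_inv_in] by (simp add: Pi_iff del: image_iff)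
next
  fix U assume U: "openin (mtop M) U"
  have "{y \<in> topspace (top_of_set (snd c ` fst c)). chart_inv c y \<in> U} = snd c ` (fst c \<inter> U)"
    by (auto simp: chart_inv_chart[OF M])
  then show "openin (top_of_set (snd c ` fst c)) {y \<in> topspace (top_of_set (snd c ` fst c)). chart_inv c y \<in> U}"
    using open_chart_image_Int[OF M U] open_subset by (metis Int_lower1 image_mono)
qed

lemma chart_at:
  assumes "smooth_manifold M" "p \<in> topspace (mtop M)"
  shows "chart_at M p \<in> atlas M" "p \<in> fst (chart_at M p)"
proof -
  have "\<exists>c. c \<in> atlas M \<and> p \<in> fst c"
    using assms unfolding smooth_manifold_def by blast
  from someI_ex[OF this] show "chart_at M p \<in> atlas M" "p \<in> fst (chart_at M p)"
    unfolding chart_at_def by blast+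
qed

section \<open>Derivatives of smooth maps in charts\<close>

lemma smooth_map_rep:
  assumes M: "smooth_manifold M" and N: "smooth_manifold N" and f: "smooth_map M N f"
    and c: "c \<in> atlas M" and d: "d \<in> atlas N"
  shows "smooth_on (snd c ` (fst c \<inter> f -` fst d)) (snd d \<circ> f \<circ> chart_inv c)"
    and "open (snd c ` (fst c \<inter> f -` fst d))"
proof -
  show "smooth_on (snd c ` (fst c \<inter> f -` fst d)) (snd d \<circ> f \<circ> chart_inv c)"
    using f c d unfolding smooth_map_def by blast
  have "fst c \<inter> f -` fst d = fst c \<inter> {x \<in> topspace (mtop M). f x \<in> fst d}"
    using chart_topspace[OF M c] by auto
  moreover have "openin (mtop M) {x \<in> topspace (mtop M). f x \<in> fst d}"
    using f openin_chart[OF N d] unfolding smooth_map_def by (auto intro: openin_continuous_map_preimage)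
  ultimately show "open (snd c ` (fst c \<inter> f -` fst d))"
    using open_chart_image_Int[OF M c] by metis
qed

lemma smooth_map_topspace:
  "smooth_map M N f \<Longrightarrow> p \<in> topspace (mtop M) \<Longrightarrow> f p \<in> topspace (mtop N)"
  unfolding smooth_map_def using continuous_map_image_subset_topspace by fastforce

lemma smooth_map_ident: "smooth_manifold M \<Longrightarrow> smooth_map M M (\<lambda>x. x)"
  unfolding smooth_map_def smooth_manifold_def by (auto simp: comp_def vimage_def)

text \<open>\<open>tangent_map\<close> uses the selected charts, which may jump from point to point.
  Here the charts are free, so that they can stay fixed while the point varies.\<close>

definition tangent_in ::
    "('a, 'e::euclidean_space) chart \<Rightarrow> ('b, 'f::euclidean_space) chart \<Rightarrow> ('a \<Rightarrow> 'b) \<Rightarrow> 'a \<Rightarrow> 'e \<Rightarrow> 'f" where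
  "tangent_in c d f p = deriv_at (snd d \<circ> f \<circ> chart_inv c) (snd c p)"

lemma tangent_map_eq_tangent_in:
  "tangent_map M N f p = tangent_in (chart_at M p) (chart_at N (f p)) f p"
  by (simp add: tangent_map_def tangent_in_def coord_at_def)

lemma has_derivative_tangent_in:
  assumes "smooth_manifold M" "smooth_manifold N" "smooth_map M N f"
    "c \<in> atlas M" "p \<in> fst c" "d \<in> atlas N" "f p \<in> fst d"
  shows "((snd d \<circ> f \<circ> chart_inv c) has_derivative tangent_in c d f p) (at (snd c p))"
  unfolding tangent_in_def
  using assms by (intro smooth_on_has_derivative[OF smooth_map_rep(1)[where M=M and N=N]]) auto

lemma linear_tangent_in:
  assumes "smooth_manifold M" "smooth_manifold N" "smooth_map M N f"
    "c \<in> atlas M" "p \<in> fst c" "d \<in> atlas N" "f p \<in> fst d"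
  shows "linear (tangent_in c d f p)"
  using has_derivative_tangent_in[OF assms] has_derivative_linear by blast

text \<open>\<open>F\<close> need only agree with the composite on the manifold: identities such as
  associativity or the unit law hold on the carrier and not for all elements of the type.\<close>

lemma has_derivative_tangent_in_chain:
  assumes M: "smooth_manifold M" and N: "smooth_manifold N" and P: "smooth_manifold P"
    and f: "smooth_map M N f" and h: "smooth_map N P h"
    and c: "c \<in> atlas M" "p \<in> fst c" and d: "d \<in> atlas N" "f p \<in> fst d" and e: "e \<in> atlas P" "h (f p) \<in> fst e"
    and F: "\<And>q. q \<in> topspace (mtop M) \<Longrightarrow> F q = h (f q)"
  shows "((snd e \<circ> F \<circ> chart_inv c) has_derivative
    (\<lambda>v. tangent_in d e h (f p) (tangent_in c d f p v))) (at (snd c p))"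
proof -
  let ?S = "snd c ` (fst c \<inter> f -` fst d)"
  have S: "open ?S" "snd c p \<in> ?S"
    using smooth_map_rep(2)[OF M N f c(1) d(1)] c d by auto
  have pe: "(snd d \<circ> f \<circ> chart_inv c) (snd c p) = snd d (f p)"
    by (simp add: chart_inv_chart[OF M c])
  have "((\<lambda>z. (snd e \<circ> h \<circ> chart_inv d) ((snd d \<circ> f \<circ> chart_inv c) z)) has_derivative
      (\<lambda>v. tangent_in d e h (f p) (tangent_in c d f p v))) (at (snd c p))"
    by (rule has_derivative_compose[OF has_derivative_tangent_in[OF M N f c d]
          has_derivative_tangent_in[OF N P h d e, folded pe]])
  moreover have "(snd e \<circ> h \<circ> chart_inv d) ((snd d \<circ> f \<circ> chart_inv c) z) = (snd e \<circ> F \<circ> chart_inv c) z"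
    if "z \<in> ?S" for z
    using that by (auto simp: chart_inv_chart[OF M c(1)] chart_inv_chart[OF N d(1)] F chart_topspace[OF M c(1)])
  ultimately show ?thesis
    using has_derivative_cong_open[OF S] by (metis (no_types, lifting))
qed

lemma tangent_in_chain:
  assumes "smooth_manifold M" "smooth_manifold N" "smooth_manifold P" "smooth_map M N f" "smooth_map N P h"
    "c \<in> atlas M" "p \<in> fst c" "d \<in> atlas N" "f p \<in> fst d" "e \<in> atlas P" "h (f p) \<in> fst e"
    "\<And>q. q \<in> topspace (mtop M) \<Longrightarrow> F q = h (f q)"
  shows "tangent_in c e F p v = tangent_in d e h (f p) (tangent_in c d f p v)"
  using deriv_at_eqI[OF has_derivative_tangent_in_chain[OF assms]] by (simp add: tangent_in_def)

lemma tangent_in_ident: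
  assumes M: "smooth_manifold M" and c: "c \<in> atlas M" "p \<in> fst c"
  shows "tangent_in c c (\<lambda>x. x) p v = v"
proof -
  have S: "open (snd c ` fst c)" "snd c p \<in> snd c ` fst c"
    using open_chart_image[OF M c(1)] c by auto
  have "deriv_at (snd c \<circ> (\<lambda>x. x) \<circ> chart_inv c) (snd c p) = deriv_at (\<lambda>x. x) (snd c p)"
    by (rule deriv_at_cong_open[OF S]) (simp add: chart_chart_inv)
  then show ?thesis by (simp add: tangent_in_def)
qed

text \<open>The tangent map of the identity between two charts is the Jacobian of the transition
  map, so both change-of-chart rules are chain rules.\<close>

lemma tangent_in_comp_ident:
  assumes M: "smooth_manifold M" and N: "smooth_manifold N" and f: "smooth_map M N f"
    and c: "c \<in> atlas M" "p \<in> fst c" and d: "d \<in> atlas N" "f p \<in> fst d"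
  shows "c' \<in> atlas M \<Longrightarrow> p \<in> fst c' \<Longrightarrow> tangent_in c' d f p (tangent_in c c' (\<lambda>x. x) p v) = tangent_in c d f p v"
    and "d' \<in> atlas N \<Longrightarrow> f p \<in> fst d' \<Longrightarrow> tangent_in d d' (\<lambda>x. x) (f p) (tangent_in c d f p v) = tangent_in c d' f p v"
  using tangent_in_chain[OF M M N smooth_map_ident[OF M] f c _ _ d, of c' f v]
    tangent_in_chain[OF M N N f smooth_map_ident[OF N] c d, of d' f v] by simp_all

lemma coord_chart:
  assumes M: "smooth_manifold M" and c: "c \<in> atlas M" "p \<in> fst c"
  shows "coord M c X (snd c p) = tangent_in (chart_at M p) c (\<lambda>x. x) p (X p)"
  by (simp add: coord_def Let_def chart_inv_chart[OF M c] tangent_in_def coord_at_def comp_def)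

lemma tangent_in_coord:
  assumes M: "smooth_manifold M" and N: "smooth_manifold N" and f: "smooth_map M N f"
    and c: "c \<in> atlas M" "p \<in> fst c" and d: "d \<in> atlas N" "f p \<in> fst d"
  shows "tangent_in c d f p (coord M c X (snd c p)) = tangent_in (chart_at M p) d f p (X p)"
proof -
  have p: "p \<in> topspace (mtop M)" by (rule chart_topspace[OF M c])
  show ?thesis
    unfolding coord_chart[OF M c] by (rule tangent_in_comp_ident(1)[OF M N f chart_at[OF M p] d c])
qed

lemma coord_chart_at:
  assumes M: "smooth_manifold M" and p: "p \<in> topspace (mtop M)"
  shows "coord M (chart_at M p) X (coord_at M p) = X p"
  unfolding coord_at_def coord_chart[OF M chart_at[OF M p]] by (rule tangent_in_ident[OF M chart_at[OF M p]])

lemma coord_related: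
  assumes M: "smooth_manifold M" and N: "smooth_manifold N" and f: "smooth_map M N f"
    and c: "c \<in> atlas M" "p \<in> fst c" and d: "d \<in> atlas N" "f p \<in> fst d"
    and rel: "tangent_map M N f p (X p) = X' (f p)"
  shows "coord N d X' (snd d (f p)) = tangent_in c d f p (coord M c X (snd c p))"
proof -
  have p: "p \<in> topspace (mtop M)" by (rule chart_topspace[OF M c])
  have fp: "f p \<in> topspace (mtop N)" by (rule chart_topspace[OF N d])
  have "coord N d X' (snd d (f p)) = tangent_in (chart_at N (f p)) d (\<lambda>x. x) (f p) (tangent_map M N f p (X p))"
    by (simp add: coord_chart[OF N d] rel)
  also have "\<dots> = tangent_in (chart_at M p) d f p (X p)"
    unfolding tangent_map_eq_tangent_in
    by (rule tangent_in_comp_ident(2)[OF M N f chart_at[OF M p] chart_at[OF N fp] d])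
  also have "\<dots> = tangent_in c d f p (coord M c X (snd c p))"
    by (simp add: tangent_in_coord[OF M N f c d])
  finally show ?thesis .
qed

section \<open>Vector fields and brackets in a fixed chart\<close>

lemma smooth_vf_coord: "smooth_vf M X \<Longrightarrow> c \<in> atlas M \<Longrightarrow> smooth_on (snd c ` fst c) (coord M c X)"
  by (simp add: smooth_vf_def)

lemma smooth_vf_differentiable:
  "smooth_vf M X \<Longrightarrow> c \<in> atlas M \<Longrightarrow> p \<in> fst c \<Longrightarrow> coord M c X differentiable (at (snd c p))"
  using smooth_on_differentiable[OF smooth_vf_coord] by blast

lemma vf_bracket_eq_field_bracket:
  assumes "smooth_manifold M" "p \<in> topspace (mtop M)"
  shows "vf_bracket M X Y p = field_bracket (coord M (chart_at M p) X) (coord M (chart_at M p) Y) (coord_at M p)"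
  by (simp add: vf_bracket_def field_bracket_def coord_chart_at[OF assms])

lemma tangent_in_field_bracket:
  assumes M: "smooth_manifold M" and N: "smooth_manifold N" and f: "smooth_map M N f"
    and c: "c \<in> atlas M" "p \<in> fst c" and d: "d \<in> atlas N" "f p \<in> fst d"
    and X: "smooth_vf M X" "smooth_vf N X'" "\<And>q. q \<in> topspace (mtop M) \<Longrightarrow> tangent_map M N f q (X q) = X' (f q)"
    and Y: "smooth_vf M Y" "smooth_vf N Y'" "\<And>q. q \<in> topspace (mtop M) \<Longrightarrow> tangent_map M N f q (Y q) = Y' (f q)"
  shows "tangent_in c d f p (field_bracket (coord M c X) (coord M c Y) (snd c p))
    = field_bracket (coord N d X') (coord N d Y') (snd d (f p))"
proof -
  let ?S = "snd c ` (fst c \<inter> f -` fst d)" and ?\<phi> = "snd d \<circ> f \<circ> chart_inv c"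
  have S: "open ?S" "snd c p \<in> ?S" and \<phi>: "smooth_on ?S ?\<phi>"
    using smooth_map_rep[OF M N f c(1) d(1)] c d by auto
  have \<phi>_chart: "?\<phi> (snd c q) = snd d (f q)" if "q \<in> fst c" for q
    by (simp add: chart_inv_chart[OF M c(1) that])
  have rel: "coord N d Z' (?\<phi> z) = deriv_at ?\<phi> z (coord M c Z z)"
    if "\<And>q. q \<in> topspace (mtop M) \<Longrightarrow> tangent_map M N f q (Z q) = Z' (f q)" and z: "z \<in> ?S" for Z Z' z
  proof -
    obtain q where q: "q \<in> fst c" "f q \<in> fst d" "z = snd c q" using z by auto
    show ?thesis
      using coord_related[OF M N f c(1) q(1) d(1) q(2), where X=Z and X'=Z'] that(1) chart_topspace[OF M c(1) q(1)]
      unfolding q(3) \<phi>_chart[OF q(1)] tangent_in_def by blast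
  qed
  have "deriv_at ?\<phi> (snd c p) (field_bracket (coord M c X) (coord M c Y) (snd c p))
    = field_bracket (coord N d X') (coord N d Y') (?\<phi> (snd c p))"
    by (rule field_bracket_related[OF S \<phi>])
      (use X Y c d in \<open>simp_all add: smooth_vf_differentiable rel del: o_apply add: \<phi>_chart\<close>)
  then show ?thesis by (simp only: tangent_in_def \<phi>_chart[OF c(2)])
qed

lemma tangent_map_ident:
  assumes "smooth_manifold M" "p \<in> topspace (mtop M)"
  shows "tangent_map M M (\<lambda>x. x) p v = v"
  unfolding tangent_map_eq_tangent_in by (rule tangent_in_ident[OF assms(1) chart_at[OF assms]])

text \<open>Chart independence of the bracket is its naturality under the identity map. It allows a
  bracket, defined at each point in that point's selected chart, to be differentiated again in a
  single chart.\<close>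

lemma coord_vf_bracket:
  assumes M: "smooth_manifold M" and XY: "smooth_vf M X" "smooth_vf M Y"
    and c: "c \<in> atlas M" "z \<in> snd c ` fst c"
  shows "coord M c (vf_bracket M X Y) z = field_bracket (coord M c X) (coord M c Y) z"
proof -
  obtain p where p: "p \<in> fst c" "z = snd c p" using c by auto
  have pM: "p \<in> topspace (mtop M)" by (rule chart_topspace[OF M c(1) p(1)])
  show ?thesis
    unfolding p(2) coord_chart[OF M c(1) p(1)] vf_bracket_eq_field_bracket[OF M pM] coord_at_def
    by (rule tangent_in_field_bracket[OF M M smooth_map_ident[OF M] chart_at[OF M pM] c(1) p(1) XY(1,1) _ XY(2,2)])
      (simp_all add: tangent_map_ident[OF M])
qed

lemma tangent_map_vf_bracket:
  assumes M: "smooth_manifold M" and N: "smooth_manifold N" and f: "smooth_map M N f"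
    and X: "smooth_vf M X" "smooth_vf N X'" "\<And>q. q \<in> topspace (mtop M) \<Longrightarrow> tangent_map M N f q (X q) = X' (f q)"
    and Y: "smooth_vf M Y" "smooth_vf N Y'" "\<And>q. q \<in> topspace (mtop M) \<Longrightarrow> tangent_map M N f q (Y q) = Y' (f q)"
    and p: "p \<in> topspace (mtop M)"
  shows "tangent_map M N f p (vf_bracket M X Y p) = vf_bracket N X' Y' (f p)"
proof -
  have fp: "f p \<in> topspace (mtop N)" by (rule smooth_map_topspace[OF f p])
  show ?thesis
    unfolding tangent_map_eq_tangent_in vf_bracket_eq_field_bracket[OF M p] vf_bracket_eq_field_bracket[OF N fp] coord_at_def
    by (rule tangent_in_field_bracket[OF M N f chart_at[OF M p] chart_at[OF N fp] X Y])
qed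

lemma field_bracket_cong:
  assumes "open S" "z \<in> S" "\<And>w. w \<in> S \<Longrightarrow> x w = x' w" "\<And>w. w \<in> S \<Longrightarrow> y w = y' w"
  shows "field_bracket x y z = field_bracket x' y' z"
  unfolding field_bracket_def
  using deriv_at_cong_open[OF assms(1,2), of x x'] deriv_at_cong_open[OF assms(1,2), of y y'] assms by simp

lemma vf_bracket_Jacobi:
  assumes M: "smooth_manifold M" and XYZ: "smooth_vf M X" "smooth_vf M Y" "smooth_vf M Z"
    and p: "p \<in> topspace (mtop M)"
  shows "vf_bracket M X (vf_bracket M Y Z) p + vf_bracket M Y (vf_bracket M Z X) p
    + vf_bracket M Z (vf_bracket M X Y) p = 0"
proof -
  let ?c = "chart_at M p"
  have S: "open (snd ?c ` fst ?c)" "coord_at M p \<in> snd ?c ` fst ?c"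
    using open_chart_image[OF M] chart_at[OF M p] by (auto simp: coord_at_def)
  \<comment> \<open>The outer bracket differentiates the inner one, so the inner one has to be
    rewritten on the whole chart domain and not only at \<open>p\<close>.\<close>
  have nested: "vf_bracket M A (vf_bracket M B C) p
      = field_bracket (coord M ?c A) (field_bracket (coord M ?c B) (coord M ?c C)) (coord_at M p)"
    if "smooth_vf M B" "smooth_vf M C" for A B C
    unfolding vf_bracket_eq_field_bracket[OF M p, of A]
    by (rule field_bracket_cong[OF S]) (simp_all add: coord_vf_bracket[OF M that chart_at(1)[OF M p]])
  show ?thesis
    unfolding nested[OF XYZ(2,3)] nested[OF XYZ(3,1)] nested[OF XYZ(1,2)]
    by (intro field_bracket_Jacobi[OF S] smooth_vf_coord XYZ chart_at[OF M p])
qed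

lemma vf_bracket_antisym: "vf_bracket M X Y p = - vf_bracket M Y X p"
  by (simp add: vf_bracket_def)

lemma coord_cong:
  assumes M: "smooth_manifold M" "c \<in> atlas M" and "y \<in> snd c ` fst c"
    "\<And>p. p \<in> topspace (mtop M) \<Longrightarrow> X p = Y p"
  shows "coord M c X y = coord M c Y y"
  using assms(3,4) by (auto simp: coord_chart[OF M] chart_topspace[OF M])

lemma vf_bracket_cong:
  assumes M: "smooth_manifold M" and p: "p \<in> topspace (mtop M)"
    and eq: "\<And>q. q \<in> topspace (mtop M) \<Longrightarrow> X q = X' q" "\<And>q. q \<in> topspace (mtop M) \<Longrightarrow> Y q = Y' q"
  shows "vf_bracket M X Y p = vf_bracket M X' Y' p"
proof -
  let ?c = "chart_at M p"
  have S: "open (snd ?c ` fst ?c)" "coord_at M p \<in> snd ?c ` fst ?c"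
    using open_chart_image[OF M] chart_at[OF M p] by (auto simp: coord_at_def)
  show ?thesis
    unfolding vf_bracket_eq_field_bracket[OF M p]
    by (rule field_bracket_cong[OF S]) (simp_all add: coord_cong[OF M chart_at(1)[OF M p] _ eq(1)] coord_cong[OF M chart_at(1)[OF M p] _ eq(2)])
qed

lemma smooth_vf_cong:
  assumes M: "smooth_manifold M" and eq: "\<And>q. q \<in> topspace (mtop M) \<Longrightarrow> X q = X' q"
  shows "smooth_vf M X \<longleftrightarrow> smooth_vf M X'"
proof -
  have "smooth_on (snd c ` fst c) (coord M c X) \<longleftrightarrow> smooth_on (snd c ` fst c) (coord M c X')" if c: "c \<in> atlas M" for c
    by (rule smooth_on_cong[OF open_chart_image[OF M c] coord_cong[OF M c _ eq]])
  then show ?thesis by (simp add: smooth_vf_def)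
qed

section \<open>Linear operations on smooth fields\<close>

lemma linear_coord_chart:
  assumes M: "smooth_manifold M" and c: "c \<in> atlas M" "p \<in> fst c"
  shows "linear (tangent_in (chart_at M p) c (\<lambda>x. x) p)"
  by (rule linear_tangent_in[OF M M smooth_map_ident[OF M] chart_at[OF M chart_topspace[OF M c]] c])

lemma coord_add:
  assumes M: "smooth_manifold M" and c: "c \<in> atlas M" "y \<in> snd c ` fst c"
  shows "coord M c (\<lambda>q. X q + Y q) y = coord M c X y + coord M c Y y"
  using c(2) by (auto simp: coord_chart[OF M c(1)] linear_add[OF linear_coord_chart[OF M c(1)]])

lemma coord_scaleR:
  assumes M: "smooth_manifold M" and c: "c \<in> atlas M" "y \<in> snd c ` fst c"
  shows "coord M c (\<lambda>q. f q *\<^sub>R X q) y = f (chart_inv c y) *\<^sub>R coord M c X y"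
  using c(2) by (auto simp: coord_chart[OF M c(1)] chart_inv_chart[OF M c(1)] linear_cmul[OF linear_coord_chart[OF M c(1)]])

lemma smooth_vf_add:
  assumes M: "smooth_manifold M" and XY: "smooth_vf M X" "smooth_vf M Y"
  shows "smooth_vf M (\<lambda>q. X q + Y q)"
  unfolding smooth_vf_def
proof
  fix c assume c: "c \<in> atlas M"
  show "smooth_on (snd c ` fst c) (coord M c (\<lambda>q. X q + Y q))"
    by (subst smooth_on_cong[OF open_chart_image[OF M c] coord_add[OF M c]])
      (auto intro!: smooth_on_add open_chart_image[OF M c] smooth_vf_coord XY c)
qed

lemma smooth_vf_scaleR:
  assumes M: "smooth_manifold M" and f: "smooth_fun M f" and X: "smooth_vf M X"
  shows "smooth_vf M (\<lambda>q. f q *\<^sub>R X q)"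
  unfolding smooth_vf_def
proof
  fix c assume c: "c \<in> atlas M"
  have "smooth_on (snd c ` fst c) (\<lambda>y. f (chart_inv c y))"
    using f c by (simp add: smooth_fun_def comp_def)
  then show "smooth_on (snd c ` fst c) (coord M c (\<lambda>q. f q *\<^sub>R X q))"
    by (subst smooth_on_cong[OF open_chart_image[OF M c] coord_scaleR[OF M c]])
      (auto intro!: smooth_on_scaleR open_chart_image[OF M c] smooth_vf_coord X c)
qed

lemma smooth_fun_constant_on:
  assumes M: "smooth_manifold M" and f: "\<And>p. p \<in> topspace (mtop M) \<Longrightarrow> f p = k"
  shows "smooth_fun M f"
  unfolding smooth_fun_def
proof
  fix c assume c: "c \<in> atlas M"
  have "(f \<circ> chart_inv c) y = k" if "y \<in> snd c ` fst c" for y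
    using chart_inv_in[OF that] f chart_topspace[OF M c] by simp
  then show "smooth_on (snd c ` fst c) (f \<circ> chart_inv c)"
    by (subst smooth_on_cong[OF open_chart_image[OF M c], where g="\<lambda>y. k"]) simp_all
qed

lemma vf_deriv_constant_on:
  assumes M: "smooth_manifold M" and f: "\<And>p. p \<in> topspace (mtop M) \<Longrightarrow> f p = k"
    and p: "p \<in> topspace (mtop M)"
  shows "vf_deriv M X f p = 0"
proof -
  let ?c = "chart_at M p"
  have S: "open (snd ?c ` fst ?c)" "coord_at M p \<in> snd ?c ` fst ?c"
    using open_chart_image[OF M] chart_at[OF M p] by (auto simp: coord_at_def)
  have "deriv_at (f \<circ> chart_inv ?c) (coord_at M p) = deriv_at (\<lambda>y. k) (coord_at M p)"
    by (rule deriv_at_cong_open[OF S])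
      (use f[OF chart_topspace[OF M chart_at(1)[OF M p] chart_inv_in]] in \<open>simp del: image_iff\<close>)
  then show ?thesis by (simp add: vf_deriv_def)
qed

lemma smooth_vf_sum:
  assumes M: "smooth_manifold M" and X: "\<And>i. i \<in> I \<Longrightarrow> smooth_vf M (X i)" and I: "finite I"
  shows "smooth_vf M (\<lambda>q. \<Sum>i\<in>I. X i q)"
  using I X
proof (induction I rule: finite_induct)
  case empty
  have "smooth_on (snd c ` fst c) (coord M c (\<lambda>q. 0))" if "c \<in> atlas M" for c
  proof -
    have "coord M c (\<lambda>q. 0) y = 0" if "y \<in> snd c ` fst c" for y
      using coord_scaleR[OF M \<open>c \<in> atlas M\<close> that, of "\<lambda>_. 0" "\<lambda>_. 0"] by simp
    then show ?thesis
      by (subst smooth_on_cong[OF open_chart_image[OF M that], where g="\<lambda>y. 0"]) simp_all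
  qed
  then show ?case by (simp add: smooth_vf_def)
next
  case (insert i I)
  then show ?case by (simp add: smooth_vf_add[OF M])
qed

lemma vf_bracket_add_left:
  assumes M: "smooth_manifold M" and XY: "smooth_vf M X" "smooth_vf M Y" and Z: "smooth_vf M Z"
    and p: "p \<in> topspace (mtop M)"
  shows "vf_bracket M (\<lambda>q. X q + Y q) Z p = vf_bracket M X Z p + vf_bracket M Y Z p"
    and "vf_bracket M (\<lambda>q. k *\<^sub>R X q) Z p = k *\<^sub>R vf_bracket M X Z p"
proof -
  let ?c = "chart_at M p"
  note c = chart_at[OF M p]
  have S: "open (snd ?c ` fst ?c)" "coord_at M p \<in> snd ?c ` fst ?c"
    using open_chart_image[OF M] c by (auto simp: coord_at_def)
  have d: "coord M ?c X differentiable (at (coord_at M p))" "coord M ?c Y differentiable (at (coord_at M p))"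
    unfolding coord_at_def using XY c by (auto intro: smooth_vf_differentiable)
  have "deriv_at (coord M ?c (\<lambda>q. X q + Y q)) (coord_at M p)
      = deriv_at (\<lambda>y. coord M ?c X y + coord M ?c Y y) (coord_at M p)"
    by (rule deriv_at_cong_open[OF S]) (simp add: coord_add[OF M c(1)])
  also have "\<dots> = (\<lambda>v. deriv_at (coord M ?c X) (coord_at M p) v + deriv_at (coord M ?c Y) (coord_at M p) v)"
    by (intro deriv_at_eqI has_derivative_add has_derivative_deriv_at d)
  finally have add: "deriv_at (coord M ?c (\<lambda>q. X q + Y q)) (coord_at M p) v
      = deriv_at (coord M ?c X) (coord_at M p) v + deriv_at (coord M ?c Y) (coord_at M p) v" for v
    by simp
  have "deriv_at (coord M ?c (\<lambda>q. k *\<^sub>R X q)) (coord_at M p) = deriv_at (\<lambda>y. k *\<^sub>R coord M ?c X y) (coord_at M p)"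
    by (rule deriv_at_cong_open[OF S]) (simp add: coord_scaleR[OF M c(1)])
  also have "\<dots> = (\<lambda>v. k *\<^sub>R deriv_at (coord M ?c X) (coord_at M p) v)"
    by (intro deriv_at_eqI has_derivative_scaleR_right has_derivative_deriv_at d)
  finally have scale: "deriv_at (coord M ?c (\<lambda>q. k *\<^sub>R X q)) (coord_at M p) v
      = k *\<^sub>R deriv_at (coord M ?c X) (coord_at M p) v" for v
    by simp
  show "vf_bracket M (\<lambda>q. X q + Y q) Z p = vf_bracket M X Z p + vf_bracket M Y Z p"
    "vf_bracket M (\<lambda>q. k *\<^sub>R X q) Z p = k *\<^sub>R vf_bracket M X Z p"
    using smooth_vf_differentiable[OF Z c, folded coord_at_def]
    by (simp_all add: vf_bracket_def add scale linear_add[OF linear_deriv_at] linear_cmul[OF linear_deriv_at] algebra_simps)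
qed

section \<open>Lie groups\<close>

locale Lie_group = group G for G :: "('a, 'm) monoid_scheme" (structure) +
  fixes M :: "('a, 'e::euclidean_space) manifold"
  assumes lie_group: "lie_group G M"
begin

lemma smooth_manifold: "smooth_manifold M"
  and topspace_eq_carrier: "topspace (mtop M) = carrier G"
  and smooth_map_mult: "smooth_map (prod_manifold M M) M (\<lambda>(x, y). x \<otimes> y)"
  using lie_group by (simp_all add: lie_group_def)

lemmas chart_carrier = chart_topspace[OF smooth_manifold, unfolded topspace_eq_carrier]
lemmas chart_at_carrier = chart_at[OF smooth_manifold, unfolded topspace_eq_carrier]
lemmas chart_inv_simp = chart_inv_chart[OF smooth_manifold]

text \<open>The two chart inverses are taken separately instead of inverting the product chart.
  Translations then arise by freezing one argument, and invariant fields are partial derivatives of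
  this one map.\<close>

definition mult_rep :: "('a, 'e) chart \<Rightarrow> ('a, 'e) chart \<Rightarrow> ('a, 'e) chart \<Rightarrow> 'e \<times> 'e \<Rightarrow> 'e" where
  "mult_rep c d e = (\<lambda>(y, z). snd e (chart_inv c y \<otimes> chart_inv d z))"

definition mult_dom :: "('a, 'e) chart \<Rightarrow> ('a, 'e) chart \<Rightarrow> ('a, 'e) chart \<Rightarrow> ('e \<times> 'e) set" where
  "mult_dom c d e = {(y, z). y \<in> snd c ` fst c \<and> z \<in> snd d ` fst d \<and> chart_inv c y \<otimes> chart_inv d z \<in> fst e}"

lemma continuous_map_mult: "continuous_map (prod_topology (mtop M) (mtop M)) (mtop M) (\<lambda>(x, y). x \<otimes> y)"
  using smooth_map_mult by (simp add: smooth_map_def prod_manifold_def)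

lemma open_mult_dom:
  assumes c: "c \<in> atlas M" and d: "d \<in> atlas M" and e: "e \<in> atlas M"
  shows "open (mult_dom c d e)"
proof -
  let ?A = "snd c ` fst c" and ?B = "snd d ` fst d"
  have AB: "open (?A \<times> ?B)"
    by (intro open_Times open_chart_image[OF smooth_manifold] c d)
  have "continuous_map (top_of_set (?A \<times> ?B)) (top_of_set ?A) fst"
    "continuous_map (top_of_set (?A \<times> ?B)) (top_of_set ?B) snd"
    by (auto simp: continuous_map_iff_continuous2 continuous_on_fst continuous_on_snd continuous_on_id)
  then have "continuous_map (top_of_set (?A \<times> ?B)) (mtop M) (chart_inv c \<circ> fst)"
    "continuous_map (top_of_set (?A \<times> ?B)) (mtop M) (chart_inv d \<circ> snd)"
    using continuous_map_compose continuous_map_chart_inv[OF smooth_manifold] c d by blast+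
  then have "continuous_map (top_of_set (?A \<times> ?B)) (prod_topology (mtop M) (mtop M))
      (\<lambda>w. ((chart_inv c \<circ> fst) w, (chart_inv d \<circ> snd) w))"
    by (rule continuous_map_pairedI)
  from continuous_map_compose[OF this continuous_map_mult]
  have "openin (top_of_set (?A \<times> ?B)) {w \<in> topspace (top_of_set (?A \<times> ?B)).
    ((\<lambda>(x, y). x \<otimes> y) \<circ> (\<lambda>w. ((chart_inv c \<circ> fst) w, (chart_inv d \<circ> snd) w))) w \<in> fst e}"
    by (rule openin_continuous_map_preimage) (rule openin_chart[OF smooth_manifold e])
  moreover have "{w \<in> topspace (top_of_set (?A \<times> ?B)).
    ((\<lambda>(x, y). x \<otimes> y) \<circ> (\<lambda>w. ((chart_inv c \<circ> fst) w, (chart_inv d \<circ> snd) w))) w \<in> fst e} = mult_dom c d e"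
    by (auto simp: mult_dom_def)
  ultimately show ?thesis
    by (metis (no_types, lifting) AB openin_open_trans)
qed

lemma smooth_on_mult_rep:
  assumes c: "c \<in> atlas M" and d: "d \<in> atlas M" and e: "e \<in> atlas M"
  shows "smooth_on (mult_dom c d e) (mult_rep c d e)"
proof -
  let ?cd = "(fst c \<times> fst d, map_prod (snd c) (snd d))" and ?m = "\<lambda>(x, y). x \<otimes> y"
  have inj: "inj_on (map_prod (snd c) (snd d)) (fst c \<times> fst d)"
    using chart_inj_on[OF smooth_manifold] c d by (intro map_prod_inj_on)
  have inv: "chart_inv ?cd (snd c p, snd d q) = (p, q)" if "p \<in> fst c" "q \<in> fst d" for p q
    using inv_into_f_f[OF inj, of "(p, q)"] that by (simp add: chart_inv_def)
  have "?cd \<in> atlas (prod_manifold M M)"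
    using c d unfolding prod_manifold_def manifold.simps by blast
  then have "smooth_on (snd ?cd ` (fst ?cd \<inter> ?m -` fst e)) (snd e \<circ> ?m \<circ> chart_inv ?cd)"
    using smooth_map_mult e unfolding smooth_map_def by blast
  moreover have "snd ?cd ` (fst ?cd \<inter> ?m -` fst e) = mult_dom c d e"
    by (force simp: mult_dom_def chart_inv_simp c d)
  ultimately have "smooth_on (mult_dom c d e) (snd e \<circ> ?m \<circ> chart_inv ?cd)"
    by simp
  moreover have "(snd e \<circ> ?m \<circ> chart_inv ?cd) w = mult_rep c d e w" if w: "w \<in> mult_dom c d e" for w
  proof -
    obtain p q where "p \<in> fst c" "q \<in> fst d" "w = (snd c p, snd d q)"
      using w by (auto simp: mult_dom_def)
    then show ?thesis by (simp add: mult_rep_def inv chart_inv_simp c d)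
  qed
  ultimately show ?thesis
    by (subst smooth_on_cong[OF open_mult_dom[OF assms], symmetric])
qed

lemma mult_rep_chart:
  "c \<in> atlas M \<Longrightarrow> d \<in> atlas M \<Longrightarrow> x \<in> fst c \<Longrightarrow> y \<in> fst d \<Longrightarrow>
    mult_rep c d e (snd c x, snd d y) = snd e (x \<otimes> y)"
  by (simp add: mult_rep_def chart_inv_simp)

lemma mult_dom_chart:
  "c \<in> atlas M \<Longrightarrow> d \<in> atlas M \<Longrightarrow> x \<in> fst c \<Longrightarrow> y \<in> fst d \<Longrightarrow> x \<otimes> y \<in> fst e \<Longrightarrow>
    (snd c x, snd d y) \<in> mult_dom c d e"
  by (auto simp: mult_dom_def chart_inv_simp)

lemma continuous_map_left_mult: "a \<in> carrier G \<Longrightarrow> continuous_map (mtop M) (mtop M) (\<lambda>y. a \<otimes> y)"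
  and continuous_map_right_mult: "a \<in> carrier G \<Longrightarrow> continuous_map (mtop M) (mtop M) (\<lambda>y. y \<otimes> a)"
proof -
  assume a: "a \<in> carrier G"
  have "continuous_map (mtop M) (prod_topology (mtop M) (mtop M)) (\<lambda>y. (a, y))"
    "continuous_map (mtop M) (prod_topology (mtop M) (mtop M)) (\<lambda>y. (y, a))"
    using a by (auto intro!: continuous_map_pairedI simp: topspace_eq_carrier)
  from this[THEN continuous_map_compose, OF continuous_map_mult]
  show "continuous_map (mtop M) (mtop M) (\<lambda>y. a \<otimes> y)" "continuous_map (mtop M) (mtop M) (\<lambda>y. y \<otimes> a)"
    by (simp_all add: comp_def)
qed

lemma smooth_map_left_mult:
  assumes a: "a \<in> carrier G" shows "smooth_map M M (\<lambda>y. a \<otimes> y)"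
  unfolding smooth_map_def
proof (intro conjI ballI)
  show cont: "continuous_map (mtop M) (mtop M) (\<lambda>y. a \<otimes> y)" by (rule continuous_map_left_mult[OF a])
  fix c d assume c: "c \<in> atlas M" and d: "d \<in> atlas M"
  let ?S = "snd c ` (fst c \<inter> (\<lambda>y. a \<otimes> y) -` fst d)" and ?ca = "chart_at M a"
  note ca = chart_at_carrier[OF a]
  have "?S = snd c ` (fst c \<inter> {y \<in> topspace (mtop M). a \<otimes> y \<in> fst d})"
    using chart_topspace[OF smooth_manifold c] by auto
  then have S: "open ?S"
    using open_chart_image_Int[OF smooth_manifold c openin_continuous_map_preimage[OF cont openin_chart[OF smooth_manifold d]]]
    by simp
  have "smooth_on ?S (\<lambda>y. mult_rep ?ca c d (snd ?ca a, y))"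
    by (rule smooth_on_compose[OF S open_mult_dom[OF ca(1) c d] _ _ smooth_on_mult_rep[OF ca(1) c d]])
      (auto intro!: smooth_on_Pair S smooth_on_ident mult_dom_chart ca c)
  then show "smooth_on ?S (snd d \<circ> (\<lambda>y. a \<otimes> y) \<circ> chart_inv c)"
    by (simp add: mult_rep_def chart_inv_simp ca comp_def)
qed

lemma smooth_map_right_mult:
  assumes a: "a \<in> carrier G" shows "smooth_map M M (\<lambda>y. y \<otimes> a)"
  unfolding smooth_map_def
proof (intro conjI ballI)
  show cont: "continuous_map (mtop M) (mtop M) (\<lambda>y. y \<otimes> a)" by (rule continuous_map_right_mult[OF a])
  fix c d assume c: "c \<in> atlas M" and d: "d \<in> atlas M"
  let ?S = "snd c ` (fst c \<inter> (\<lambda>y. y \<otimes> a) -` fst d)" and ?ca = "chart_at M a"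
  note ca = chart_at_carrier[OF a]
  have "?S = snd c ` (fst c \<inter> {y \<in> topspace (mtop M). y \<otimes> a \<in> fst d})"
    using chart_topspace[OF smooth_manifold c] by auto
  then have S: "open ?S"
    using open_chart_image_Int[OF smooth_manifold c openin_continuous_map_preimage[OF cont openin_chart[OF smooth_manifold d]]]
    by simp
  have "smooth_on ?S (\<lambda>y. mult_rep c ?ca d (y, snd ?ca a))"
    by (rule smooth_on_compose[OF S open_mult_dom[OF c ca(1) d] _ _ smooth_on_mult_rep[OF c ca(1) d]])
      (auto intro!: smooth_on_Pair S smooth_on_ident mult_dom_chart ca c)
  then show "smooth_on ?S (snd d \<circ> (\<lambda>y. y \<otimes> a) \<circ> chart_inv c)"
    by (simp add: mult_rep_def chart_inv_simp ca comp_def)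
qed

lemma has_derivative_mult_rep:
  assumes "c \<in> atlas M" "d \<in> atlas M" "e \<in> atlas M" "x \<in> fst c" "y \<in> fst d" "x \<otimes> y \<in> fst e"
  shows "(mult_rep c d e has_derivative deriv_at (mult_rep c d e) (snd c x, snd d y)) (at (snd c x, snd d y))"
  using assms by (intro smooth_on_has_derivative[OF smooth_on_mult_rep] mult_dom_chart)

lemma tangent_in_left_mult:
  assumes a: "ca \<in> atlas M" "a \<in> fst ca" and x: "c \<in> atlas M" "x \<in> fst c" and e: "e \<in> atlas M" "a \<otimes> x \<in> fst e"
  shows "tangent_in c e (\<lambda>y. a \<otimes> y) x v = deriv_at (mult_rep ca c e) (snd ca a, snd c x) (0, v)"
proof -
  have "((\<lambda>y. mult_rep ca c e (snd ca a, y)) has_derivative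
      (\<lambda>v. deriv_at (mult_rep ca c e) (snd ca a, snd c x) (0, v))) (at (snd c x))"
    by (rule has_derivative_compose[where f="\<lambda>y. (snd ca a, y)" and g="mult_rep ca c e",
          OF _ has_derivative_mult_rep[OF a(1) x(1) e(1) a(2) x(2) e(2)]])
      (auto intro!: derivative_eq_intros)
  moreover have "(\<lambda>y. mult_rep ca c e (snd ca a, y)) = snd e \<circ> (\<lambda>y. a \<otimes> y) \<circ> chart_inv c"
    by (simp add: mult_rep_def chart_inv_simp a comp_def)
  ultimately show ?thesis
    unfolding tangent_in_def by (simp add: deriv_at_eqI)
qed

lemma tangent_in_right_mult:
  assumes a: "ca \<in> atlas M" "a \<in> fst ca" and x: "c \<in> atlas M" "x \<in> fst c" and e: "e \<in> atlas M" "x \<otimes> a \<in> fst e"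
  shows "tangent_in c e (\<lambda>y. y \<otimes> a) x v = deriv_at (mult_rep c ca e) (snd c x, snd ca a) (v, 0)"
proof -
  have "((\<lambda>y. mult_rep c ca e (y, snd ca a)) has_derivative
      (\<lambda>v. deriv_at (mult_rep c ca e) (snd c x, snd ca a) (v, 0))) (at (snd c x))"
    by (rule has_derivative_compose[where f="\<lambda>y. (y, snd ca a)" and g="mult_rep c ca e",
          OF _ has_derivative_mult_rep[OF x(1) a(1) e(1) x(2) a(2) e(2)]])
      (auto intro!: derivative_eq_intros)
  moreover have "(\<lambda>y. mult_rep c ca e (y, snd ca a)) = snd e \<circ> (\<lambda>y. y \<otimes> a) \<circ> chart_inv c"
    by (simp add: mult_rep_def chart_inv_simp a comp_def)
  ultimately show ?thesis
    unfolding tangent_in_def by (simp add: deriv_at_eqI)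
qed

section \<open>Invariant vector fields\<close>

abbreviation "LV \<equiv> left_invariant_vf G M"
abbreviation "br \<equiv> lie_bracket G M"

definition right_invariant_vf :: "'e \<Rightarrow> 'a \<Rightarrow> 'e" where
  "right_invariant_vf u p = tangent_map M M (\<lambda>y. y \<otimes> p) \<one> u"

abbreviation "c1 \<equiv> chart_at M \<one>"
abbreviation "x1 \<equiv> snd c1 \<one>"

lemmas chart1 = chart_at_carrier[OF one_closed]

text \<open>The first form shows the field as a partial derivative of the multiplication at a point
  depending smoothly on \<open>p\<close>, which gives smoothness of the field; the second is the
  intermediate form in charts.\<close>

lemma coord_left_invariant_vf:
  assumes c: "c \<in> atlas M" "p \<in> fst c"
  shows "coord M c (LV u) (snd c p) = deriv_at (mult_rep c c1 c) (snd c p, x1) (0, u)"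
    and "coord M c (LV u) (snd c p) = tangent_in c1 c (\<lambda>y. p \<otimes> y) \<one> u"
proof -
  have p: "p \<in> carrier G" by (rule chart_carrier[OF c])
  have "coord M c (LV u) (snd c p) = tangent_in (chart_at M p) c (\<lambda>x. x) p (tangent_in c1 (chart_at M p) (\<lambda>y. p \<otimes> y) \<one> u)"
    by (simp add: coord_chart[OF smooth_manifold c] left_invariant_vf_def tangent_map_eq_tangent_in p)
  also have "\<dots> = tangent_in c1 c (\<lambda>y. p \<otimes> y) \<one> u"
    using tangent_in_comp_ident(2)[OF smooth_manifold smooth_manifold smooth_map_left_mult[OF p] chart1 chart_at_carrier(1)[OF p], of c u]
      chart_at_carrier[OF p] c p by simp
  finally show 1: "coord M c (LV u) (snd c p) = tangent_in c1 c (\<lambda>y. p \<otimes> y) \<one> u" .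
  show "coord M c (LV u) (snd c p) = deriv_at (mult_rep c c1 c) (snd c p, x1) (0, u)"
    unfolding 1 by (rule tangent_in_left_mult[OF c chart1 c(1)]) (simp add: c p)
qed

lemma coord_right_invariant_vf:
  assumes c: "c \<in> atlas M" "p \<in> fst c"
  shows "coord M c (right_invariant_vf u) (snd c p) = deriv_at (mult_rep c1 c c) (x1, snd c p) (u, 0)"
    and "coord M c (right_invariant_vf u) (snd c p) = tangent_in c1 c (\<lambda>y. y \<otimes> p) \<one> u"
proof -
  have p: "p \<in> carrier G" by (rule chart_carrier[OF c])
  have "coord M c (right_invariant_vf u) (snd c p)
      = tangent_in (chart_at M p) c (\<lambda>x. x) p (tangent_in c1 (chart_at M p) (\<lambda>y. y \<otimes> p) \<one> u)"
    by (simp add: coord_chart[OF smooth_manifold c] right_invariant_vf_def tangent_map_eq_tangent_in p)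
  also have "\<dots> = tangent_in c1 c (\<lambda>y. y \<otimes> p) \<one> u"
    using tangent_in_comp_ident(2)[OF smooth_manifold smooth_manifold smooth_map_right_mult[OF p] chart1 chart_at_carrier(1)[OF p], of c u]
      chart_at_carrier[OF p] c p by simp
  finally show 1: "coord M c (right_invariant_vf u) (snd c p) = tangent_in c1 c (\<lambda>y. y \<otimes> p) \<one> u" .
  show "coord M c (right_invariant_vf u) (snd c p) = deriv_at (mult_rep c1 c c) (x1, snd c p) (u, 0)"
    unfolding 1 by (rule tangent_in_right_mult[OF c chart1 c(1)]) (simp add: c p)
qed

lemma smooth_vf_left_invariant: "smooth_vf M (LV u)"
  unfolding smooth_vf_def
proof
  fix c assume c: "c \<in> atlas M"
  have S: "open (snd c ` fst c)" by (rule open_chart_image[OF smooth_manifold c])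
  have "smooth_on (snd c ` fst c) (\<lambda>y. deriv_at (mult_rep c c1 c) (y, x1) (0, u))"
    by (rule smooth_on_compose[OF S open_mult_dom[OF c chart1(1) c] _ _ smooth_on_deriv_at[OF smooth_on_mult_rep[OF c chart1(1) c]]])
      (auto intro!: smooth_on_Pair S smooth_on_ident mult_dom_chart chart1 c simp: chart_carrier[OF c])
  then show "smooth_on (snd c ` fst c) (coord M c (LV u))"
    by (subst smooth_on_cong[OF S]) (auto simp: coord_left_invariant_vf(1)[OF c])
qed

lemma smooth_vf_right_invariant: "smooth_vf M (right_invariant_vf u)"
  unfolding smooth_vf_def
proof
  fix c assume c: "c \<in> atlas M"
  have S: "open (snd c ` fst c)" by (rule open_chart_image[OF smooth_manifold c])
  have "smooth_on (snd c ` fst c) (\<lambda>y. deriv_at (mult_rep c1 c c) (x1, y) (u, 0))"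
    by (rule smooth_on_compose[OF S open_mult_dom[OF chart1(1) c c] _ _ smooth_on_deriv_at[OF smooth_on_mult_rep[OF chart1(1) c c]]])
      (auto intro!: smooth_on_Pair S smooth_on_ident mult_dom_chart chart1 c simp: chart_carrier[OF c])
  then show "smooth_on (snd c ` fst c) (coord M c (right_invariant_vf u))"
    by (subst smooth_on_cong[OF S]) (auto simp: coord_right_invariant_vf(1)[OF c])
qed

lemma tangent_map_chain:
  assumes "smooth_map M M f" "smooth_map M M h" "p \<in> carrier G" "\<And>q. q \<in> carrier G \<Longrightarrow> F q = h (f q)"
  shows "tangent_map M M F p v = tangent_map M M h (f p) (tangent_map M M f p v)"
proof -
  have "f p \<in> carrier G" "h (f p) \<in> carrier G"
    using smooth_map_topspace assms topspace_eq_carrier by metis+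
  then show ?thesis
    using tangent_in_chain[OF smooth_manifold smooth_manifold smooth_manifold assms(1,2)
        chart_at_carrier[OF assms(3)] chart_at_carrier chart_at_carrier, of F v] assms(3,4)
    by (simp add: tangent_map_eq_tangent_in topspace_eq_carrier)
qed

lemma linear_tangent_map:
  assumes "smooth_map M M f" "p \<in> carrier G"
  shows "linear (tangent_map M M f p)"
proof -
  have "f p \<in> carrier G"
    using smooth_map_topspace assms topspace_eq_carrier by metis
  then show ?thesis
    unfolding tangent_map_eq_tangent_in
    by (intro linear_tangent_in[OF smooth_manifold smooth_manifold] chart_at_carrier assms)
qed

lemma tangent_map_id: "p \<in> carrier G \<Longrightarrow> tangent_map M M (\<lambda>x. x) p v = v"
  using tangent_map_ident[OF smooth_manifold] topspace_eq_carrier by blast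

lemma tangent_map_left_mult_inverse:
  assumes a: "a \<in> carrier G" and p: "p \<in> carrier G"
  shows "tangent_map M M (\<lambda>y. inv a \<otimes> y) (a \<otimes> p) (tangent_map M M (\<lambda>y. a \<otimes> y) p v) = v"
  using tangent_map_chain[OF smooth_map_left_mult[OF a] smooth_map_left_mult[OF inv_closed[OF a]] p, of "\<lambda>x. x" v]
  by (simp add: a p tangent_map_id m_assoc[symmetric])

lemma left_invariant_vf_one: "LV u \<one> = u"
proof -
  \<comment> \<open>Translation by \<one> is the identity on the carrier only, which suffices for
    \<open>tangent_map_chain\<close>.\<close>
  have "tangent_map M M (\<lambda>y. \<one> \<otimes> y) \<one> u = tangent_map M M (\<lambda>y. y) \<one> (tangent_map M M (\<lambda>y. y) \<one> u)"
    by (rule tangent_map_chain[OF smooth_map_ident[OF smooth_manifold] smooth_map_ident[OF smooth_manifold]]) simp_all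
  then show ?thesis by (simp add: left_invariant_vf_def tangent_map_id)
qed

lemma right_invariant_vf_one: "right_invariant_vf u \<one> = u"
proof -
  have "tangent_map M M (\<lambda>y. y \<otimes> \<one>) \<one> u = tangent_map M M (\<lambda>y. y) \<one> (tangent_map M M (\<lambda>y. y) \<one> u)"
    by (rule tangent_map_chain[OF smooth_map_ident[OF smooth_manifold] smooth_map_ident[OF smooth_manifold]]) simp_all
  then show ?thesis by (simp add: right_invariant_vf_def tangent_map_id)
qed

lemma linear_left_invariant_vf: "p \<in> carrier G \<Longrightarrow> linear (\<lambda>u. LV u p)"
  unfolding left_invariant_vf_def by (intro linear_tangent_map smooth_map_left_mult one_closed)

lemma tangent_map_left_invariant_vf:
  assumes a: "a \<in> carrier G" and p: "p \<in> carrier G"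
  shows "tangent_map M M (\<lambda>y. a \<otimes> y) p (LV u p) = LV u (a \<otimes> p)"
  using tangent_map_chain[OF smooth_map_left_mult[OF p] smooth_map_left_mult[OF a] one_closed, of "\<lambda>y. (a \<otimes> p) \<otimes> y" u]
  by (simp add: left_invariant_vf_def a p m_assoc)

lemma inj_left_invariant_vf: "p \<in> carrier G \<Longrightarrow> inj (\<lambda>u. LV u p)"
  unfolding left_invariant_vf_def
  by (rule inj_on_inverseI) (rule tangent_map_left_mult_inverse[OF _ one_closed])

lemma surj_left_invariant_vf:
  assumes p: "p \<in> carrier G"
  obtains u where "LV u p = v"
proof -
  have "LV (tangent_map M M (\<lambda>y. inv p \<otimes> y) p v) p = v"
    using tangent_map_left_mult_inverse[OF inv_closed[OF p] p, of v] p by (simp add: left_invariant_vf_def)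
  then show thesis by (rule that)
qed

section \<open>The Lie algebra of the group\<close>

lemma left_invariant_vf_lie_bracket:
  assumes p: "p \<in> carrier G"
  shows "LV (br u v) p = vf_bracket M (LV u) (LV v) p"
  \<comment> \<open>Left translation by \<open>p\<close> relates each left-invariant field to
    itself, so naturality carries the bracket from \<one> to \<open>p\<close>.\<close>
  using tangent_map_vf_bracket[OF smooth_manifold smooth_manifold smooth_map_left_mult[OF p]
      smooth_vf_left_invariant smooth_vf_left_invariant _ smooth_vf_left_invariant smooth_vf_left_invariant,
      of u u v v \<one>] p
  by (simp add: topspace_eq_carrier tangent_map_left_invariant_vf lie_bracket_def left_invariant_vf_def[of G M "vf_bracket M _ _ _"])

lemma lie_bracket_antisym: "br u v = - br v u"
  unfolding lie_bracket_def by (rule vf_bracket_antisym)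

lemma bilinear_lie_bracket: "bilinear br"
proof -
  have one: "\<one> \<in> topspace (mtop M)" by (simp add: topspace_eq_carrier)
  have l: "linear (\<lambda>u. br u v)" for v
  proof (rule linearI)
    fix u u' k
    have "br (u + u') v = vf_bracket M (\<lambda>q. LV u q + LV u' q) (LV v) \<one>"
      unfolding lie_bracket_def
      by (rule vf_bracket_cong[OF smooth_manifold one]) (simp_all add: topspace_eq_carrier linear_add[OF linear_left_invariant_vf])
    then show "br (u + u') v = br u v + br u' v"
      by (simp add: vf_bracket_add_left(1)[OF smooth_manifold smooth_vf_left_invariant smooth_vf_left_invariant smooth_vf_left_invariant one] lie_bracket_def)
    have "br (k *\<^sub>R u) v = vf_bracket M (\<lambda>q. k *\<^sub>R LV u q) (LV v) \<one>"
      unfolding lie_bracket_def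
      by (rule vf_bracket_cong[OF smooth_manifold one]) (simp_all add: topspace_eq_carrier linear_cmul[OF linear_left_invariant_vf])
    then show "br (k *\<^sub>R u) v = k *\<^sub>R br u v"
      by (simp add: vf_bracket_add_left(2)[OF smooth_manifold smooth_vf_left_invariant smooth_vf_left_invariant smooth_vf_left_invariant one] lie_bracket_def)
  qed
  have "linear (br u)" for u
    using linear_compose_neg[OF l[of u]] by (simp flip: lie_bracket_antisym)
  then show ?thesis using l by (simp add: bilinear_def)
qed

lemma lie_bracket_Jacobi: "br u (br v w) = br (br u v) w + br v (br u w)"
proof -
  have one: "\<one> \<in> topspace (mtop M)" by (simp add: topspace_eq_carrier)
  have nested: "vf_bracket M (LV u) (vf_bracket M (LV v) (LV w)) \<one> = br u (br v w)" for u v w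
    unfolding lie_bracket_def[of _ _ u]
    by (rule vf_bracket_cong[OF smooth_manifold one]) (simp_all add: left_invariant_vf_lie_bracket topspace_eq_carrier)
  have "br u (br v w) + br v (br w u) + br w (br u v) = 0"
    using vf_bracket_Jacobi[OF smooth_manifold smooth_vf_left_invariant smooth_vf_left_invariant smooth_vf_left_invariant one, of u v w]
    by (simp add: nested)
  moreover have "br v (br w u) = - br v (br u w)"
    by (subst lie_bracket_antisym[of w u]) (rule bilinear_rneg[OF bilinear_lie_bracket])
  ultimately show ?thesis
    using lie_bracket_antisym[of w "br u v"] by (simp add: algebra_simps add_eq_0_iff)
qed

text \<open>In a chart at \<open>\<one>\<close> both terms of the bracket are the mixed second derivative of the multiplication.\<close>

lemma vf_bracket_left_right_invariant: "vf_bracket M (LV u) (right_invariant_vf v) \<one> = 0"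
proof -
  let ?\<mu> = "mult_rep c1 c1 c1" and ?W = "mult_dom c1 c1 c1" and ?S = "snd c1 ` fst c1"
  have S: "open ?S" "x1 \<in> ?S"
    using open_chart_image[OF smooth_manifold chart1(1)] chart1(2) by auto
  have W: "open ?W" "(x1, x1) \<in> ?W"
    using chart1 by (auto intro!: open_mult_dom mult_dom_chart)
  have \<mu>: "smooth_on ?W ?\<mu>" by (rule smooth_on_mult_rep[OF chart1(1) chart1(1) chart1(1)])
  have dd: "((\<lambda>z. deriv_at ?\<mu> z w) has_derivative deriv_at (\<lambda>z. deriv_at ?\<mu> z w) (x1, x1)) (at (x1, x1))" for w
    by (rule smooth_on_has_derivative[OF smooth_on_deriv_at[OF \<mu>] W(2)])
  have "deriv_at (coord M c1 (LV u)) x1 = deriv_at (\<lambda>y. deriv_at ?\<mu> (y, x1) (0, u)) x1"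
    by (rule deriv_at_cong_open[OF S]) (auto simp: coord_left_invariant_vf(1)[OF chart1(1)])
  also have "\<dots> = (\<lambda>w. deriv_at (\<lambda>z. deriv_at ?\<mu> z (0, u)) (x1, x1) (w, 0))"
    by (rule deriv_at_eqI, rule has_derivative_compose[where f="\<lambda>y. (y, x1)" and g="\<lambda>z. deriv_at ?\<mu> z (0, u)", OF _ dd])
      (auto intro!: derivative_eq_intros)
  finally have L: "deriv_at (coord M c1 (LV u)) x1 w = deriv_at (\<lambda>z. deriv_at ?\<mu> z (0, u)) (x1, x1) (w, 0)" for w
    by simp
  have "deriv_at (coord M c1 (right_invariant_vf v)) x1 = deriv_at (\<lambda>y. deriv_at ?\<mu> (x1, y) (v, 0)) x1"
    by (rule deriv_at_cong_open[OF S]) (auto simp: coord_right_invariant_vf(1)[OF chart1(1)])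
  also have "\<dots> = (\<lambda>w. deriv_at (\<lambda>z. deriv_at ?\<mu> z (v, 0)) (x1, x1) (0, w))"
    by (rule deriv_at_eqI, rule has_derivative_compose[where f="\<lambda>y. (x1, y)" and g="\<lambda>z. deriv_at ?\<mu> z (v, 0)", OF _ dd])
      (auto intro!: derivative_eq_intros)
  finally have R: "deriv_at (coord M c1 (right_invariant_vf v)) x1 w = deriv_at (\<lambda>z. deriv_at ?\<mu> z (v, 0)) (x1, x1) (0, w)" for w
    by simp
  show ?thesis
    unfolding vf_bracket_def coord_at_def L R left_invariant_vf_one right_invariant_vf_one
    using deriv_at_symmetric[OF W \<mu>] by simp
qed

end

section \<open>Lie subgroups\<close>

lemma openin_chart_inv_image:
  assumes M: "smooth_manifold M" "c \<in> atlas M" and B: "open B" "B \<subseteq> snd c ` fst c"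
  shows "openin (mtop M) (chart_inv c ` B)"
proof -
  have sub: "fst c \<subseteq> topspace (mtop M)" using openin_chart[OF M] openin_subset by blast
  have "continuous_map (subtopology (mtop M) (fst c)) (top_of_set (snd c ` fst c)) (snd c)"
    by (rule homeomorphic_imp_continuous_map[OF homeomorphic_map_chart[OF M]])
  moreover have "openin (top_of_set (snd c ` fst c)) B"
    using B by (simp add: open_subset)
  ultimately have "openin (subtopology (mtop M) (fst c)) {p \<in> topspace (subtopology (mtop M) (fst c)). snd c p \<in> B}"
    by (rule openin_continuous_map_preimage)
  moreover have "{p \<in> topspace (subtopology (mtop M) (fst c)). snd c p \<in> B} = chart_inv c ` B"
  proof (intro subset_antisym subsetI)
    fix p assume "p \<in> {p \<in> topspace (subtopology (mtop M) (fst c)). snd c p \<in> B}"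
    then show "p \<in> chart_inv c ` B"
      using chart_inv_chart[OF M, of p] by (auto intro!: image_eqI[of _ _ "snd c p"])
  next
    fix p assume "p \<in> chart_inv c ` B"
    then obtain y where y: "y \<in> B" "p = chart_inv c y" by blast
    then have "y \<in> snd c ` fst c" using B(2) by blast
    from chart_inv_in[OF this] chart_chart_inv[OF this]
    show "p \<in> {p \<in> topspace (subtopology (mtop M) (fst c)). snd c p \<in> B}"
      using y sub by auto
  qed
  ultimately have "openin (subtopology (mtop M) (fst c)) (chart_inv c ` B)"
    by simp
  then show ?thesis
    by (rule openin_trans_full[OF _ openin_chart[OF M]])
qed

text \<open>A member of a countable base is chosen between the point \<open>k t\<close> and the set
  \<open>U t\<close>; disjointness makes this choice injective in \<open>t\<close>.\<close>

lemma countable_disjoint_openin: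
  assumes X: "second_countable X" and U: "\<And>t. t \<in> T \<Longrightarrow> openin X (U t)" and k: "\<And>t. t \<in> T \<Longrightarrow> k t \<in> U t"
    and disj: "\<And>s t. s \<in> T \<Longrightarrow> t \<in> T \<Longrightarrow> U s \<inter> U t \<noteq> {} \<Longrightarrow> s = t"
  shows "countable T"
proof -
  obtain \<B> where \<B>: "countable \<B>" "\<forall>U x. openin X U \<and> x \<in> U \<longrightarrow> (\<exists>V\<in>\<B>. x \<in> V \<and> V \<subseteq> U)"
    using X unfolding second_countable_def by auto
  have "\<forall>t\<in>T. \<exists>V. V \<in> \<B> \<and> k t \<in> V \<and> V \<subseteq> U t"
    using \<B>(2) U k by meson
  then obtain V where V: "\<And>t. t \<in> T \<Longrightarrow> V t \<in> \<B> \<and> k t \<in> V t \<and> V t \<subseteq> U t"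
    by metis
  have "inj_on V T"
  proof (rule inj_onI)
    fix s t assume st: "s \<in> T" "t \<in> T" "V s = V t"
    then have "k s \<in> U s \<inter> U t" using V[OF st(1)] V[OF st(2)] by auto
    then show "s = t" using disj[OF st(1,2)] by auto
  qed
  moreover have "V ` T \<subseteq> \<B>" using V by blast
  ultimately show ?thesis
    using \<B>(1) by (metis countable_image_inj_on countable_subset)
qed

locale Lie_subgroup = Lie_group G M
  for G :: "('a, 'm) monoid_scheme" (structure) and M :: "('a, 'e::euclidean_space) manifold" +
  fixes K :: "'a set" and N :: "('a, 'f::euclidean_space) manifold"
  assumes lie_subgroup: "lie_subgroup K N G M"
begin

lemma subgroup_K: "subgroup K G"
  and smooth_map_incl: "smooth_map N M (\<lambda>x. x)"
  and lie_group_K: "lie_group (G\<lparr>carrier := K\<rparr>) N"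
  and inj_tangent_incl: "p \<in> K \<Longrightarrow> inj (tangent_map N M (\<lambda>x. x) p)"
  using lie_subgroup by (auto simp: lie_subgroup_def)

text \<open>With its own manifold structure the subgroup is a Lie group, so continuity and
  smoothness of its translations hold in \<open>N\<close>, whose topology may be finer than the one
  induced from \<open>M\<close>.\<close>

sublocale K: Lie_group "G\<lparr>carrier := K\<rparr>" N
  using lie_group_K unfolding Lie_group_def Lie_group_axioms_def lie_group_def by blast

lemma topspace_N: "topspace (mtop N) = K"
  using K.topspace_eq_carrier by simp

lemma K_carrier: "p \<in> K \<Longrightarrow> p \<in> carrier G"
  using subgroup_K subgroup.mem_carrier by metis

lemma one_K: "\<one> \<in> K"
  by (rule subgroup.one_closed[OF subgroup_K])

definition incl :: "'f \<Rightarrow> 'e" where "incl = tangent_map N M (\<lambda>x. x) \<one>"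
definition \<kk> :: "'e set" where "\<kk> = range incl"

lemma lie_subalgebra_eq: "lie_subalgebra_of N G M = \<kk>"
  by (simp add: lie_subalgebra_of_def \<kk>_def incl_def)

abbreviation "cN \<equiv> chart_at N \<one>"
abbreviation "xN \<equiv> snd cN \<one>"

lemma chartN: "cN \<in> atlas N" "\<one> \<in> fst cN"
  using chart_at[OF K.smooth_manifold] one_K topspace_N by blast+

lemma incl_tangent_in: "incl = tangent_in cN c1 (\<lambda>x. x) \<one>"
  by (simp add: incl_def tangent_map_eq_tangent_in)

lemma linear_incl: "linear incl"
  unfolding incl_tangent_in
  by (rule linear_tangent_in[OF K.smooth_manifold smooth_manifold smooth_map_incl chartN chart1])

lemma inj_incl: "inj incl"
  unfolding incl_def by (rule inj_tangent_incl[OF one_K])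

lemma subspace_\<kk>: "subspace \<kk>"
  unfolding \<kk>_def by (intro linear_subspace_image linear_incl subspace_UNIV)

definition incl_rep :: "'f \<Rightarrow> 'e" where "incl_rep = snd c1 \<circ> (\<lambda>x. x) \<circ> chart_inv cN"
definition incl_dom :: "'f set" where "incl_dom = snd cN ` (fst cN \<inter> (\<lambda>x. x) -` fst c1)"

lemma open_incl_dom: "open incl_dom"
  and smooth_on_incl_rep: "smooth_on incl_dom incl_rep"
  unfolding incl_dom_def incl_rep_def
  by (rule smooth_map_rep[OF K.smooth_manifold smooth_manifold smooth_map_incl chartN(1) chart1(1)])+

lemma xN_incl_dom: "xN \<in> incl_dom"
  using chartN(2) chart1(2) by (auto simp: incl_dom_def)

lemma incl_dom_sub: "incl_dom \<subseteq> snd cN ` fst cN"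
  by (auto simp: incl_dom_def)

lemma incl_domD:
  assumes "y \<in> incl_dom"
  shows "chart_inv cN y \<in> fst c1" "chart_inv cN y \<in> K" "incl_rep y = snd c1 (chart_inv cN y)"
  using assms chart_topspace[OF K.smooth_manifold chartN(1)]
  by (auto simp: incl_dom_def incl_rep_def chart_inv_chart[OF K.smooth_manifold chartN(1)] topspace_N)

lemma incl_rep_xN: "incl_rep xN = x1"
  by (simp add: incl_rep_def chart_inv_chart[OF K.smooth_manifold chartN])

lemma has_derivative_incl_rep: "(incl_rep has_derivative incl) (at xN)"
  unfolding incl_rep_def incl_tangent_in
  by (rule has_derivative_tangent_in[OF K.smooth_manifold smooth_manifold smooth_map_incl chartN chart1])

text \<open>The inclusion intertwines right translation by \<open>p\<close> on \<open>K\<close> and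
  on \<open>G\<close>; both sides are the derivative of the same map from \<open>N\<close> to
  \<open>M\<close>. This lets invariance of the restricted metric speak about fields on
  \<open>G\<close>.\<close>

lemma right_invariant_vf_incl:
  assumes p: "p \<in> K"
  shows "right_invariant_vf (incl u) p = tangent_map N M (\<lambda>x. x) p (tangent_map N N (\<lambda>y. y \<otimes> p) \<one> u)"
proof -
  note pG = K_carrier[OF p]
  have pN: "p \<in> topspace (mtop N)" using p topspace_N by simp
  have "right_invariant_vf (incl u) p = tangent_in cN (chart_at M p) (\<lambda>y. y \<otimes> p) \<one> u"
    using tangent_in_chain[OF K.smooth_manifold smooth_manifold smooth_manifold smooth_map_incl smooth_map_right_mult[OF pG]
        chartN chart1, of "chart_at M p" "\<lambda>y. y \<otimes> p" u] chart_at_carrier[OF pG]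
    by (simp add: right_invariant_vf_def tangent_map_eq_tangent_in incl_tangent_in pG)
  also have "\<dots> = tangent_map N M (\<lambda>x. x) p (tangent_map N N (\<lambda>y. y \<otimes> p) \<one> u)"
    using tangent_in_chain[OF K.smooth_manifold K.smooth_manifold smooth_manifold _ smooth_map_incl
        chartN, of "\<lambda>y. y \<otimes> p" "chart_at N p" "chart_at M p" "\<lambda>y. y \<otimes> p" u]
      chart_at_carrier[OF pG] chart_at[OF K.smooth_manifold pN] K.smooth_map_right_mult[of p] p
    by (simp add: tangent_map_eq_tangent_in pG)
  finally show ?thesis .
qed

text \<open>A direction in \<kk> comes from \<open>N\<close>, so the chain rule reduces the
  derivative to that of \<open>F\<close> along the inclusion, which is constant near \<one> in the
  coordinates of \<open>N\<close>. Closedness of \<open>K\<close> is irrelevant here.\<close>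

lemma vf_deriv_constant_on_subgroup:
  assumes F: "smooth_fun M F" and const: "\<And>p. p \<in> K \<Longrightarrow> F p = k" and w: "w \<in> \<kk>"
  shows "vf_deriv M (LV w) F \<one> = 0"
proof -
  obtain w' where w': "w = incl w'" using w by (auto simp: \<kk>_def)
  have "smooth_on (snd c1 ` fst c1) (F \<circ> chart_inv c1)"
    using F chart1(1) by (simp add: smooth_fun_def)
  then have "((F \<circ> chart_inv c1) has_derivative deriv_at (F \<circ> chart_inv c1) x1) (at (incl_rep xN))"
    using chart1(2) by (simp add: incl_rep_xN smooth_on_has_derivative)
  from has_derivative_compose[OF has_derivative_incl_rep this]
  have "deriv_at (\<lambda>y. (F \<circ> chart_inv c1) (incl_rep y)) xN = (\<lambda>v. deriv_at (F \<circ> chart_inv c1) x1 (incl v))"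
    by (rule deriv_at_eqI)
  moreover have "deriv_at (\<lambda>y. (F \<circ> chart_inv c1) (incl_rep y)) xN = deriv_at (\<lambda>y. k) xN"
    by (rule deriv_at_cong_open[OF open_incl_dom xN_incl_dom])
      (simp add: incl_domD const chart_inv_simp chart1)
  ultimately have "deriv_at (F \<circ> chart_inv c1) x1 (incl w') = 0"
    by (metis frechet_derivative_const)
  then show ?thesis
    by (simp add: vf_deriv_def coord_at_def left_invariant_vf_one w')
qed

text \<open>If the curve \<open>\<gamma>\<close> in \<open>K\<close> has initial velocity \<open>incl v\<close> and the claim fails at \<open>a\<close>, then
  \<open>(t, y) \<mapsto> \<gamma> t \<otimes> a \<otimes> y\<close> is injective for small real \<open>t\<close> and \<open>y \<in> K\<close> near \<open>\<one>\<close>.  Hence the translates of a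
  neighbourhood of \<open>\<one>\<close> in \<open>K\<close> by the elements \<open>inv a \<otimes> \<gamma> t \<otimes> a\<close> of \<open>K\<close> are uncountably many
  disjoint open sets.\<close>

lemma right_invariant_vf_tangent:
  assumes normal: "K \<lhd> G" and a: "a \<in> carrier G" and u: "u \<in> \<kk>"
  obtains w where "w \<in> \<kk>" "right_invariant_vf u a = LV w a"
proof (rule ccontr)
  assume "\<not> thesis"
  with that have not_tangent: "right_invariant_vf u a \<noteq> LV w a" if "w \<in> \<kk>" for w
    using that by blast
  obtain v where v: "u = incl v" using u by (auto simp: \<kk>_def)
  let ?ca = "chart_at M a" and ?n = "chart_inv cN"
  note ca = chart_at_carrier[OF a]
  let ?W1 = "mult_dom c1 ?ca ?ca" and ?\<mu>1 = "mult_rep c1 ?ca ?ca"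
  let ?W2 = "mult_dom ?ca c1 ?ca" and ?\<mu>2 = "mult_rep ?ca c1 ?ca"
  \<comment> \<open>Coordinates near \<open>a\<close> of the product with \<open>a\<close> of the
    point of \<open>K\<close> with coordinate \<open>s\<close>.\<close>
  define \<rho> where "\<rho> s = ?\<mu>1 (incl_rep s, snd ?ca a)" for s
  define S1 where "S1 = incl_dom \<inter> (\<lambda>s. (incl_rep s, snd ?ca a)) -` ?W1"
  have W1: "open ?W1" "smooth_on ?W1 ?\<mu>1" and W2: "open ?W2" "smooth_on ?W2 ?\<mu>2"
    by (intro open_mult_dom smooth_on_mult_rep chart1 ca)+
  have S1: "open S1"
    unfolding S1_def
    by (rule continuous_open_preimage[OF _ open_incl_dom W1(1)])
      (intro continuous_on_Pair smooth_on_continuous_on[OF smooth_on_incl_rep] continuous_on_const)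
  have S1_sub: "S1 \<subseteq> incl_dom" by (auto simp: S1_def)
  have \<rho>: "smooth_on S1 \<rho>"
    unfolding \<rho>_def
    by (rule smooth_on_compose[OF S1 W1(1) _ _ W1(2)])
      (auto intro!: smooth_on_Pair S1 smooth_on_subset[OF smooth_on_incl_rep S1_sub], simp add: S1_def)
  have xS1: "xN \<in> S1"
    using xN_incl_dom chart1 ca a by (auto simp: S1_def incl_rep_xN intro!: mult_dom_chart)
  have \<rho>_xN: "\<rho> xN = snd ?ca a"
    using chart1 ca a by (simp add: \<rho>_def incl_rep_xN mult_rep_chart)
  \<comment> \<open>A straight line in the chart of \<open>N\<close> serves as the curve through
    \<one> with initial velocity \<open>v\<close>.\<close>
  define L where "L = (\<lambda>w::real \<times> 'f. xN + fst w *\<^sub>R v)"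
  define S2' where "S2' = L -` S1 \<inter> snd -` incl_dom"
  have contL: "continuous_on A L" for A unfolding L_def by (intro continuous_intros)
  have S2': "open S2'"
    unfolding S2'_def
    by (intro open_Int open_vimage S1 open_incl_dom contL) (intro continuous_intros)
  have smL: "smooth_on A L" if "open A" for A
    unfolding L_def using that
    by (intro smooth_on_add smooth_on_const smooth_on_linear) (auto intro!: linearI simp: algebra_simps)
  have sm\<rho>L: "smooth_on S2' (\<lambda>w. \<rho> (L w))"
    by (rule smooth_on_compose[OF S2' S1 _ smL[OF S2'] \<rho>]) (auto simp: S2'_def)
  have sm_incl: "smooth_on S2' (\<lambda>w. incl_rep (snd w))"
    by (rule smooth_on_compose[OF S2' open_incl_dom _ _ smooth_on_incl_rep])
      (auto simp: S2'_def intro!: smooth_on_linear linear_snd)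
  define h where "h w = (\<rho> (L w), incl_rep (snd w))" for w
  have h: "smooth_on S2' h"
    unfolding h_def by (rule smooth_on_Pair[OF S2' sm\<rho>L sm_incl])
  define S2 where "S2 = S2' \<inter> h -` ?W2"
  have S2: "open S2"
    unfolding S2_def by (rule continuous_open_preimage[OF smooth_on_continuous_on[OF h] S2' W2(1)])
  \<comment> \<open>The triple product is formed by two chart multiplications; \<open>S2\<close> is
    cut down so that the intermediate product also stays in the chart around
    \<open>a\<close>.\<close>
  define \<Psi> where "\<Psi> w = ?\<mu>2 (h w)" for w
  have \<Psi>: "smooth_on S2 \<Psi>"
    unfolding \<Psi>_def
    by (rule smooth_on_compose[OF S2 W2(1) _ smooth_on_subset[OF h] W2(2)]) (auto simp: S2_def)
  have L0: "L (0, y) = xN" for y by (simp add: L_def)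
  have h0: "h (0, xN) = (snd ?ca a, x1)" by (simp add: h_def L0 \<rho>_xN incl_rep_xN)
  have xS2: "(0, xN) \<in> S2"
    using xS1 xN_incl_dom chart1 ca a by (auto simp: S2_def S2'_def L0 h0 intro!: mult_dom_chart)
  have \<Psi>_eq: "\<Psi> w = snd ?ca (?n (L w) \<otimes> a \<otimes> ?n (snd w))" if w: "w \<in> S2" for w
  proof -
    have Lw: "L w \<in> S1" "snd w \<in> incl_dom" using w by (auto simp: S2_def S2'_def)
    then have "L w \<in> incl_dom" "(incl_rep (L w), snd ?ca a) \<in> ?W1" by (auto simp: S1_def)
    then have "?n (L w) \<otimes> a \<in> fst ?ca"
      by (simp add: mult_dom_def incl_domD chart_inv_simp chart1 ca)
    then show ?thesis
      using incl_domD[OF \<open>L w \<in> incl_dom\<close>] incl_domD[OF Lw(2)]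
      by (simp add: \<Psi>_def h_def \<rho>_def mult_rep_chart chart1 ca)
  qed
  have R: "right_invariant_vf x a = deriv_at ?\<mu>1 (x1, snd ?ca a) (x, 0)" for x
    using tangent_in_right_mult[OF ca chart1 ca(1), of x] ca a
    by (simp add: right_invariant_vf_def tangent_map_eq_tangent_in)
  have LVa: "LV x a = deriv_at ?\<mu>2 (snd ?ca a, x1) (0, x)" for x
    using tangent_in_left_mult[OF ca chart1 ca(1), of x] ca a
    by (simp add: left_invariant_vf_def tangent_map_eq_tangent_in)
  \<comment> \<open>The partial derivative in the first slot is that of right translation by \<one>,
    the identity on the carrier.\<close>
  have fst2: "deriv_at ?\<mu>2 (snd ?ca a, x1) (x, 0) = x" for x
  proof -
    have "tangent_in ?ca ?ca (\<lambda>y. y \<otimes> \<one>) a x = tangent_in ?ca ?ca (\<lambda>y. y) a (tangent_in ?ca ?ca (\<lambda>y. y) a x)"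
      using tangent_in_chain[OF smooth_manifold smooth_manifold smooth_manifold
          smooth_map_ident[OF smooth_manifold] smooth_map_ident[OF smooth_manifold] ca ca ca, of "\<lambda>y. y \<otimes> \<one>" x]
      by (simp add: topspace_eq_carrier)
    then show ?thesis
      using tangent_in_right_mult[OF chart1 ca ca(1), of x] ca a
      by (simp add: tangent_in_ident[OF smooth_manifold ca])
  qed
  have d1: "(?\<mu>1 has_derivative deriv_at ?\<mu>1 (x1, snd ?ca a)) (at (x1, snd ?ca a))"
    using chart1 ca a by (intro has_derivative_mult_rep) auto
  have d2: "(?\<mu>2 has_derivative deriv_at ?\<mu>2 (snd ?ca a, x1)) (at (snd ?ca a, x1))"
    using chart1 ca a by (intro has_derivative_mult_rep) auto
  have dL: "(L has_derivative (\<lambda>w. fst w *\<^sub>R v)) (at (0, xN))"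
    unfolding L_def by (auto intro!: derivative_eq_intros)
  have "((\<lambda>s. (incl_rep s, snd ?ca a)) has_derivative (\<lambda>w. (incl w, 0))) (at xN)"
    by (auto intro!: has_derivative_Pair has_derivative_incl_rep)
  from has_derivative_compose[OF this, of ?\<mu>1] d1
  have "(\<rho> has_derivative (\<lambda>w. right_invariant_vf (incl w) a)) (at (L (0, xN)))"
    unfolding \<rho>_def[abs_def] L0 R by (simp add: incl_rep_xN)
  from has_derivative_compose[OF dL this]
  have d\<rho>: "((\<lambda>w. \<rho> (L w)) has_derivative (\<lambda>w. right_invariant_vf (incl (fst w *\<^sub>R v)) a)) (at (0, xN))" .
  have "((\<lambda>w. incl_rep (snd w)) has_derivative (\<lambda>w. incl (snd w))) (at (0, xN))"
    by (rule has_derivative_compose[where f=snd and g=incl_rep])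
      (auto intro!: derivative_eq_intros has_derivative_incl_rep)
  from has_derivative_Pair[OF d\<rho> this]
  have "(h has_derivative (\<lambda>w. (right_invariant_vf (incl (fst w *\<^sub>R v)) a, incl (snd w)))) (at (0, xN))"
    unfolding h_def[abs_def] .
  from has_derivative_compose[OF this, of ?\<mu>2] d2
  have D\<Psi>: "deriv_at \<Psi> (0, xN) = (\<lambda>w. deriv_at ?\<mu>2 (snd ?ca a, x1) (right_invariant_vf (incl (fst w *\<^sub>R v)) a, incl (snd w)))"
    unfolding \<Psi>_def[abs_def] h0 by (intro deriv_at_eqI)
  have lin_R: "linear (\<lambda>x. right_invariant_vf x a)"
    unfolding right_invariant_vf_def by (intro linear_tangent_map smooth_map_right_mult a one_closed)
  have D\<Psi>': "deriv_at \<Psi> (0, xN) (t, y) = t *\<^sub>R right_invariant_vf u a + LV (incl y) a" for t y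
  proof -
    have "deriv_at \<Psi> (0, xN) (t, y)
        = deriv_at ?\<mu>2 (snd ?ca a, x1) ((right_invariant_vf (incl (t *\<^sub>R v)) a, 0) + (0, incl y))"
      by (simp add: D\<Psi>)
    also have "\<dots> = right_invariant_vf (incl (t *\<^sub>R v)) a + LV (incl y) a"
      unfolding linear_add[OF has_derivative_linear[OF d2]] fst2 LVa ..
    finally show ?thesis
      by (simp add: v linear_cmul[OF linear_incl] linear_cmul[OF lin_R])
  qed
  have "inj (deriv_at \<Psi> (0, xN))"
    unfolding linear_injective_0[OF linear_deriv_at[OF smooth_on_differentiable[OF \<Psi> xS2]]]
  proof (intro allI impI)
    fix w assume w: "deriv_at \<Psi> (0, xN) w = 0"
    obtain t y where ty: "w = (t, y)" by (cases w)
    have eq: "t *\<^sub>R right_invariant_vf u a = LV (incl (- y)) a"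
      using w D\<Psi>'[of t y]
      by (simp add: ty linear_neg[OF linear_incl] linear_neg[OF linear_left_invariant_vf[OF a]] eq_neg_iff_add_eq_0)
    \<comment> \<open>Dividing a kernel relation by \<open>t\<close> would exhibit the
      right-invariant vector as a left-invariant one from \<kk>. Once \<open>t = 0\<close>,
      injectivity of \<open>incl\<close> and of left translation removes \<open>y\<close>.\<close>
    have t0: "t = 0"
    proof (rule ccontr)
      assume t: "t \<noteq> 0"
      have "right_invariant_vf u a = (1 / t) *\<^sub>R (t *\<^sub>R right_invariant_vf u a)" using t by simp
      also have "\<dots> = LV (incl ((1 / t) *\<^sub>R (- y))) a"
        by (simp only: eq linear_cmul[OF linear_incl] linear_cmul[OF linear_left_invariant_vf[OF a]])
      finally show False using not_tangent[of "incl ((1 / t) *\<^sub>R (- y))"] by (simp add: \<kk>_def)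
    qed
    then have "LV (incl (- y)) a = LV 0 a"
      using eq by (simp add: linear_0[OF linear_left_invariant_vf[OF a]])
    then have "incl (- y) = incl 0"
      using inj_left_invariant_vf[OF a] by (simp add: inj_def linear_0[OF linear_incl])
    then have "y = 0" using inj_incl by (metis injD neg_equal_0_iff_equal)
    then show "w = 0" by (simp add: ty t0 zero_prod_def)
  qed
  from smooth_on_locally_injective[OF S2 xS2 \<Psi> this]
  obtain r where r: "r > 0" "ball (0, xN) r \<subseteq> S2" "inj_on \<Psi> (ball (0, xN) r)" .
  \<comment> \<open>Half the radius for each factor keeps the product of \<open>T\<close> and
    \<open>B\<close> inside the ball, since the norm of a pair is at most the sum of the
    norms.\<close>
  define T where "T = {0<..<r/2}"
  define B where "B = ball xN (r/2)"
  have TB: "(t, y) \<in> ball (0, xN) r" if "t \<in> T" "y \<in> B" for t y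
  proof -
    have "dist (0, xN) (t, y) = norm (0 - t, xN - y)" by (simp add: dist_norm)
    also have "\<dots> \<le> norm (0 - t) + norm (xN - y)" by (rule norm_Pair_le)
    also have "\<dots> < r" using that by (auto simp: T_def B_def dist_norm)
    finally show ?thesis by simp
  qed
  have TB2: "(t, y) \<in> S2" if "t \<in> T" "y \<in> B" for t y
    using TB[OF that] r(2) by blast
  have TT: "r / 4 \<in> T" using r(1) by (simp add: T_def)
  have BK: "?n y \<in> K" "y \<in> incl_dom" if "y \<in> B" for y
    using TB2[OF TT that] incl_domD(2) by (auto simp: S2_def S2'_def)
  have xB: "xN \<in> B" using r(1) by (simp add: B_def)
  have n_xN: "?n xN = \<one>" by (simp add: chart_inv_chart[OF K.smooth_manifold chartN])
  define \<gamma> where "\<gamma> t = ?n (xN + t *\<^sub>R v)" for t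
  have \<gamma>K: "\<gamma> t \<in> K" if "t \<in> T" for t
    using TB2[OF that xB] incl_domD(2) S1_sub by (auto simp: S2_def S2'_def L_def \<gamma>_def)
  \<comment> \<open>Conjugation moves the curve across \<open>a\<close>, that is,
    \<open>\<gamma> t \<otimes> a = a \<otimes> k t\<close>, and normality keeps \<open>k t\<close>
    in \<open>K\<close>.\<close>
  define k where "k t = inv a \<otimes> \<gamma> t \<otimes> a" for t
  have kK: "k t \<in> K" if "t \<in> T" for t
    unfolding k_def by (rule normal.inv_op_closed1[OF normal a \<gamma>K[OF that]])
  \<comment> \<open>The translate of the neighbourhood of \<one> by \<open>k t\<close>, written as a
    preimage so that continuity of left translation in \<open>N\<close> makes it open there.\<close>
  define U where "U t = {x \<in> topspace (mtop N). inv (k t) \<otimes> x \<in> ?n ` B}" for t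
  have "openin (mtop N) (?n ` B)"
    using BK(2) incl_dom_sub by (intro openin_chart_inv_image[OF K.smooth_manifold chartN(1)]) (auto simp: B_def)
  then have U: "openin (mtop N) (U t)" if "t \<in> T" for t
    using openin_continuous_map_preimage[OF K.continuous_map_left_mult[of "inv (k t)"], of "?n ` B"]
      subgroup.m_inv_closed[OF subgroup_K kK[OF that]] by (simp add: U_def)
  have kU: "k t \<in> U t" if "t \<in> T" for t
    using kK[OF that] K_carrier[OF kK[OF that]] xB n_xN by (auto simp: U_def topspace_N intro!: image_eqI[of _ _ xN])
  have elem: "\<exists>y\<in>B. \<Psi> (t, y) = snd ?ca (a \<otimes> x)" if t: "t \<in> T" and x: "x \<in> U t" for t x
  proof -
    obtain y where y: "y \<in> B" "inv (k t) \<otimes> x = ?n y" using x by (auto simp: U_def)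
    have G: "x \<in> carrier G" "k t \<in> carrier G" "?n y \<in> carrier G" "\<gamma> t \<in> carrier G"
      using x BK(1)[OF y(1)] kK[OF t] \<gamma>K[OF t] K_carrier by (auto simp: U_def topspace_N)
    have "x = k t \<otimes> ?n y"
      using y(2) G by (metis inv_solve_left m_closed)
    then have "a \<otimes> x = a \<otimes> (inv a \<otimes> \<gamma> t \<otimes> a \<otimes> ?n y)" by (simp add: k_def)
    also have "\<dots> = \<gamma> t \<otimes> a \<otimes> ?n y"
      using a G by (simp add: m_assoc[symmetric])
    finally show ?thesis
      using \<Psi>_eq[OF TB2[OF t y(1)]] y(1) by (auto simp: L_def \<gamma>_def)
  qed
  have "s = t" if st: "s \<in> T" "t \<in> T" "U s \<inter> U t \<noteq> {}" for s t
  proof -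
    obtain x where "x \<in> U s" "x \<in> U t" using st(3) by blast
    then obtain y z where "y \<in> B" "z \<in> B" "\<Psi> (s, y) = \<Psi> (t, z)"
      using elem st(1,2) by metis
    then show ?thesis
      using inj_onD[OF r(3), of "(s, y)" "(t, z)"] TB st(1,2) by simp
  qed
  moreover have "second_countable (mtop N)"
    using K.smooth_manifold by (simp add: smooth_manifold_def)
  ultimately have "countable T"
    using countable_disjoint_openin[of "mtop N" T U k] U kU by blast
  then show False
    using r(1) uncountable_open_interval[of 0 "r/2"] by (simp add: T_def)
qed

end

section \<open>Left-invariant foliations\<close>

locale Lie_foliation = Lie_subgroup G M K N
  for G :: "('a, 'm) monoid_scheme" (structure) and M :: "('a, 'e::euclidean_space) manifold"
    and K :: "'a set" and N :: "('a, 'f::euclidean_space) manifold" +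
  fixes g :: "('a, 'e) metric" and nab :: "('a, 'e) connection"
  assumes riemannian: "riemannian_metric M g"
    and left_invariant: "left_invariant_metric G M g"
    and levi_civita: "levi_civita_connection M g nab"
    and normal: "K \<lhd> G"
begin

section \<open>The metric and its connection on the group\<close>

abbreviation "\<V> \<equiv> left_invariant_distribution G M \<kk>"

lemma bilinear_g: "p \<in> carrier G \<Longrightarrow> bilinear (g p)"
  and g_sym: "p \<in> carrier G \<Longrightarrow> g p u v = g p v u"
  and g_pos: "p \<in> carrier G \<Longrightarrow> v \<noteq> 0 \<Longrightarrow> 0 < g p v v"
  and smooth_fun_g: "smooth_vf M X \<Longrightarrow> smooth_vf M Y \<Longrightarrow> smooth_fun M (\<lambda>p. g p (X p) (Y p))"
  using riemannian by (auto simp: riemannian_metric_def topspace_eq_carrier)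

lemma affine: "affine_connection M nab"
  using levi_civita by (simp add: levi_civita_connection_def)

lemma nab_add_left:
  "smooth_vf M X \<Longrightarrow> smooth_vf M Y \<Longrightarrow> smooth_vf M Z \<Longrightarrow> p \<in> carrier G \<Longrightarrow>
    nab (\<lambda>q. X q + Y q) Z p = nab X Z p + nab Y Z p"
  and nab_add_right:
  "smooth_vf M X \<Longrightarrow> smooth_vf M Y \<Longrightarrow> smooth_vf M Z \<Longrightarrow> p \<in> carrier G \<Longrightarrow>
    nab X (\<lambda>q. Y q + Z q) p = nab X Y p + nab X Z p"
  and nab_scale_left:
  "smooth_fun M f \<Longrightarrow> smooth_vf M X \<Longrightarrow> smooth_vf M Y \<Longrightarrow> p \<in> carrier G \<Longrightarrow>
    nab (\<lambda>q. f q *\<^sub>R X q) Y p = f p *\<^sub>R nab X Y p"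
  and nab_scale_right:
  "smooth_fun M f \<Longrightarrow> smooth_vf M X \<Longrightarrow> smooth_vf M Y \<Longrightarrow> p \<in> carrier G \<Longrightarrow>
    nab X (\<lambda>q. f q *\<^sub>R Y q) p = vf_deriv M X f p *\<^sub>R Y p + f p *\<^sub>R nab X Y p"
  using affine by (simp_all add: affine_connection_def topspace_eq_carrier)

lemma torsion_free:
  "smooth_vf M X \<Longrightarrow> smooth_vf M Y \<Longrightarrow> p \<in> carrier G \<Longrightarrow> nab X Y p - nab Y X p = vf_bracket M X Y p"
  using levi_civita by (simp add: levi_civita_connection_def topspace_eq_carrier)

lemma metric_compatible:
  "smooth_vf M X \<Longrightarrow> smooth_vf M Y \<Longrightarrow> smooth_vf M Z \<Longrightarrow> p \<in> carrier G \<Longrightarrow>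
    vf_deriv M X (\<lambda>q. g q (Y q) (Z q)) p = g p (nab X Y p) (Z p) + g p (Y p) (nab X Z p)"
  using levi_civita by (simp add: levi_civita_connection_def topspace_eq_carrier)

lemma g_left_invariant_vf:
  assumes p: "p \<in> carrier G"
  shows "g p (LV u p) (LV v p) = g \<one> u v"
proof -
  have "g (p \<otimes> \<one>) (tangent_map M M (\<lambda>y. p \<otimes> y) \<one> u) (tangent_map M M (\<lambda>y. p \<otimes> y) \<one> v) = g \<one> u v"
    using left_invariant p one_closed unfolding left_invariant_metric_def by blast
  then show ?thesis using p by (simp add: left_invariant_vf_def)
qed

lemma zero_section_smooth:
  assumes "\<And>p. p \<in> carrier G \<Longrightarrow> Z p = 0"
  shows "smooth_vf M Z"
  using smooth_vf_cong[OF smooth_manifold, of Z "\<lambda>q. \<Sum>i\<in>{}. Z q"] smooth_vf_sum[OF smooth_manifold, of "{}" "\<lambda>_. Z"] assms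
  by (simp add: topspace_eq_carrier)

text \<open>A field vanishing on the group need not be the zero function, but it equals its product with the
  indicator function of the complement of the group.\<close>

lemma nab_zero_section:
  assumes Z: "\<And>p. p \<in> carrier G \<Longrightarrow> Z p = 0" and X: "smooth_vf M X" and p: "p \<in> carrier G"
  shows "nab Z X p = 0" and "nab X Z p = 0"
proof -
  define \<theta> where "\<theta> q = (if q \<in> carrier G then 0 else 1 :: real)" for q
  have \<theta>: "smooth_fun M \<theta>"
    by (rule smooth_fun_constant_on[OF smooth_manifold, of _ 0]) (simp add: \<theta>_def topspace_eq_carrier)
  have Z_eq: "Z = (\<lambda>q. \<theta> q *\<^sub>R Z q)"
    using Z by (auto simp: \<theta>_def)
  have "nab (\<lambda>q. \<theta> q *\<^sub>R Z q) X p = 0" "nab X (\<lambda>q. \<theta> q *\<^sub>R Z q) p = 0"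
    using nab_scale_left[OF \<theta> zero_section_smooth[OF Z] X p] nab_scale_right[OF \<theta> X zero_section_smooth[OF Z] p] Z[OF p] p
    by (simp_all add: \<theta>_def)
  then show "nab Z X p = 0" "nab X Z p = 0" by (simp_all flip: Z_eq)
qed

lemma nab_sum_left:
  assumes "finite I" and f: "\<And>i. i \<in> I \<Longrightarrow> smooth_fun M (f i)" and E: "\<And>i. i \<in> I \<Longrightarrow> smooth_vf M (E i)"
    and X: "smooth_vf M X" and p: "p \<in> carrier G"
  shows "nab (\<lambda>q. \<Sum>i\<in>I. f i q *\<^sub>R E i q) X p = (\<Sum>i\<in>I. f i p *\<^sub>R nab (E i) X p)"
  using assms(1) f E
proof (induction I rule: finite_induct)
  case empty
  then show ?case by (simp add: nab_zero_section(1)[OF _ X p])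
next
  case (insert i I)
  have 1: "smooth_vf M (\<lambda>q. f i q *\<^sub>R E i q)" "smooth_vf M (\<lambda>q. \<Sum>i\<in>I. f i q *\<^sub>R E i q)"
    using insert by (auto intro!: smooth_vf_scaleR smooth_vf_sum smooth_manifold)
  have "nab (\<lambda>q. f i q *\<^sub>R E i q) X p = f i p *\<^sub>R nab (E i) X p"
    using insert by (intro nab_scale_left X p) auto
  then show ?case
    using nab_add_left[OF 1 X p] insert by simp
qed

lemma nab_sum_right:
  assumes "finite I" and f: "\<And>i. i \<in> I \<Longrightarrow> smooth_fun M (f i)" and E: "\<And>i. i \<in> I \<Longrightarrow> smooth_vf M (E i)"
    and X: "smooth_vf M X" and p: "p \<in> carrier G"
  shows "nab X (\<lambda>q. \<Sum>i\<in>I. f i q *\<^sub>R E i q) p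
    = (\<Sum>i\<in>I. vf_deriv M X (f i) p *\<^sub>R E i p) + (\<Sum>i\<in>I. f i p *\<^sub>R nab X (E i) p)"
  using assms(1) f E
proof (induction I rule: finite_induct)
  case empty
  then show ?case by (simp add: nab_zero_section(2)[OF _ X p])
next
  case (insert i I)
  have 1: "smooth_vf M (\<lambda>q. f i q *\<^sub>R E i q)" "smooth_vf M (\<lambda>q. \<Sum>i\<in>I. f i q *\<^sub>R E i q)"
    using insert by (auto intro!: smooth_vf_scaleR smooth_vf_sum smooth_manifold)
  have "nab X (\<lambda>q. f i q *\<^sub>R E i q) p = vf_deriv M X (f i) p *\<^sub>R E i p + f i p *\<^sub>R nab X (E i) p"
    using insert by (intro nab_scale_right X p) auto
  then show ?case
    using nab_add_right[OF X 1 p] insert by simp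
qed

section \<open>Vertical sections and their covariant derivatives\<close>

lemma section_of_left_invariant: "u \<in> \<kk> \<Longrightarrow> section_of M \<V> (LV u)"
  by (auto simp: section_of_def smooth_vf_left_invariant left_invariant_distribution_def)

lemma section_of_right_invariant: "u \<in> \<kk> \<Longrightarrow> section_of M \<V> (right_invariant_vf u)"
  using right_invariant_vf_tangent[OF normal]
  by (auto simp: section_of_def smooth_vf_right_invariant left_invariant_distribution_def topspace_eq_carrier image_iff) metis

lemma section_ofD:
  assumes "section_of M \<V> V"
  shows "smooth_vf M V" "p \<in> carrier G \<Longrightarrow> \<exists>v\<in>\<kk>. V p = LV v p"
  using assms by (auto simp: section_of_def left_invariant_distribution_def topspace_eq_carrier)

text \<open>Of an orthonormal left-invariant frame only the expansion at each point is kept.\<close>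

definition vertical_frame :: "'e set \<Rightarrow> bool" where
  "vertical_frame B \<longleftrightarrow> finite B \<and> B \<subseteq> \<kk> \<and>
    (\<forall>p\<in>carrier G. \<forall>v\<in>\<kk>. LV v p = (\<Sum>e\<in>B. g p (LV v p) (LV e p) *\<^sub>R LV e p))"

text \<open>Left translations are isometries, so an orthonormal expansion at \<one> is transported
  to every point with the same coefficients.\<close>

lemma vertical_frame_exists: "\<exists>B. vertical_frame B"
proof -
  obtain B where B: "finite B" "B \<subseteq> \<kk>" "\<And>u. u \<in> \<kk> \<Longrightarrow> u = (\<Sum>e\<in>B. g \<one> u e *\<^sub>R e)"
    using orthonormal_basis_exists[OF bilinear_g[OF one_closed] subspace_\<kk> g_sym[OF one_closed] g_pos[OF one_closed]]
    by metis
  have "LV v p = (\<Sum>e\<in>B. g p (LV v p) (LV e p) *\<^sub>R LV e p)" if "p \<in> carrier G" "v \<in> \<kk>" for p v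
  proof -
    have "LV v p = LV (\<Sum>e\<in>B. g \<one> v e *\<^sub>R e) p"
      using B(3)[OF that(2)] by simp
    also have "\<dots> = (\<Sum>e\<in>B. g p (LV v p) (LV e p) *\<^sub>R LV e p)"
      by (simp only: linear_sum[OF linear_left_invariant_vf[OF that(1)]] linear_cmul[OF linear_left_invariant_vf[OF that(1)]]
          g_left_invariant_vf[OF that(1)])
    finally show ?thesis .
  qed
  then show ?thesis using B(1,2) by (auto simp: vertical_frame_def)
qed

lemma nab_section:
  assumes frame: "vertical_frame B"
    and V: "section_of M \<V> V" and X: "smooth_vf M X" and p: "p \<in> carrier G"
  shows "nab V X p = (\<Sum>e\<in>B. g p (V p) (LV e p) *\<^sub>R nab (LV e) X p)"
    and "nab X V p = (\<Sum>e\<in>B. vf_deriv M X (\<lambda>q. g q (V q) (LV e q)) p *\<^sub>R LV e p)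
      + (\<Sum>e\<in>B. g p (V p) (LV e p) *\<^sub>R nab X (LV e) p)"
proof -
  have B: "finite B" "\<And>p v. p \<in> carrier G \<Longrightarrow> v \<in> \<kk> \<Longrightarrow> LV v p = (\<Sum>e\<in>B. g p (LV v p) (LV e p) *\<^sub>R LV e p)"
    using frame by (auto simp: vertical_frame_def)
  define W where "W q = (\<Sum>e\<in>B. g q (V q) (LV e q) *\<^sub>R LV e q)" for q
  \<comment> \<open>\<open>V\<close> and its expansion \<open>W\<close> agree only on the group. The
    difference vanishes there and contributes nothing, but it is needed to write \<open>V\<close> as
    a sum of functions.\<close>
  define Z where "Z q = V q - W q" for q
  have f: "smooth_fun M (\<lambda>q. g q (V q) (LV e q))" for e
    by (intro smooth_fun_g section_ofD(1)[OF V] smooth_vf_left_invariant)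
  have W: "smooth_vf M W"
    unfolding W_def by (intro smooth_vf_sum smooth_vf_scaleR smooth_manifold f smooth_vf_left_invariant B(1))
  have Z0: "Z q = 0" if "q \<in> carrier G" for q
    using section_ofD(2)[OF V that] B(2)[OF that] by (force simp: Z_def W_def)
  have Z: "smooth_vf M Z" "nab Z X p = 0" "nab X Z p = 0"
    using zero_section_smooth[of Z] nab_zero_section[of Z, OF _ X p] Z0 by blast+
  have V_eq: "V = (\<lambda>q. W q + Z q)" by (simp add: Z_def)
  have "nab V X p = nab W X p + nab Z X p"
    by (subst V_eq) (rule nab_add_left[OF W Z(1) X p])
  then show "nab V X p = (\<Sum>e\<in>B. g p (V p) (LV e p) *\<^sub>R nab (LV e) X p)"
    unfolding W_def[abs_def] Z nab_sum_left[OF B(1) f smooth_vf_left_invariant X p] by simp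
  have "nab X V p = nab X W p + nab X Z p"
    by (subst V_eq) (rule nab_add_right[OF X W Z(1) p])
  then show "nab X V p = (\<Sum>e\<in>B. vf_deriv M X (\<lambda>q. g q (V q) (LV e q)) p *\<^sub>R LV e p)
      + (\<Sum>e\<in>B. g p (V p) (LV e p) *\<^sub>R nab X (LV e) p)"
    unfolding W_def[abs_def] Z nab_sum_right[OF B(1) f smooth_vf_left_invariant X p] by simp
qed

lemma nab_section_tensorial:
  assumes V: "section_of M \<V> V" and X: "smooth_vf M X" and p: "p \<in> carrier G"
    and v: "v \<in> \<kk>" "V p = LV v p"
  shows "nab V X p = nab (LV v) X p"
proof -
  obtain B where B: "vertical_frame B" using vertical_frame_exists by blast
  show ?thesis
    unfolding nab_section(1)[OF B V X p]
      nab_section(1)[OF B section_of_left_invariant[OF v(1)] X p] v(2) ..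
qed

text \<open>The fields commute at \<one>, so vanishing torsion exchanges them; tensoriality then
  replaces the right-invariant direction by the left-invariant one with the same value. Both
  \<open>ideal_\<kk>\<close> and \<open>ad_invariant\<close> rest on this exchange.\<close>

lemma nab_right_invariant:
  assumes u: "u \<in> \<kk>"
  shows "nab (LV x) (right_invariant_vf u) \<one> = nab (LV u) (LV x) \<one>"
proof -
  have "nab (LV x) (right_invariant_vf u) \<one> = nab (right_invariant_vf u) (LV x) \<one>"
    using torsion_free[OF smooth_vf_left_invariant smooth_vf_right_invariant one_closed, of x u]
    by (simp add: vf_bracket_left_right_invariant)
  also have "\<dots> = nab (LV u) (LV x) \<one>"
    by (rule nab_section_tensorial[OF section_of_right_invariant[OF u] smooth_vf_left_invariant one_closed u])
      (simp add: left_invariant_vf_one right_invariant_vf_one)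
  finally show ?thesis .
qed

lemma torsion_free_left_invariant:
  assumes "p \<in> carrier G"
  shows "nab (LV u) (LV v) p - nab (LV v) (LV u) p = LV (br u v) p"
  using assms by (simp add: torsion_free smooth_vf_left_invariant left_invariant_vf_lie_bracket)

text \<open>Since \<open>[LV x, right_invariant_vf u]\<close> vanishes at \<open>\<one>\<close> and the coefficients of
  \<open>right_invariant_vf u\<close> in a vertical left-invariant frame are smooth, \<open>br x u\<close> is vertical.\<close>

lemma ideal_\<kk>:
  assumes u: "u \<in> \<kk>"
  shows "br x u \<in> \<kk>"
proof -
  obtain B where B: "vertical_frame B" using vertical_frame_exists by blast
  note decomp = nab_section(2)[OF B _ smooth_vf_left_invariant one_closed]
  \<comment> \<open>The derivative of the frame coefficients of the right-invariant field. The
    left-invariant field has constant coefficients and the same value at \<one>, so the two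
    covariant derivatives differ by \<open>w\<close>.\<close>
  define w where "w = (\<Sum>e\<in>B. vf_deriv M (LV x) (\<lambda>q. g q (right_invariant_vf u q) (LV e q)) \<one> *\<^sub>R e)"
  have w: "w \<in> \<kk>"
    unfolding w_def using B by (auto simp: vertical_frame_def intro!: subspace_sum[OF subspace_\<kk>] subspace_scale[OF subspace_\<kk>])
  have "vf_deriv M (LV x) (\<lambda>q. g q (LV u q) (LV e q)) \<one> = 0" for e
    by (rule vf_deriv_constant_on[OF smooth_manifold, of _ "g \<one> u e"])
      (simp_all add: topspace_eq_carrier g_left_invariant_vf)
  then have "nab (LV x) (right_invariant_vf u) \<one> = w + nab (LV x) (LV u) \<one>"
    unfolding decomp[OF section_of_right_invariant[OF u]] decomp[OF section_of_left_invariant[OF u]]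
    by (simp add: w_def left_invariant_vf_one right_invariant_vf_one)
  then have "br x u = - w"
    using torsion_free_left_invariant[OF one_closed, of x u]
    by (simp add: nab_right_invariant[OF u] left_invariant_vf_one algebra_simps)
  then show ?thesis using subspace_neg[OF subspace_\<kk> w] by simp
qed

section \<open>Covariant derivatives and brackets of left-invariant fields\<close>

lemma g_nab_left_invariant:
  assumes p: "p \<in> carrier G"
  shows "g p (nab (LV x) (LV u) p) (LV v p) + g p (LV u p) (nab (LV x) (LV v) p) = 0"
proof -
  have "vf_deriv M (LV x) (\<lambda>q. g q (LV u q) (LV v q)) p = 0"
    by (rule vf_deriv_constant_on[OF smooth_manifold, of _ "g \<one> u v"])
      (simp_all add: p topspace_eq_carrier g_left_invariant_vf)
  then show ?thesis
    using metric_compatible[OF smooth_vf_left_invariant smooth_vf_left_invariant smooth_vf_left_invariant p, of x u v] by simp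
qed

text \<open>Vanishing torsion turns both terms into derivatives in direction \<open>LV x\<close>;
  these cancel because inner products of left-invariant fields are constant, and brackets with
  \<open>x\<close> remain. It is applied with \<open>x\<close> in \<kk> for skewness and with
  \<open>x\<close> orthogonal to \<kk> for the second fundamental form.\<close>

lemma g_nab_eq_lie_bracket:
  assumes p: "p \<in> carrier G"
  shows "g p (nab (LV u) (LV x) p) (LV v p) + g p (LV u p) (nab (LV v) (LV x) p)
    = - (g \<one> (br x u) v + g \<one> u (br x v))"
proof -
  note b = bilinear_g[OF p]
  have swap: "nab (LV y) (LV x) p = nab (LV x) (LV y) p - LV (br x y) p" for y
    using torsion_free_left_invariant[OF p, of x y] by (simp add: algebra_simps)
  show ?thesis
    using g_nab_left_invariant[OF p, of x u v]
    by (simp add: swap bilinear_lsub[OF b] bilinear_rsub[OF b] g_left_invariant_vf[OF p])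
qed

section \<open>Biinvariance, semisimplicity and skewness\<close>

lemma g_right_invariant_vf:
  assumes biinv: "biinvariant_metric (G\<lparr>carrier := K\<rparr>) N (restrict_metric N M g)"
    and p: "p \<in> K" and uv: "u \<in> \<kk>" "v \<in> \<kk>"
  shows "g p (right_invariant_vf u p) (right_invariant_vf v p) = g \<one> u v"
proof -
  obtain u' v' where u': "u = incl u'" "v = incl v'" using uv by (auto simp: \<kk>_def)
  have "restrict_metric N M g (\<one> \<otimes> p) (tangent_map N N (\<lambda>y. y \<otimes> p) \<one> u') (tangent_map N N (\<lambda>y. y \<otimes> p) \<one> v')
      = restrict_metric N M g \<one> u' v'"
    using biinv p one_K by (simp add: biinvariant_metric_def right_invariant_metric_def)
  then show ?thesis
    using K_carrier[OF p] unfolding u' right_invariant_vf_incl[OF p] by (simp add: restrict_metric_def incl_def)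
qed

text \<open>The inner product of two right-invariant fields is constant on \<open>K\<close>.
  Differentiating it along \<open>w\<close> at \<one> and applying
  \<open>nab_right_invariant\<close> produces exactly the sum evaluated in
  \<open>g_nab_eq_lie_bracket\<close>.\<close>

lemma ad_invariant:
  assumes biinv: "biinvariant_metric (G\<lparr>carrier := K\<rparr>) N (restrict_metric N M g)"
    and uvw: "u \<in> \<kk>" "v \<in> \<kk>" "w \<in> \<kk>"
  shows "g \<one> (br w u) v = - g \<one> u (br w v)"
proof -
  have "vf_deriv M (LV w) (\<lambda>q. g q (right_invariant_vf u q) (right_invariant_vf v q)) \<one> = 0"
    by (rule vf_deriv_constant_on_subgroup[OF _ g_right_invariant_vf[OF biinv _ uvw(1,2)] uvw(3)])
      (intro smooth_fun_g smooth_vf_right_invariant)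
  then have "g \<one> (nab (LV u) (LV w) \<one>) v + g \<one> u (nab (LV v) (LV w) \<one>) = 0"
    using metric_compatible[OF smooth_vf_left_invariant smooth_vf_right_invariant smooth_vf_right_invariant one_closed, of w u v]
    by (simp add: right_invariant_vf_one nab_right_invariant uvw)
  then show ?thesis
    using g_nab_eq_lie_bracket[OF one_closed, of u w v] by (simp add: left_invariant_vf_one)
qed

text \<open>The centre is an abelian ideal, so it is solvable after one derivation step and vanishes
  by semisimplicity.\<close>

lemma semisimple_centre_trivial:
  assumes ss: "lie_semisimple br \<kk>" and u: "u \<in> \<kk>" "\<And>v. v \<in> \<kk> \<Longrightarrow> br u v = 0"
  shows "u = 0"
proof -
  define I where "I = {u \<in> \<kk>. \<forall>v\<in>\<kk>. br u v = 0}"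
  have "subspace I"
    unfolding I_def using subspace_\<kk> bilinear_lie_bracket
    by (auto simp: subspace_def bilinear_ladd bilinear_lmul bilinear_lzero)
  moreover have "br x y = 0" if "x \<in> \<kk>" "y \<in> I" for x y
    using that lie_bracket_antisym[of x y] by (simp add: I_def)
  moreover have "I \<subseteq> \<kk>" by (auto simp: I_def)
  ultimately have I: "lie_ideal br \<kk> I" "0 \<in> I" "\<And>x y. x \<in> I \<Longrightarrow> y \<in> I \<Longrightarrow> br x y = 0"
    by (auto simp: lie_ideal_def subspace_0)
  have "{br x y | x y. x \<in> I \<and> y \<in> I} = {0}"
    using I(2,3) by auto metis
  then have "(lie_derived br ^^ 1) I = {0}"
    by (simp add: lie_derived_def span_singleton)
  then have "lie_solvable br I" unfolding lie_solvable_def by blast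
  then have "I = {0}" using ss I(1) by (simp add: lie_semisimple_def)
  then show ?thesis using u by (auto simp: I_def)
qed

lemma ad_skew_on_\<kk>:
  assumes ss: "lie_semisimple br \<kk>"
    and biinv: "biinvariant_metric (G\<lparr>carrier := K\<rparr>) N (restrict_metric N M g)"
    and uv: "u \<in> \<kk>" "v \<in> \<kk>"
  shows "g \<one> (br x u) v + g \<one> u (br x v) = 0"
proof -
  have "\<exists>C\<in>\<kk>. \<forall>u\<in>\<kk>. br x u = br C u"
  proof (rule derivation_inner[where b="g \<one>"])
    show "bilinear (g \<one>)" "bilinear br" "linear (br x)" "subspace \<kk>"
      by (simp_all add: bilinear_g bilinear_lie_bracket bilinear_linear_right subspace_\<kk>)
    show "g \<one> u v = g \<one> v u" for u v by (rule g_sym[OF one_closed])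
    show "0 < g \<one> v v" if "v \<noteq> 0" for v by (rule g_pos[OF one_closed that])
    show "br u v \<in> \<kk>" "br x v \<in> \<kk>" if "v \<in> \<kk>" for u v by (rule ideal_\<kk>[OF that])+
    show "br u (br v w) = br (br u v) w + br v (br u w)" "br x (br u v) = br (br x u) v + br u (br x v)" for u v w
      by (rule lie_bracket_Jacobi)+
    show "g \<one> (br u v) w = - g \<one> v (br u w)" if "u \<in> \<kk>" "v \<in> \<kk>" "w \<in> \<kk>" for u v w
      by (rule ad_invariant[OF biinv that(2,3,1)])
    show "u = 0" if "u \<in> \<kk>" "\<And>v. v \<in> \<kk> \<Longrightarrow> br u v = 0" for u
      by (rule semisimple_centre_trivial[OF ss that])
  qed
  then obtain C where C: "C \<in> \<kk>" "\<And>u. u \<in> \<kk> \<Longrightarrow> br x u = br C u"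
    by auto
  show ?thesis using ad_invariant[OF biinv uv C(1)] by (simp add: C uv)
qed

section \<open>Vanishing of the second fundamental form\<close>

lemma orth_proj_eq_0:
  assumes p: "p \<in> carrier G" and S: "0 \<in> S" and v: "\<And>u. u \<in> S \<Longrightarrow> g p v u = 0"
  shows "orth_proj (g p) S v = 0"
  unfolding orth_proj_def
proof (rule the_equality)
  show "0 \<in> S \<and> (\<forall>u\<in>S. g p (v - 0) u = 0)" using S v by simp
  fix w assume w: "w \<in> S \<and> (\<forall>u\<in>S. g p (v - w) u = 0)"
  \<comment> \<open>Testing with \<open>w\<close> itself gives uniqueness, as required by the
    definite description.\<close>
  then have "g p w w = 0"
    using v[of w] bilinear_lsub[OF bilinear_g[OF p], of v w w] by auto
  then show "w = 0" using g_pos[OF p, of w] by fastforce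
qed

lemma totally_geodesic:
  assumes ss: "lie_semisimple br \<kk>"
    and biinv: "biinvariant_metric (G\<lparr>carrier := K\<rparr>) N (restrict_metric N M g)"
  shows "totally_geodesic_foliation M g nab \<V>"
  unfolding totally_geodesic_foliation_def
proof (intro allI impI ballI)
  fix V W p
  assume V: "section_of M \<V> V" and W: "section_of M \<V> W" and pM: "p \<in> topspace (mtop M)"
  then have p: "p \<in> carrier G" by (simp add: topspace_eq_carrier)
  note b = bilinear_g[OF p]
  have "orth_proj (g p) (horizontal g \<V> p) (nab V W p + nab W V p) = 0"
  proof (rule orth_proj_eq_0[OF p])
    show "0 \<in> horizontal g \<V> p" by (simp add: horizontal_def bilinear_lzero[OF b])
    fix h assume h: "h \<in> horizontal g \<V> p"
    \<comment> \<open>The horizontal vector is extended to a left-invariant field, which is then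
      orthogonal to the leaves at every point.\<close>
    obtain x where x: "LV x p = h" using surj_left_invariant_vf[OF p] by metis
    have x_orth: "g \<one> y x = 0" if "y \<in> \<kk>" for y
    proof -
      have "g p (LV x p) (LV y p) = 0"
        using h that by (auto simp: horizontal_def left_invariant_distribution_def x)
      then show ?thesis by (simp add: g_left_invariant_vf[OF p] g_sym[OF one_closed])
    qed
    \<comment> \<open>Because \<open>C\<close> and \<open>LV x\<close> are orthogonal everywhere,
      differentiating their inner product shifts the covariant derivative from the arbitrary section
      to the left-invariant field.\<close>
    have move: "g p (nab A C p) h = - g p (C p) (nab A (LV x) p)"
      if A: "smooth_vf M A" and C: "section_of M \<V> C" for A C
    proof -
      have "g q (C q) (LV x q) = 0" if "q \<in> topspace (mtop M)" for q
      proof -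
        have q: "q \<in> carrier G" using that topspace_eq_carrier by simp
        then obtain y where "y \<in> \<kk>" "C q = LV y q" using section_ofD(2)[OF C] by blast
        then show ?thesis by (simp add: g_left_invariant_vf[OF q] x_orth)
      qed
      then have "vf_deriv M A (\<lambda>q. g q (C q) (LV x q)) p = 0"
        by (rule vf_deriv_constant_on[OF smooth_manifold _ pM])
      then show ?thesis
        using metric_compatible[OF A section_ofD(1)[OF C] smooth_vf_left_invariant p, of x] by (simp add: x)
    qed
    obtain v where v: "v \<in> \<kk>" "V p = LV v p" using section_ofD(2)[OF V p] by blast
    obtain w where w: "w \<in> \<kk>" "W p = LV w p" using section_ofD(2)[OF W p] by blast
    \<comment> \<open>After the shift, \<open>V\<close> and \<open>W\<close> occur only as
      directions and as values at \<open>p\<close>, so tensoriality allows left-invariant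
      representatives.\<close>
    have "g p (nab V W p + nab W V p) h = - (g p (LV w p) (nab (LV v) (LV x) p) + g p (LV v p) (nab (LV w) (LV x) p))"
      using move[OF section_ofD(1)[OF V] W] move[OF section_ofD(1)[OF W] V]
      by (simp add: bilinear_ladd[OF b] v(2) w(2) nab_section_tensorial[OF V smooth_vf_left_invariant p v]
          nab_section_tensorial[OF W smooth_vf_left_invariant p w])
    also have "\<dots> = g \<one> (br x v) w + g \<one> v (br x w)"
      using g_nab_eq_lie_bracket[OF p, of v x w] g_sym[OF p, of "LV w p"] by simp
    also have "\<dots> = 0" by (rule ad_skew_on_\<kk>[OF ss biinv v(1) w(1)])
    finally show "g p (nab V W p + nab W V p) h = 0" .
  qed
  then show "second_fundamental_form g nab (horizontal g \<V>) V W p = 0"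
    by (simp add: second_fundamental_form_def)
qed

end

theorem theorem1p5:
  fixes G :: "('a, 'm) monoid_scheme"
    and M :: "('a, 'e::euclidean_space) manifold"
    and g :: "('a, 'e) metric"
    and nab :: "('a, 'e) connection"
    and K :: "'a set"
    and N :: "('a, 'f::euclidean_space) manifold"
  assumes "lie_group G M"
    and "riemannian_metric M g"
    and "left_invariant_metric G M g"
    and "levi_civita_connection M g nab"
    and "lie_subgroup K N G M"
    and "K \<lhd> G"
    and "lie_semisimple (lie_bracket G M) (lie_subalgebra_of N G M)"
    and "conformal_foliation M g nab (left_invariant_distribution G M (lie_subalgebra_of N G M))"
    and "biinvariant_metric (G\<lparr>carrier := K\<rparr>) N (restrict_metric N M g)"
  shows "totally_geodesic_foliation M g nab (left_invariant_distribution G M (lie_subalgebra_of N G M))"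
proof -
  have "group G" using assms(1) by (simp add: lie_group_def)
  then interpret Lie_foliation G M K N g nab
    using assms by (simp add: Lie_foliation_def Lie_subgroup_def Lie_group_def Lie_group_axioms_def
        Lie_subgroup_axioms_def Lie_foliation_axioms_def)
  show ?thesis
    using assms(7,9) unfolding lie_subalgebra_eq by (rule totally_geodesic)
qed

end
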